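(* Let $p=4r+3$ be a prime, and let $\Gamma_p$, $\gamma$, $M_p=\Gamma_p\backslash\mathbb R^p$ and its two spin structures $\varepsilon_1,\varepsilon_2$ be as defined in the context. Let $\rho:\Gamma_p\to \mathrm U(V)$ be a finite dimensional unitary representation that is trivial on the translation lattice of $\Gamma_p$, with character $\chi_\rho$. Then the eta series of $M_p$ (for the twisted Dirac operator $D_\rho$) for $\varepsilon_1$ and $\varepsilon_2$ are respectively given by $$\eta_{(\Gamma_p,\rho,\varepsilon_1)}(s)=\frac{-2\,\chi_\rho(\gamma)}{\sqrt p\,(2\pi p)^s}\sum_{k=1}^{p-1}\Big(\frac kp\Big)\sum_{l=1}^{p-1}\sin\big(\tfrac{2l\pi k}p\big)\,\zeta\big(s,\tfrac lp\big),$$ $$\eta_{(\Gamma_p,\rho,\varepsilon_2)}(s)=\frac{-2\,\chi_\rho(\gamma)}{\sqrt p\,(2\pi p)^s}\sum_{k=1}^{p-1}(-1)^k\Big(\frac kp\Big)\sum_{l=0}^{p-1}\sin\big(\tfrac{(2l+1)\pi k}p\big)\,\zeta\big(s,\tfrac{2l+1}{2p}\big),$$ and the eta invariants have the expressions $$\eta_{\rho,\varepsilon_1}=\frac{-2\,\chi_\rho(\gamma)}{\sqrt p}\sum_{k=1}^{\frac{p-1}2}\Big(\frac kp\Big)\cot\big(\tfrac{k\pi}p\big),\qquad \eta_{\rho,\varepsilon_2}=\frac{-2\,\chi_\rho(\gamma)}{\sqrt p}\sum_{k=1}^{\frac{p-1}2}(-1)^k\Big(\frac kp\Big)\operatorname{cosec}\big(\tfrac{k\pi}p\big),$$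 where $\big(\frac{\cdot}p\big)$ denotes the Legendre symbol and $\zeta(s,\alpha)=\sum_{j=0}^\infty(j+\alpha)^{-s}$ ($\alpha\in(0,1]$) is the Riemann–Hurwitz zeta function.
   Context: $L_b$ is translation by $b$, and $BL_b$ is the isometry $x\mapsto B(x+b)$ of $\mathbb R^p$; $r(BL_b)=B$. Put $m=\frac{p-1}2=2r+1$. The manifold. Let $e_1,\dots,e_p$ be the canonical basis of $\mathbb R^p$, $\Lambda=\bigoplus\mathbb Ze_i$, and $B$ the linear map with $Be_i=e_{i+1}$ for $1\le i\le p-2$, $Be_{p-1}=-\sum_{i=1}^{p-1}e_i$, $Be_p=e_p$ (of order $p$). Let $D\in\mathrm{GL}_p(\mathbb R)$ with $De_p=e_p$ be such that $C:=DBD^{-1}\in\mathrm{SO}(p)$ is the block diagonal matrix with blocks the rotations $\begin{pmatrix}\cos\theta_j&-\sin\theta_j\\ \sin\theta_j&\cos\theta_j\end{pmatrix}$, $\theta_j=\frac{2\pi j}p$, $1\le j\le m$, followed by $1$. Put $\gamma=CL_{e_p/p}$ and let $\Gamma_p=\langle\gamma,L_{\lambda}:\lambda\in D\Lambda\rangle$; it is a Bieberbach group (discrete, cocompact, torsion-free group of isometries) with translation lattice $D\Lambda$ and holonomy group $\mathbb Z_p$. Let $f_j=De_j$ for $1\le j\le p-1$. Spin group. $Cl(p)$ is the Clifford algebra of $\mathbb R^p$ with $vw+wv=-2\langle v,w\rangle$, $\mathrm{Spin}(p)=\{v_1\cdots v_l:\|v_j\|=1,\ l\text{ even}\}$, $\mu(g)(x)=gxg^{-1}$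 the double cover of $\mathrm{SO}(p)$, and $x(t_1,\dots,t_m)=\prod_{j=1}^m(\cos t_j+\sin t_j\,e_{2j-1}e_{2j})$. Spin structures on $M_p$ correspond to homomorphisms $\varepsilon:\Gamma_p\to\mathrm{Spin}(p)$ with $\mu\circ\varepsilon=r$. $M_p$ has exactly two, given on generators by $\varepsilon_1(L_{f_j})=\varepsilon_2(L_{f_j})=1$ ($1\le j\le p-1$), $\varepsilon_1(L_{e_p})=1$, $\varepsilon_2(L_{e_p})=-1$, $\varepsilon_1(\gamma)=(-1)^{r+1}x(\frac\pi p,\frac{2\pi}p,\dots,\frac{(2r+1)\pi}p)$, $\varepsilon_2(\gamma)=(-1)^{r}x(\frac\pi p,\frac{2\pi}p,\dots,\frac{(2r+1)\pi}p)$ (in the exponents, $r$ is the integer with $p=4r+3$). Dirac operator. $(L,\mathrm S)$ is the irreducible complex representation of $Cl(p)\otimes\mathbb C$ of dimension $2^m$ in which $L(e_p)$ acts by $\mp i$ on the subspace $\mathrm S^\pm$ where $e_1e_2\cdots e_{2m}$ acts by $\pm i^m$. $D_\rho$ acts on smooth $\psi:\mathbb R^p\to\mathrm S\otimes V$ with $\psi(gx)=(L(\varepsilon(g))\otimes\rho(g))\psi(x)$ for all $g\in\Gamma_p$, by $D_\rho \psi=\sum_i(L(e_i)\otimes\mathrm{Id})\,\partial \psi/\partial x_i$. The eta series is $\eta(s)=\sum_{\lambda\ne0}\mathrm{sgn}(\lambda)|\lambda|^{-s}$ over nonzero eigenvalues with multiplicity ($\mathrm{Re}(s)>p$), meromorphically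 continued to $\mathbb C$; it is holomorphic at $s=0$, and the eta invariant is $\eta(0)$.
   Formalization: The printed formulas fail for general ρ (p=3, ρ(γ)=e^{2πi/3} gives non-real η); here χ_ρ(γ^k) stands inside the k-sums (its real part in the eta invariants), and the printed form is proved when χ_ρ(γ^k)=χ_ρ(γ) for 1≤k≤p−1; series formulas are for s≠1. *)

theory Defs
  imports "HOL-Complex_Analysis.Complex_Analysis" "HOL-Number_Theory.Residues"
    "HOL-Algebra.Generated_Groups" "HOL-Library.Function_Algebras"
begin

text \<open>
  Throughout, \<open>\<real>\<^sup>p\<close> is \<open>'n rvec\<close> with \<open>CARD('n) = p\<close>. The index type is linearly ordered, so that
  the canonical basis is the family \<open>ebasis 1, \<dots>, ebasis p\<close>.
\<close>

type_synonym 'n rvec = "(real, 'n) vec"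

section \<open>The Clifford algebra\<close>

text \<open>
  \<open>Cl(p)\<close> in its standard basis: \<open>e\<^sub>I = e\<^bsub>i\<^sub>1\<^esub> \<cdots> e\<^bsub>i\<^sub>k\<^esub>\<close> for \<open>I = {i\<^sub>1 < \<dots> < i\<^sub>k}\<close>, and
  \<open>e\<^sub>I e\<^sub>J = \<plusminus> e\<^bsub>I \<triangle> J\<^esub>\<close>. Each pair \<open>i \<in> I\<close>, \<open>j \<in> J\<close> contributes a factor \<open>-1\<close> if \<open>j < i\<close> (a transposition)
  or \<open>j = i\<close> (from \<open>e\<^sub>i\<^sup>2 = -1\<close>). The characterising relation is lemma \<open>cl_relation\<close> below.
\<close>

typedef (overloaded) ('n :: "{finite,linorder}") clifford = "UNIV :: ('n set \<Rightarrow> real) set"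
  morphisms cl_coeff Clifford by simp

definition cl_sign :: "'n::{finite,linorder} set \<Rightarrow> 'n set \<Rightarrow> real" where
  "cl_sign I J = (\<Prod>i\<in>I. \<Prod>j\<in>J. if j \<le> i then - 1 else 1)"

lemma clifford_eqI: "(\<And>K. cl_coeff a K = cl_coeff b K) \<Longrightarrow> a = b"
  by (metis cl_coeff_inject ext)

lemma cl_coeff_Clifford [simp]: "cl_coeff (Clifford f) = f"
  by (simp add: Clifford_inverse)

instantiation clifford :: ("{finite,linorder}") "{real_vector, times, one}"
begin
definition "0 = Clifford (\<lambda>K. 0)"
definition "1 = Clifford (\<lambda>K. if K = {} then 1 else 0)"
definition "a + b = Clifford (\<lambda>K. cl_coeff a K + cl_coeff b K)"
definition "- a = Clifford (\<lambda>K. - cl_coeff a K)"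
definition "a - b = Clifford (\<lambda>K. cl_coeff a K - cl_coeff b K)"
definition "c *\<^sub>R a = Clifford (\<lambda>K. c * cl_coeff a K)"
definition "a * b = Clifford (\<lambda>K. \<Sum>(I, J) | sym_diff I J = K. cl_sign I J * cl_coeff a I * cl_coeff b J)"
instance
  by standard (auto intro!: clifford_eqI simp: zero_clifford_def plus_clifford_def
      uminus_clifford_def minus_clifford_def scaleR_clifford_def algebra_simps)
end

lemma cl_coeff_times:
  "cl_coeff (a * b) K = (\<Sum>I\<in>UNIV. cl_sign I (sym_diff I K) * cl_coeff a I * cl_coeff b (sym_diff I K))"
proof -
  have "(\<Sum>(I, J) | sym_diff I J = K. cl_sign I J * cl_coeff a I * cl_coeff b J)
      = (\<Sum>I\<in>UNIV. cl_sign I (sym_diff I K) * cl_coeff a I * cl_coeff b (sym_diff I K))"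
  proof (rule sum.reindex_bij_witness[where j = fst and i = "\<lambda>I. (I, sym_diff I K)"])
    fix x assume "x \<in> {(I, J). sym_diff I J = K}"
    then obtain I J where x: "x = (I, J)" and K: "sym_diff I J = K" by blast
    have J: "sym_diff I K = J" unfolding K[symmetric] by auto
    show "(fst x, sym_diff (fst x) K) = x"
      "cl_sign (fst x) (sym_diff (fst x) K) * cl_coeff a (fst x) * cl_coeff b (sym_diff (fst x) K) =
        (case x of (I, J) \<Rightarrow> cl_sign I J * cl_coeff a I * cl_coeff b J)"
      unfolding x fst_conv J by simp_all
  qed auto
  then show ?thesis by (simp add: times_clifford_def)
qed

lemma prod_sym_diff:
  fixes f :: "'a::finite \<Rightarrow> real"
  assumes "\<And>x. f x * f x = 1"
  shows "prod f (sym_diff I J) = prod f I * prod f J"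
proof -
  have "prod f I = prod f (I - J) * prod f (I \<inter> J)"
    by (metis Int_Diff_Un Int_Diff_disjoint finite prod.union_disjoint mult.commute)
  moreover have "prod f J = prod f (J - I) * prod f (I \<inter> J)"
    by (metis Int_Diff_Un Int_Diff_disjoint finite prod.union_disjoint mult.commute inf_commute)
  moreover have "prod f (I \<inter> J) * prod f (I \<inter> J) = 1"
    by (simp add: prod.distrib[symmetric] assms)
  moreover have "prod f (sym_diff I J) = prod f (I - J) * prod f (J - I)"
    by (rule prod.union_disjoint) auto
  ultimately show ?thesis by (simp add: algebra_simps)
qed

lemma cl_sign_left: "cl_sign (sym_diff I J) K = cl_sign I K * cl_sign J K"
  unfolding cl_sign_def by (rule prod_sym_diff) (auto simp flip: prod.distrib intro!: prod.neutral)

lemma cl_sign_right: "cl_sign K (sym_diff I J) = cl_sign K I * cl_sign K J"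
proof -
  have "(\<Prod>j\<in>sym_diff I J. if j \<le> i then - 1 else 1 :: real)
      = (\<Prod>j\<in>I. if j \<le> i then - 1 else 1) * (\<Prod>j\<in>J. if j \<le> i then - 1 else 1)" for i
    by (rule prod_sym_diff) simp
  then show ?thesis unfolding cl_sign_def by (simp add: prod.distrib)
qed

lemma cl_sign_empty [simp]: "cl_sign {} J = 1" "cl_sign I {} = 1"
  by (simp_all add: cl_sign_def)

instance clifford :: ("{finite,linorder}") real_algebra_1
proof
  fix a b c :: "'a clifford" and x :: real
  have sd: "sym_diff (sym_diff I M) (sym_diff I K) = sym_diff M K" for I M K :: "'a set" by auto
  have sd3: "sym_diff (sym_diff I M) (sym_diff M K) = sym_diff I K" for I M K :: "'a set" by auto
  have sd2: "sym_diff I (sym_diff I K) = K" for I K :: "'a set" by auto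
  show "a * b * c = a * (b * c)"
  proof (rule clifford_eqI)
    fix K :: "'a set"
    have "cl_coeff (a * b * c) K = (\<Sum>M\<in>UNIV. \<Sum>I\<in>UNIV.
        cl_sign M (sym_diff M K) * cl_sign I (sym_diff I M) * cl_coeff a I
          * cl_coeff b (sym_diff I M) * cl_coeff c (sym_diff M K))"
      by (simp add: cl_coeff_times sum_distrib_left sum_distrib_right mult_ac)
    also have "\<dots> = (\<Sum>I\<in>UNIV. \<Sum>M\<in>UNIV.
        cl_sign M (sym_diff M K) * cl_sign I (sym_diff I M) * cl_coeff a I
          * cl_coeff b (sym_diff I M) * cl_coeff c (sym_diff M K))"
      by (rule sum.swap)
    also have "\<dots> = (\<Sum>I\<in>UNIV. \<Sum>J\<in>UNIV.
        cl_sign I (sym_diff I K) * cl_sign J (sym_diff J (sym_diff I K)) * cl_coeff a I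
          * cl_coeff b J * cl_coeff c (sym_diff J (sym_diff I K)))"
    proof (rule sum.cong[OF refl])
      fix I :: "'a set"
      have sg: "cl_sign M (sym_diff M K) * cl_sign I (sym_diff I M)
          = cl_sign I (sym_diff I K) * cl_sign (sym_diff I M) (sym_diff M K)" for M
      proof -
        have 1: "cl_sign I (sym_diff I K) = cl_sign I (sym_diff I M) * cl_sign I (sym_diff M K)"
          using cl_sign_right[of I "sym_diff I M" "sym_diff M K"]
          by (simp only: sd3)
        have 2: "cl_sign M (sym_diff M K) = cl_sign I (sym_diff M K) * cl_sign (sym_diff I M) (sym_diff M K)"
          using cl_sign_left[of I "sym_diff I M" "sym_diff M K"] by (simp only: sd2)
        show ?thesis by (simp only: 1 2 mult_ac)
      qed
      show "(\<Sum>M\<in>UNIV. cl_sign M (sym_diff M K) * cl_sign I (sym_diff I M) * cl_coeff a I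
          * cl_coeff b (sym_diff I M) * cl_coeff c (sym_diff M K))
        = (\<Sum>J\<in>UNIV. cl_sign I (sym_diff I K) * cl_sign J (sym_diff J (sym_diff I K)) * cl_coeff a I
          * cl_coeff b J * cl_coeff c (sym_diff J (sym_diff I K)))"
        by (rule sum.reindex_bij_witness[where i = "sym_diff I" and j = "sym_diff I"])
          (simp_all only: sd sd2 sg UNIV_I)
    qed
    also have "\<dots> = cl_coeff (a * (b * c)) K"
      by (simp add: cl_coeff_times sum_distrib_left sum_distrib_right mult_ac)
    finally show "cl_coeff (a * b * c) K = cl_coeff (a * (b * c)) K" .
  qed
  show "1 * a = a"
    by (rule clifford_eqI) (simp add: cl_coeff_times one_clifford_def if_distrib[of "\<lambda>t. _ * t"]
        if_distrib[of "\<lambda>t. t * _"] cong: if_cong)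
  show "a * 1 = a"
  proof (rule clifford_eqI)
    fix K :: "'a set"
    have e: "sym_diff I K = {} \<longleftrightarrow> I = K" for I by auto
    have "cl_coeff (a * 1) K = (\<Sum>I\<in>UNIV. if I = K then cl_sign I (sym_diff I K) * cl_coeff a I else 0)"
      unfolding cl_coeff_times one_clifford_def cl_coeff_Clifford by (rule sum.cong) (simp_all only: e, auto)
    then show "cl_coeff (a * 1) K = cl_coeff a K" by simp
  qed
  show "(a + b) * c = a * c + b * c" "a * (b + c) = a * b + a * c"
    by (rule clifford_eqI; simp add: cl_coeff_times plus_clifford_def[of "_ * _"]
        plus_clifford_def[of a b] plus_clifford_def[of b c] algebra_simps sum.distrib)+
  show "x *\<^sub>R a * b = x *\<^sub>R (a * b)" "a * x *\<^sub>R b = x *\<^sub>R (a * b)"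
    by (rule clifford_eqI; simp add: cl_coeff_times scaleR_clifford_def algebra_simps sum_distrib_left)+
  have "cl_coeff (0 :: 'a clifford) {} \<noteq> cl_coeff 1 {}"
    by (simp add: zero_clifford_def one_clifford_def)
  then show "(0 :: 'a clifford) \<noteq> 1" by metis
qed

definition cl_vec :: "'n rvec \<Rightarrow> 'n::{finite,linorder} clifford" where
  "cl_vec v = Clifford (\<lambda>K. \<Sum>i\<in>UNIV. if K = {i} then v $ i else 0)"

lemma cl_vec_times:
  "cl_coeff (cl_vec v * cl_vec w) K =
    (\<Sum>i\<in>UNIV. \<Sum>j\<in>UNIV. if sym_diff {i} {j} = K then cl_sign {i} {j} * v $ i * w $ j else 0)"
proof -
  have A: "cl_coeff (cl_vec v) I * t I = (\<Sum>i\<in>UNIV. if I = {i} then v $ i * t {i} else 0)"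
    for v :: "'a rvec" and I :: "'a set" and t :: "'a set \<Rightarrow> real"
    by (auto simp: cl_vec_def sum_distrib_right intro!: sum.cong)
  have "cl_coeff (cl_vec v * cl_vec w) K
      = (\<Sum>I\<in>UNIV. cl_coeff (cl_vec v) I * (cl_sign I (sym_diff I K) * cl_coeff (cl_vec w) (sym_diff I K)))"
    by (simp add: cl_coeff_times mult_ac)
  also have "\<dots> = (\<Sum>i\<in>UNIV. v $ i * (cl_sign {i} (sym_diff {i} K) * cl_coeff (cl_vec w) (sym_diff {i} K)))"
    unfolding A[where t = "\<lambda>I. cl_sign I (sym_diff I K) * cl_coeff (cl_vec w) (sym_diff I K)"]
    by (subst sum.swap) simp
  also have "\<dots> = (\<Sum>i\<in>UNIV. \<Sum>j\<in>UNIV. if sym_diff {i} {j} = K then cl_sign {i} {j} * v $ i * w $ j else 0)"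
  proof (rule sum.cong[OF refl])
    fix i :: 'a
    have "v $ i * (cl_sign {i} (sym_diff {i} K) * cl_coeff (cl_vec w) (sym_diff {i} K))
       = (\<Sum>j\<in>UNIV. if sym_diff {i} K = {j} then cl_sign {i} {j} * v $ i * w $ j else 0)"
      by (auto simp: cl_vec_def sum_distrib_left intro!: sum.cong)
    moreover have "sym_diff {i} K = {j} \<longleftrightarrow> sym_diff {i} {j} = K" for j by auto
    ultimately show "v $ i * (cl_sign {i} (sym_diff {i} K) * cl_coeff (cl_vec w) (sym_diff {i} K))
       = (\<Sum>j\<in>UNIV. if sym_diff {i} {j} = K then cl_sign {i} {j} * v $ i * w $ j else 0)"
      by simp
  qed
  finally show ?thesis .
qed

lemma cl_relation: "cl_vec v * cl_vec w + cl_vec w * cl_vec v = (- 2 * (v \<bullet> w)) *\<^sub>R 1"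
proof (rule clifford_eqI)
  fix K
  have "cl_coeff (cl_vec v * cl_vec w + cl_vec w * cl_vec v) K
      = cl_coeff (cl_vec v * cl_vec w) K + cl_coeff (cl_vec w * cl_vec v) K"
    by (simp add: plus_clifford_def[of "_ * _"])
  also have "cl_coeff (cl_vec w * cl_vec v) K =
    (\<Sum>i\<in>UNIV. \<Sum>j\<in>UNIV. if sym_diff {j} {i} = K then cl_sign {j} {i} * w $ j * v $ i else 0)"
    unfolding cl_vec_times by (rule sum.swap)
  also have "cl_coeff (cl_vec v * cl_vec w) K + \<dots> =
    (\<Sum>i\<in>UNIV. \<Sum>j\<in>UNIV. if j = i then (if K = {} then - 2 * (v $ i * w $ i) else 0) else 0)"
    unfolding cl_vec_times sum.distrib[symmetric]
  proof (intro sum.cong refl)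
    fix i j :: 'a
    have "sym_diff {j} {i} = sym_diff {i} {j}" by auto
    moreover have "sym_diff {i} {j} = K \<longleftrightarrow> K = {}" if "i = j" using that by auto
    moreover have "cl_sign {i} {j} + cl_sign {j} {i} = 0" if "i \<noteq> j"
      using that by (cases "j \<le> i") (simp_all add: cl_sign_def)
    moreover have "cl_sign {i} {i} = - 1" by (simp add: cl_sign_def)
    ultimately show "(if sym_diff {i} {j} = K then cl_sign {i} {j} * v $ i * w $ j else 0)
        + (if sym_diff {j} {i} = K then cl_sign {j} {i} * w $ j * v $ i else 0)
      = (if j = i then (if K = {} then - 2 * (v $ i * w $ i) else 0) else 0)"
      by (cases "i = j") (simp_all add: algebra_simps add_eq_0_iff)
  qed
  also have "\<dots> = (if K = {} then - 2 * (v \<bullet> w) else 0)"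
    by (simp add: inner_vec_def sum_distrib_left)
  also have "\<dots> = cl_coeff ((- 2 * (v \<bullet> w)) *\<^sub>R 1) K"
    by (simp add: scaleR_clifford_def one_clifford_def)
  finally show "cl_coeff (cl_vec v * cl_vec w + cl_vec w * cl_vec v) K = cl_coeff ((- 2 * (v \<bullet> w)) *\<^sub>R 1) K" .
qed

definition Spin :: "'n::{finite,linorder} clifford monoid" where
  "Spin = \<lparr>carrier = {prod_list (map cl_vec vs) | vs. even (length vs) \<and> (\<forall>v\<in>set vs. norm v = 1)},
           monoid.mult = (*), one = 1\<rparr>"

section \<open>The groups \<open>\<Gamma>\<^sub>p\<close>\<close>

definition ebasis :: "nat \<Rightarrow> 'n::{finite,linorder} rvec" where
  "ebasis i = axis (sorted_list_of_set UNIV ! (i - 1)) 1"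

definition isom_group :: "('n rvec \<Rightarrow> 'n::finite rvec) monoid" where
  "isom_group = \<lparr>carrier = {f. surj f \<and> (\<forall>x y. dist (f x) (f y) = dist x y)},
                 monoid.mult = (\<circ>), one = id\<rparr>"

definition transl :: "'n rvec \<Rightarrow> 'n rvec \<Rightarrow> 'n::finite rvec" where
  "transl b x = x + b"

text \<open>If \<open>g x = B (x + b)\<close> with \<open>B\<close> linear, then \<open>g x - g 0 = B x\<close>, so this is \<open>r (B L\<^sub>b) = B\<close>.\<close>

definition lin_part :: "('n rvec \<Rightarrow> 'n rvec) \<Rightarrow> 'n rvec \<Rightarrow> 'n::finite rvec" where
  "lin_part g x = g x - g 0"

definition rot_dim :: "'n::finite itself \<Rightarrow> nat" where
  "rot_dim _ = (CARD('n) - 1) div 2"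

definition Bmap :: "'n rvec \<Rightarrow> 'n::{finite,linorder} rvec" where
  "Bmap v = (let p = CARD('n) in
     (\<Sum>i=1..p-2. (v \<bullet> ebasis i) *\<^sub>R ebasis (i + 1))
     - (v \<bullet> ebasis (p - 1)) *\<^sub>R (\<Sum>i=1..p-1. ebasis i)
     + (v \<bullet> ebasis p) *\<^sub>R ebasis p)"

definition Cmap :: "'n rvec \<Rightarrow> 'n::{finite,linorder} rvec" where
  "Cmap v = (let p = CARD('n); \<theta> = (\<lambda>j. 2 * pi * real j / real p) in
     (\<Sum>j=1..rot_dim TYPE('n).
        (cos (\<theta> j) * (v \<bullet> ebasis (2*j-1)) - sin (\<theta> j) * (v \<bullet> ebasis (2*j))) *\<^sub>R ebasis (2*j-1)
      + (sin (\<theta> j) * (v \<bullet> ebasis (2*j-1)) + cos (\<theta> j) * (v \<bullet> ebasis (2*j))) *\<^sub>R ebasis (2*j))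
     + (v \<bullet> ebasis p) *\<^sub>R ebasis p)"

definition int_lattice :: "('n::finite rvec) set" where
  "int_lattice = {v. \<forall>i. v $ i \<in> \<int>}"

definition gamma_p :: "'n rvec \<Rightarrow> 'n::{finite,linorder} rvec" where
  "gamma_p = Cmap \<circ> transl ((1 / real CARD('n)) *\<^sub>R ebasis CARD('n))"

definition Gamma_p :: "('n rvec, 'n) vec \<Rightarrow> ('n rvec \<Rightarrow> 'n::{finite,linorder} rvec) set" where
  "Gamma_p D = generate isom_group (insert gamma_p (transl ` (*v) D ` int_lattice))"

abbreviation subgrp :: "('n rvec \<Rightarrow> 'n::finite rvec) set \<Rightarrow> ('n rvec \<Rightarrow> 'n rvec) monoid" where
  "subgrp \<Gamma> \<equiv> isom_group\<lparr>carrier := \<Gamma>\<rparr>"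

section \<open>Spin structures and representations\<close>

definition spin_structure ::
    "('n rvec \<Rightarrow> 'n rvec) set \<Rightarrow> (('n rvec \<Rightarrow> 'n rvec) \<Rightarrow> 'n::{finite,linorder} clifford) \<Rightarrow> bool" where
  "spin_structure \<Gamma> \<epsilon> \<longleftrightarrow> \<epsilon> \<in> hom (subgrp \<Gamma>) Spin \<and>
     (\<forall>g\<in>\<Gamma>. \<forall>x. cl_vec (lin_part g x) = \<epsilon> g * cl_vec x * inv\<^bsub>Spin\<^esub> (\<epsilon> g))"

definition spin_x :: "(nat \<Rightarrow> real) \<Rightarrow> 'n::{finite,linorder} clifford" where
  "spin_x t = prod_list (map (\<lambda>j. of_real (cos (t j))
     + sin (t j) *\<^sub>R (cl_vec (ebasis (2*j-1)) * cl_vec (ebasis (2*j)))) [1..<rot_dim TYPE('n) + 1])"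

text \<open>
  A complex representation of \<open>Cl(p) \<otimes> \<complex>\<close> is given by its restriction to \<open>Cl(p)\<close>, a real algebra
  homomorphism into the complex matrices. Sign \<open>\<sigma> = \<plusminus>1\<close> in the last clause stands for \<open>S\<^sup>\<plusminus>\<close>.
\<close>

definition spinor_rep :: "('n::{finite,linorder} clifford \<Rightarrow> complex ^ 's ^ 's::finite) \<Rightarrow> bool" where
  "spinor_rep L \<longleftrightarrow>
     CARD('s) = 2 ^ rot_dim TYPE('n) \<and>
     linear L \<and> L 1 = mat 1 \<and> (\<forall>a b. L (a * b) = L a ** L b) \<and>
     (\<forall>W. vec.subspace W \<and> (\<forall>a. \<forall>w\<in>W. L a *v w \<in> W) \<longrightarrow> W = {0} \<or> W = UNIV) \<and>
     (\<forall>\<sigma>\<in>{1, -1}. \<forall>w.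
        L (prod_list (map (\<lambda>i. cl_vec (ebasis i)) [1..<2 * rot_dim TYPE('n) + 1])) *v w
          = (\<sigma> * \<i> ^ rot_dim TYPE('n)) *s w
        \<longrightarrow> L (cl_vec (ebasis CARD('n))) *v w = (- \<sigma> * \<i>) *s w)"

definition unitary_group :: "(complex ^ 'd ^ 'd::finite) monoid" where
  "unitary_group = \<lparr>carrier = {A. (\<chi> i j. cnj (A $ j $ i)) ** A = mat 1},
                    monoid.mult = (**), one = mat 1\<rparr>"

section \<open>The twisted Dirac operator and its eta function\<close>

text \<open>\<open>S \<otimes> V\<close> is \<open>complex ^ ('s \<times> 'd)\<close>; the following is the Kronecker product.\<close>

definition tensor_mat :: "complex ^ 's ^ 's \<Rightarrow> complex ^ 'd ^ 'd
    \<Rightarrow> complex ^ ('s::finite \<times> 'd::finite) ^ ('s \<times> 'd)" where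
  "tensor_mat A B = (\<chi> a b. A $ fst a $ fst b * B $ snd a $ snd b)"

definition partial_deriv :: "'n rvec \<Rightarrow> ('n rvec \<Rightarrow> 'b) \<Rightarrow> 'n::finite rvec \<Rightarrow> 'b::real_normed_vector" where
  "partial_deriv v f x = vector_derivative (\<lambda>t. f (x + t *\<^sub>R v)) (at 0)"

fun Ck :: "nat \<Rightarrow> ('n::finite rvec \<Rightarrow> 'b::real_normed_vector) \<Rightarrow> bool" where
  "Ck 0 f \<longleftrightarrow> continuous_on UNIV f"
| "Ck (Suc k) f \<longleftrightarrow> (\<forall>x. f differentiable at x) \<and> (\<forall>i. Ck k (partial_deriv (axis i 1) f))"

definition smooth_fun :: "('n::finite rvec \<Rightarrow> 'b::real_normed_vector) \<Rightarrow> bool" where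
  "smooth_fun f \<longleftrightarrow> (\<forall>k. Ck k f)"

definition twisted_spinors :: "('n rvec \<Rightarrow> 'n rvec) set \<Rightarrow> ('n::{finite,linorder} clifford \<Rightarrow> complex ^ 's ^ 's)
    \<Rightarrow> (('n rvec \<Rightarrow> 'n rvec) \<Rightarrow> 'n clifford) \<Rightarrow> (('n rvec \<Rightarrow> 'n rvec) \<Rightarrow> complex ^ 'd ^ 'd)
    \<Rightarrow> ('n rvec \<Rightarrow> complex ^ ('s::finite \<times> 'd::finite)) set" where
  "twisted_spinors \<Gamma> L \<epsilon> \<rho> =
     {\<psi>. smooth_fun \<psi> \<and> (\<forall>g\<in>\<Gamma>. \<forall>x. \<psi> (g x) = tensor_mat (L (\<epsilon> g)) (\<rho> g) *v \<psi> x)}"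

definition dirac :: "('n::{finite,linorder} clifford \<Rightarrow> complex ^ 's ^ 's)
    \<Rightarrow> ('n rvec \<Rightarrow> complex ^ ('s::finite \<times> 'd::finite)) \<Rightarrow> 'n rvec \<Rightarrow> complex ^ ('s \<times> 'd)" where
  "dirac L \<psi> x = (\<Sum>i=1..CARD('n). tensor_mat (L (cl_vec (ebasis i))) (mat 1) *v partial_deriv (ebasis i) \<psi> x)"

text \<open>The operator is formally self-adjoint, so only real eigenvalues are considered.\<close>

definition eigenspinors :: "('n rvec \<Rightarrow> 'n rvec) set \<Rightarrow> ('n::{finite,linorder} clifford \<Rightarrow> complex ^ 's ^ 's)
    \<Rightarrow> (('n rvec \<Rightarrow> 'n rvec) \<Rightarrow> 'n clifford) \<Rightarrow> (('n rvec \<Rightarrow> 'n rvec) \<Rightarrow> complex ^ 'd ^ 'd)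
    \<Rightarrow> real \<Rightarrow> ('n rvec \<Rightarrow> complex ^ ('s::finite \<times> 'd::finite)) set" where
  "eigenspinors \<Gamma> L \<epsilon> \<rho> \<mu> = {\<psi> \<in> twisted_spinors \<Gamma> L \<epsilon> \<rho>. \<forall>x. dirac L \<psi> x = of_real \<mu> *s \<psi> x}"

definition eigenvalues where
  "eigenvalues \<Gamma> L \<epsilon> \<rho> = {\<mu>. \<exists>\<psi>\<in>eigenspinors \<Gamma> L \<epsilon> \<rho> \<mu>. \<exists>x. \<psi> x \<noteq> 0}"

global_interpretation fun_cvs: vector_space "\<lambda>(c::complex) (\<psi> :: 'a \<Rightarrow> complex ^ 'k::finite) x. c *s \<psi> x"
  defines fun_cdim = fun_cvs.dim
  by unfold_locales (simp_all add: fun_eq_iff vec_eq_iff algebra_simps)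

definition eta_term where
  "eta_term \<Gamma> L \<epsilon> \<rho> s \<mu> =
     complex_of_real (sgn \<mu>) * of_nat (fun_cdim (eigenspinors \<Gamma> L \<epsilon> \<rho> \<mu>)) * complex_of_real \<bar>\<mu>\<bar> powr (- s)"

text \<open>
  The meromorphic continuation to \<open>\<complex>\<close> of a function given on \<open>{s. Re s > a}\<close>. Being nicely meromorphic
  (removable singularities filled in, value \<open>0\<close> at poles) makes it unique.
\<close>

definition mero_cont :: "real \<Rightarrow> (complex \<Rightarrow> complex) \<Rightarrow> complex \<Rightarrow> complex" where
  "mero_cont a f = (THE F. F nicely_meromorphic_on UNIV \<and> (\<forall>s. Re s > a \<longrightarrow> F s = f s))"

definition eta_fun :: "('n rvec \<Rightarrow> 'n rvec) set \<Rightarrow> ('n::{finite,linorder} clifford \<Rightarrow> complex ^ 's ^ 's::finite)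
    \<Rightarrow> (('n rvec \<Rightarrow> 'n rvec) \<Rightarrow> 'n clifford) \<Rightarrow> (('n rvec \<Rightarrow> 'n rvec) \<Rightarrow> complex ^ 'd ^ 'd::finite)
    \<Rightarrow> complex \<Rightarrow> complex" where
  "eta_fun \<Gamma> L \<epsilon> \<rho> = mero_cont (real CARD('n))
     (\<lambda>s. \<Sum>\<^sub>\<infinity>\<mu>\<in>eigenvalues \<Gamma> L \<epsilon> \<rho> - {0}. eta_term \<Gamma> L \<epsilon> \<rho> s \<mu>)"

definition eta_invariant where
  "eta_invariant \<Gamma> L \<epsilon> \<rho> = eta_fun \<Gamma> L \<epsilon> \<rho> 0"

definition hurwitz_zeta :: "complex \<Rightarrow> real \<Rightarrow> complex" where
  "hurwitz_zeta s \<alpha> = mero_cont 1 (\<lambda>s. \<Sum>j. complex_of_real (real j + \<alpha>) powr (- s)) s"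

end

theory Submission
  imports Defs "HOL-Number_Theory.Euler_Criterion"
begin

text \<open>
  Fourier expansion identifies the \<open>\<mu>\<close>-eigenspace of \<open>D\<^sub>\<rho>\<close> with the families \<open>w(u)\<close>, where \<open>u\<close> runs over the
  points of a shifted dual lattice with \<open>2\<pi>|u| = |\<mu>|\<close>, such that \<open>2\<pi>i L(u) w(u) = \<mu> w(u)\<close> and \<open>w\<close> is
  equivariant under \<open>\<gamma>\<close>. Its dimension is the trace of a projection which averages over the powers
  of \<open>\<gamma>\<close>, and in the difference of the dimensions for \<open>\<mu>\<close> and \<open>-\<mu>\<close> only those \<open>u\<close> survive that are fixed
  by a nontrivial power, that is \<open>u = \<plusminus>\<nu> e\<^sub>p\<close>. So the spectral asymmetry lives on \<open>\<mu> = \<plusminus>2\<pi>(j + h)\<close>, with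
  \<open>h = 1\<close> for \<open>\<epsilon>\<^sub>1\<close> and \<open>h = 1/2\<close> for \<open>\<epsilon>\<^sub>2\<close>. It is a sine sum against the traces of \<open>L(\<epsilon>(\<gamma>\<^sup>k) e\<^sub>p) \<otimes> \<rho>(\<gamma>\<^sup>k)\<close>,
  in particular \<open>p\<close>-periodic in \<open>j\<close>, and the traces are products of sines, which Gauss's lemma evaluates
  as Legendre symbols times \<open>\<surd>p\<close>. Summing over the residue classes of \<open>j\<close> modulo \<open>p\<close> gives Hurwitz zeta
  functions. The eta invariants follow from \<open>\<zeta>(0, \<alpha>) = 1/2 - \<alpha>\<close> and Abel summation.
\<close>

section \<open>The Hurwitz zeta function\<close>

text \<open>No multiplicity is ever computed. In the trace formula the trivial power of \<gamma>
  counts all lattice points of a given length, and this count is the same for \<mu> and -\<mu>, so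
  only the difference becomes explicit. A crude bound on the multiplicities gives absolute
  convergence for Re s > p, which is what allows \<mu> and -\<mu> to be paired in the series.
  Primality of p enters twice: every nontrivial power of \<gamma> turns each coordinate plane by a
  nontrivial angle, hence fixes only the axis of \<open>e_p\<close>, and Gauss's lemma cancels k
  modulo p. The residue of p modulo 4 also enters twice: the number m of planes is odd, so the phase
  i^(m+1) of the spinor trace is a real sign, and -1 is a nonresidue, so at s = 0 the terms k and p
  - k carry equal weights. Adding them turns the character values into twice their real parts. For
  general \<rho> the trace of \<rho>(\<gamma>^k) varies with k, so it stays under the sum over
  k.\<close>

lemma mero_cont_eqI:
  assumes F: "F nicely_meromorphic_on UNIV" and eq: "\<And>s. Re s > a \<Longrightarrow> F s = f s"
  shows "mero_cont a f = F"
  unfolding mero_cont_def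
proof (rule the_equality)
  show "F nicely_meromorphic_on UNIV \<and> (\<forall>s. Re s > a \<longrightarrow> F s = f s)" using assms by blast
next
  fix G assume G: "G nicely_meromorphic_on UNIV \<and> (\<forall>s. Re s > a \<longrightarrow> G s = f s)"
  have mF: "F meromorphic_on UNIV" and mG: "G meromorphic_on UNIV"
    using F G by (auto simp: nicely_meromorphic_on_def)
  have mD: "(\<lambda>s. F s - G s) meromorphic_on UNIV"
    by (intro meromorphic_intros mF mG)
  have iso: "isolated_singularity_at (\<lambda>s. F s - G s) w" for w
    using meromorphic_on_subset[OF mD] by (intro meromorphic_on_isolated_singularity) auto
  have "open {s. Re s > a}" by (rule open_halfspace_Re_gt)
  then have "eventually (\<lambda>s. s \<in> {s. Re s > a}) (at (of_real (a + 1)))"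
    by (intro eventually_at_in_open') auto
  then have "eventually (\<lambda>s. remove_sings (\<lambda>s. F s - G s) s = 0) (at (of_real (a + 1)))"
    using eventually_remove_sings_eq_at[OF iso]
    by eventually_elim (use eq G in auto)
  then have fr: "frequently (\<lambda>s. remove_sings (\<lambda>s. F s - G s) s = 0) (at (of_real (a + 1)))"
    by (intro eventually_frequently) auto
  \<comment> \<open>Identity theorem: the difference with its removable singularities filled in
    vanishes near a point of the half-plane, hence everywhere.\<close>
  have z: "remove_sings (\<lambda>s. F s - G s) w = 0" for w
    using frequently_eq_meromorphic_imp_constant[OF fr remove_sings_nicely_meromorphic[OF mD]]
    by auto
  show "G = F"
  proof
    fix w
    have ev: "eventually (\<lambda>s. F s = G s) (at w)"
      using eventually_remove_sings_eq_at[OF iso[of w]] by eventually_elim (simp add: z)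
    \<comment> \<open>Being nicely meromorphic determines the value at \<open>w\<close> from the
      punctured neighbourhood: it is the limit, or 0 at a pole. So agreement near \<open>w\<close>
      implies agreement at \<open>w\<close>.\<close>
    have cF: "(is_pole F w \<and> F w = 0) \<or> F \<midarrow>w\<rightarrow> F w"
      and cG: "(is_pole G w \<and> G w = 0) \<or> G \<midarrow>w\<rightarrow> G w"
      using F G by (auto simp: nicely_meromorphic_on_def)
    have p: "is_pole F w \<longleftrightarrow> is_pole G w" by (rule is_pole_cong[OF ev refl])
    have l: "F \<midarrow>w\<rightarrow> c \<longleftrightarrow> G \<midarrow>w\<rightarrow> c" for c by (rule tendsto_cong[OF ev])
    have np: "\<not> (is_pole F w \<and> F \<midarrow>w\<rightarrow> c)" for c
      using not_tendsto_and_filterlim_at_infinity[of "at w" F c] by (auto simp: is_pole_def)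
    show "G w = F w"
      using cF cG p l np LIM_unique by metis
  qed
qed

text \<open>Weierstrass M-test, locally. The bound is asked for large \<open>j\<close> only, because
  the majorants used below are multiples of \<open>real j powr e\<close>, which is 0 at j =
  0.\<close>

lemma holomorphic_suminf:
  fixes f :: "nat \<Rightarrow> complex \<Rightarrow> complex"
  assumes S: "open S" and hol: "\<And>j. f j holomorphic_on S"
    and bd: "\<And>x. x \<in> S \<Longrightarrow> \<exists>d>0. \<exists>M. summable M \<and> cball x d \<subseteq> S \<and>
       (\<forall>\<^sub>F j in sequentially. \<forall>y\<in>cball x d. norm (f j y) \<le> M j)"
  shows "(\<lambda>s. \<Sum>j. f j s) holomorphic_on S"
proof (rule holomorphic_uniform_sequence[OF S])
  show "(\<lambda>s. \<Sum>j<n. f j s) holomorphic_on S" for n by (intro holomorphic_intros hol)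
  fix x assume "x \<in> S"
  from bd[OF this] obtain d M where "d > 0" "cball x d \<subseteq> S" "summable M"
    "\<forall>\<^sub>F j in sequentially. \<forall>y\<in>cball x d. norm (f j y) \<le> M j" by blast
  then show "\<exists>d>0. cball x d \<subseteq> S \<and>
      uniform_limit (cball x d) (\<lambda>n s. \<Sum>j<n. f j s) (\<lambda>s. \<Sum>j. f j s) sequentially"
    using Weierstrass_m_test_ev[of "cball x d" f M] by blast
qed

section \<open>Taylor remainders of complex powers\<close>

definition falling :: "complex \<Rightarrow> nat \<Rightarrow> complex" where
  "falling a k = (\<Prod>i<k. a - of_nat i)"

text \<open>Taylor remainder of order \<open>K\<close> of z powr (1 - s) at \<open>x\<close>, for
  the increment 1. The exponent is 1 - s so that the linear term is (1 - s) x^(-s), a multiple of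
  the summand of the zeta series.\<close>

definition zeta_rem :: "nat \<Rightarrow> complex \<Rightarrow> real \<Rightarrow> complex" where
  "zeta_rem K s x = of_real (x + 1) powr (1 - s)
     - (\<Sum>k\<le>K. falling (1 - s) k * of_real x powr (1 - s - of_nat k) / fact k)"

text \<open>The assumption on \<open>s\<close> makes the exponent of the derivative of order K + 1
  nonpositive, so this derivative is largest at the left end of the segment. Each further order
  gains one power of \<open>x\<close>.\<close>

lemma zeta_rem_bound:
  assumes x: "x > 0" and s: "Re s \<ge> - real K"
  shows "cmod (zeta_rem K s x) \<le> cmod (falling (1 - s) (Suc K)) * x powr (- Re s - real K)"
proof -
  define a where "a = 1 - s"
  define f where "f = (\<lambda>i z. falling a i * z powr (a - of_nat i))"
  let ?S = "closed_segment (complex_of_real x) (complex_of_real (x + 1))"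
  have S: "z \<in> ?S \<Longrightarrow> \<exists>t. z = of_real t \<and> x \<le> t" for z
    unfolding closed_segment_of_real using x by (auto simp: closed_segment_eq_real_ivl)
  have "cmod (f 0 (of_real (x + 1)) - (\<Sum>i\<le>K. f i (of_real x) * (of_real (x + 1) - of_real x) ^ i / fact i))
      \<le> (cmod (falling a (Suc K)) * x powr (- Re s - real K)) * cmod (of_real (x + 1) - of_real x :: complex) ^ Suc K / fact K"
  proof (rule complex_Taylor[where S = ?S])
    fix i z assume "z \<in> ?S" "i \<le> K"
    then obtain t where t: "z = of_real t" "x \<le> t" using S by blast
    then have "z \<notin> \<real>\<^sub>\<le>\<^sub>0" using x by auto
    then show "(f i has_field_derivative f (Suc i) z) (at z within ?S)"
      unfolding f_def
      by (auto intro!: derivative_eq_intros has_field_derivative_powr[THEN has_field_derivative_at_within]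
          simp: falling_def algebra_simps)
  next
    fix z assume "z \<in> ?S"
    then obtain t where t: "z = of_real t" "x \<le> t" using S by blast
    have "cmod (z powr (a - of_nat (Suc K))) = t powr (- Re s - real K)"
      using t x by (subst norm_powr_real_powr) (auto simp: a_def)
    also have "\<dots> \<le> x powr (- Re s - real K)"
      using t x s by (intro powr_mono2') auto
    finally show "cmod (f (Suc K) z) \<le> cmod (falling a (Suc K)) * x powr (- Re s - real K)"
      unfolding f_def norm_mult by (intro mult_left_mono) auto
  qed auto
  moreover have "f 0 (of_real (x + 1)) - (\<Sum>i\<le>K. f i (of_real x) * (of_real (x + 1) - of_real x) ^ i / fact i) = zeta_rem K s x"
    by (simp add: f_def zeta_rem_def falling_def a_def)
  moreover have "(cmod (falling a (Suc K)) * x powr (- Re s - real K)) * cmod (of_real (x + 1) - of_real x :: complex) ^ Suc K / fact K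
     \<le> cmod (falling a (Suc K)) * x powr (- Re s - real K)"
    using mult_left_mono[of 1 "fact K :: real" "cmod (falling a (Suc K)) * x powr (- Re s - real K)"]
    by (simp add: divide_le_eq fact_ge_1)
  ultimately show ?thesis unfolding a_def by simp
qed

lemma holomorphic_falling [holomorphic_intros]:
  "f holomorphic_on S \<Longrightarrow> (\<lambda>s. falling (f s) k) holomorphic_on S"
  unfolding falling_def by (intro holomorphic_intros)

lemma summable_nat_powr: "e < - 1 \<Longrightarrow> summable (\<lambda>j. real j powr e)"
  using summable_real_powr_iff by blast

lemma holomorphic_of_real_powr [holomorphic_intros]:
  assumes "x > 0" "f holomorphic_on S"
  shows "(\<lambda>s. complex_of_real x powr f s) holomorphic_on S"
proof -
  have "(\<lambda>s. exp (f s * of_real (ln x))) holomorphic_on S"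
    using assms by (intro holomorphic_intros)
  then show ?thesis using assms by (simp add: powr_def Ln_of_real)
qed

lemma cball_Re_ge:
  assumes "y \<in> cball x d" shows "Re y \<ge> Re x - d"
proof -
  have "\<bar>Re (x - y)\<bar> \<le> d" using assms abs_Re_le_cmod[of "x - y"] by (simp add: dist_norm)
  then show ?thesis by simp
qed

lemma cball_subset_Re_gt:
  assumes "b < Re x - d" shows "cball x d \<subseteq> {s. Re s > b}"
  using cball_Re_ge assms by fastforce

lemma holomorphic_zeta_rem:
  assumes "\<alpha> > 0"
  shows "(\<lambda>s. zeta_rem K s (real j + \<alpha>)) holomorphic_on S"
  unfolding zeta_rem_def using assms by (intro holomorphic_intros) (auto simp: add.assoc)

lemma holomorphic_zeta_rem_sum:
  assumes \<alpha>: "\<alpha> > 0"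
  shows "(\<lambda>s. \<Sum>j. zeta_rem K s (real j + \<alpha>)) holomorphic_on {s. Re s > 1 - real K}"
proof (rule holomorphic_suminf)
  show "open {s. Re s > 1 - real K}" by (rule open_halfspace_Re_gt)
  show "(\<lambda>s. zeta_rem K s (real j + \<alpha>)) holomorphic_on {s. Re s > 1 - real K}" for j
    by (rule holomorphic_zeta_rem[OF \<alpha>])
  fix x assume "x \<in> {s. Re s > 1 - real K}"
  then have x: "Re x > 1 - real K" by simp
  define d where "d = (Re x - (1 - real K)) / 2"
  have d: "d > 0" using x by (simp add: d_def)
  have "compact ((\<lambda>s. falling (1 - s) (Suc K)) ` cball x d)"
    by (intro compact_continuous_image holomorphic_on_imp_continuous_on holomorphic_intros) auto
  then obtain C where C: "\<And>y. y \<in> cball x d \<Longrightarrow> cmod (falling (1 - y) (Suc K)) \<le> C"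
    using compact_imp_bounded bounded_iff by (metis (no_types, lifting) image_eqI)
  have "summable (\<lambda>j. C * real j powr (- (Re x - d) - real K))"
    using x by (intro summable_mult summable_nat_powr) (simp add: d_def field_simps)
  moreover have "cball x d \<subseteq> {s. Re s > 1 - real K}"
    using x by (intro cball_subset_Re_gt) (simp add: d_def field_simps)
  moreover have "\<forall>\<^sub>F j in sequentially. \<forall>y\<in>cball x d. norm (zeta_rem K y (real j + \<alpha>)) \<le> C * real j powr (- (Re x - d) - real K)"
    using eventually_ge_at_top[of 1]
  proof eventually_elim
    case (elim j)
    show ?case
    proof
      fix y assume y: "y \<in> cball x d"
      have Re: "Re y \<ge> Re x - d" "Re y > 1 - real K"
        using cball_Re_ge[OF y] x by (auto simp: d_def field_simps)
      have "norm (zeta_rem K y (real j + \<alpha>)) \<le> cmod (falling (1 - y) (Suc K)) * (real j + \<alpha>) powr (- Re y - real K)"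
        using \<alpha> Re by (intro zeta_rem_bound) auto
      also have "\<dots> \<le> C * (real j powr (- (Re x - d) - real K))"
      proof (intro mult_mono)
        have "(real j + \<alpha>) powr (- Re y - real K) \<le> real j powr (- Re y - real K)"
          using \<alpha> Re elim by (intro powr_mono2') auto
        also have "\<dots> \<le> real j powr (- (Re x - d) - real K)"
          using Re elim by (intro powr_mono) auto
        finally show "(real j + \<alpha>) powr (- Re y - real K) \<le> real j powr (- (Re x - d) - real K)" .
        show "0 \<le> C" using C[OF y] norm_ge_zero order_trans by blast
      qed (use C y in auto)
      finally show "norm (zeta_rem K y (real j + \<alpha>)) \<le> C * real j powr (- (Re x - d) - real K)" .
    qed
  qed
  ultimately show "\<exists>d>0. \<exists>M. summable M \<and> cball x d \<subseteq> {s. Re s > 1 - real K} \<and>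
       (\<forall>\<^sub>F j in sequentially. \<forall>y\<in>cball x d. norm (zeta_rem K y (real j + \<alpha>)) \<le> M j)"
    using d by blast
qed

section \<open>The Hurwitz series and its continuation\<close>

abbreviation hurwitz_series :: "real \<Rightarrow> complex \<Rightarrow> complex" where
  "hurwitz_series \<alpha> s \<equiv> (\<Sum>j. complex_of_real (real j + \<alpha>) powr (- s))"

lemma norm_shifted_powr_le:
  assumes "\<alpha> > 0" "j \<ge> 1" "b \<le> Re s" "0 \<le> Re s"
  shows "cmod (complex_of_real (real j + \<alpha>) powr (- s)) \<le> real j powr (- b)"
proof -
  have "cmod (complex_of_real (real j + \<alpha>) powr (- s)) = (real j + \<alpha>) powr (- Re s)"
    using assms by (subst norm_powr_real_powr) auto
  also have "\<dots> \<le> real j powr (- Re s)" using assms by (intro powr_mono2') auto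
  also have "\<dots> \<le> real j powr (- b)" using assms by (intro powr_mono) auto
  finally show ?thesis .
qed

lemma summable_hurwitz:
  assumes "\<alpha> > 0" "Re s > 1"
  shows "summable (\<lambda>j. norm (complex_of_real (real j + \<alpha>) powr (- s)))"
proof (rule summable_comparison_test_ev)
  show "\<forall>\<^sub>F j in sequentially. norm (norm (complex_of_real (real j + \<alpha>) powr (- s))) \<le> real j powr (- Re s)"
    using eventually_ge_at_top[of 1] by eventually_elim (use assms norm_shifted_powr_le in auto)
  show "summable (\<lambda>j. real j powr (- Re s))" using assms by (intro summable_nat_powr) auto
qed

lemma holomorphic_hurwitz_series:
  assumes \<alpha>: "\<alpha> > 0"
  shows "hurwitz_series \<alpha> holomorphic_on {s. Re s > 1}"
proof (rule holomorphic_suminf)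
  show "open {s. Re s > 1}" by (rule open_halfspace_Re_gt)
  show "(\<lambda>s. complex_of_real (real j + \<alpha>) powr (- s)) holomorphic_on {s. Re s > 1}" for j
    using \<alpha> by (intro holomorphic_intros) auto
  fix x assume "x \<in> {s. Re s > 1}"
  then have x: "Re x > 1" by simp
  define d where "d = (Re x - 1) / 2"
  have d: "d > 0" using x by (simp add: d_def)
  have "summable (\<lambda>j. real j powr (- (Re x - d)))"
    using x by (intro summable_nat_powr) (simp add: d_def field_simps)
  moreover have "cball x d \<subseteq> {s. Re s > 1}"
    using x by (intro cball_subset_Re_gt) (simp add: d_def field_simps)
  moreover have "\<forall>\<^sub>F j in sequentially. \<forall>y\<in>cball x d. norm (complex_of_real (real j + \<alpha>) powr (- y)) \<le> real j powr (- (Re x - d))"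
    using eventually_ge_at_top[of 1]
  proof eventually_elim
    case (elim j)
    show ?case
    proof
      fix y assume "y \<in> cball x d"
      from cball_Re_ge[OF this] have "Re y \<ge> Re x - d" .
      moreover have "Re x - d \<ge> 0" using x by (simp add: d_def field_simps)
      ultimately show "norm (complex_of_real (real j + \<alpha>) powr (- y)) \<le> real j powr (- (Re x - d))"
        using \<alpha> elim by (intro norm_shifted_powr_le) auto
    qed
  qed
  ultimately show "\<exists>d>0. \<exists>M. summable M \<and> cball x d \<subseteq> {s. Re s > 1} \<and>
       (\<forall>\<^sub>F j in sequentially. \<forall>y\<in>cball x d. norm (complex_of_real (real j + \<alpha>) powr (- y)) \<le> M j)"
    using d by blast
qed

text \<open>Summing the Taylor expansion of \<open>(x + 1) powr (1 - s)\<close> at \<open>x\<close> over \<open>x = \<alpha>, \<alpha> + 1, \<dots>\<close>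
  telescopes and expresses \<open>(s - 1) \<zeta>(s, \<alpha>)\<close> through values of \<open>\<zeta>\<close> further to the right. The factor
  \<open>s - 1\<close> removes the pole, since \<open>falling (1 - s) k\<close> is divisible by \<open>s + k - 2\<close>.\<close>

lemma hurwitz_recursion:
  assumes \<alpha>: "\<alpha> > 0" and s: "Re s > 1" and Z: "\<And>s. Re s > 1 \<Longrightarrow> Z s = (s - 1) * hurwitz_series \<alpha> s"
  shows "Z s = of_real \<alpha> powr (1 - s)
      - (\<Sum>i\<le>n. falling (1 - s) (Suc i) / fact (i + 2) * Z (s + of_nat (Suc i)))
      + (\<Sum>j. zeta_rem (n + 2) s (real j + \<alpha>))"
proof -
  let ?g = "\<lambda>j. complex_of_real (real j + \<alpha>) powr (1 - s)"
  have "?g \<longlonglongrightarrow> 0"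
  proof (rule tendsto_norm_zero_cancel, rule Lim_null_comparison)
    show "\<forall>\<^sub>F j in sequentially. norm (norm (?g j)) \<le> real j powr (1 - Re s)"
      using eventually_ge_at_top[of 1]
      by eventually_elim (use norm_shifted_powr_le[OF \<alpha>, of _ "Re (s - 1)" "s - 1"] s in auto)
    show "(\<lambda>j. real j powr (1 - Re s)) \<longlonglongrightarrow> 0"
      using s by (intro tendsto_neg_powr filterlim_real_sequentially) auto
  qed
  then have "(\<lambda>j. ?g (Suc j) - ?g j) sums (0 - ?g 0)"
    by (rule telescope_sums)
  then have tel: "(\<lambda>j. ?g (Suc j) - ?g j) sums (- (of_real \<alpha> powr (1 - s)))" by simp
  have sm: "(\<lambda>j. complex_of_real (real j + \<alpha>) powr (- (s + of_nat i))) sums hurwitz_series \<alpha> (s + of_nat i)" for i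
    by (rule summable_sums[OF summable_norm_cancel[OF summable_hurwitz[OF \<alpha>]]]) (use s in simp)
  have sk: "(\<lambda>j. \<Sum>i\<le>n+1. falling (1 - s) (Suc i) / fact (Suc i) * complex_of_real (real j + \<alpha>) powr (- (s + of_nat i)))
     sums (\<Sum>i\<le>n+1. falling (1 - s) (Suc i) / fact (Suc i) * hurwitz_series \<alpha> (s + of_nat i))"
    by (intro sums_sum sums_mult sm)
  have "zeta_rem (n + 2) s (real j + \<alpha>) = (?g (Suc j) - ?g j)
     - (\<Sum>i\<le>n+1. falling (1 - s) (Suc i) / fact (Suc i) * complex_of_real (real j + \<alpha>) powr (- (s + of_nat i)))" for j
  proof -
    have "(\<Sum>k\<le>Suc (n + 1). falling (1 - s) k * of_real (real j + \<alpha>) powr (1 - s - of_nat k) / fact k)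
      = ?g j + (\<Sum>i\<le>n+1. falling (1 - s) (Suc i) / fact (Suc i) * complex_of_real (real j + \<alpha>) powr (- (s + of_nat i)))"
      by (subst sum.atMost_Suc_shift) (simp add: falling_def)
    then show ?thesis unfolding zeta_rem_def by (simp add: add_ac)
  qed
  then have "(\<lambda>j. zeta_rem (n + 2) s (real j + \<alpha>)) sums (- (of_real \<alpha> powr (1 - s))
     - (\<Sum>i\<le>n+1. falling (1 - s) (Suc i) / fact (Suc i) * hurwitz_series \<alpha> (s + of_nat i)))"
    using sums_diff[OF tel sk] by simp
  then have 1: "(\<Sum>j. zeta_rem (n + 2) s (real j + \<alpha>)) = - (of_real \<alpha> powr (1 - s))
     - (\<Sum>i\<le>Suc n. falling (1 - s) (Suc i) / fact (Suc i) * hurwitz_series \<alpha> (s + of_nat i))"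
    by (simp add: sums_iff)
  \<comment> \<open>The term i = 0 is (1 - s) times the series at \<open>s\<close>, that is
    -\<open>Z s\<close>; the remaining terms are shifted by one index.\<close>
  have 2: "(\<Sum>i\<le>Suc n. falling (1 - s) (Suc i) / fact (Suc i) * hurwitz_series \<alpha> (s + of_nat i))
     = - Z s + (\<Sum>i\<le>n. falling (1 - s) (Suc (Suc i)) / fact (Suc (Suc i)) * hurwitz_series \<alpha> (s + of_nat (Suc i)))"
    by (subst sum.atMost_Suc_shift) (simp add: falling_def Z[OF s] algebra_simps)
  \<comment> \<open>The last factor of \<open>falling\<close> is -(s + i), exactly what turns the
    series at s + i + 1 into a value of \<open>Z\<close>.\<close>
  have 3: "falling (1 - s) (Suc (Suc i)) / fact (Suc (Suc i)) * hurwitz_series \<alpha> (s + of_nat (Suc i))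
     = - (falling (1 - s) (Suc i) / fact (i + 2) * Z (s + of_nat (Suc i)))" for i
  proof -
    have "falling (1 - s) (Suc (Suc i)) = - falling (1 - s) (Suc i) * (s + of_nat (Suc i) - 1)"
      unfolding falling_def by (subst prod.lessThan_Suc) (simp add: algebra_simps del: prod.lessThan_Suc)
    moreover have "Z (s + of_nat (Suc i)) = (s + of_nat (Suc i) - 1) * hurwitz_series \<alpha> (s + of_nat (Suc i))"
      using s by (intro Z) auto
    ultimately show ?thesis by (simp del: of_nat_Suc fact_Suc)
  qed
  show ?thesis unfolding 1 2 3 by (simp add: sum_negf)
qed

text \<open>The right-hand side of \<open>hurwitz_recursion\<close> evaluates \<open>Z\<close> only
  at s + 1, s + 2, ..., so each use of it extends the domain by a strip of width one.\<close>

lemma hurwitz_halfplane: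
  assumes \<alpha>: "\<alpha> > 0"
  shows "\<exists>Z. Z holomorphic_on {s. Re s > 1 - real n} \<and> (\<forall>s. Re s > 1 \<longrightarrow> Z s = (s - 1) * hurwitz_series \<alpha> s)"
proof (induction n)
  case 0
  have "(\<lambda>s. (s - 1) * hurwitz_series \<alpha> s) holomorphic_on {s. Re s > 1}"
    by (intro holomorphic_intros holomorphic_hurwitz_series \<alpha>)
  then show ?case by (auto intro!: exI[of _ "\<lambda>s. (s - 1) * hurwitz_series \<alpha> s"])
next
  case (Suc n)
  then obtain Z where hol: "Z holomorphic_on {s. Re s > 1 - real n}"
    and Z: "\<And>s. Re s > 1 \<Longrightarrow> Z s = (s - 1) * hurwitz_series \<alpha> s" by blast
  define Z' where "Z' = (\<lambda>s. of_real \<alpha> powr (1 - s)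
      - (\<Sum>i\<le>n. falling (1 - s) (Suc i) / fact (i + 2) * Z (s + of_nat (Suc i)))
      + (\<Sum>j. zeta_rem (n + 2) s (real j + \<alpha>)))"
  have sh: "(\<lambda>s. Z (s + of_nat (Suc i))) holomorphic_on {s. Re s > 1 - real (Suc n)}" for i
    by (rule holomorphic_on_compose_gen[of "\<lambda>s. s + of_nat (Suc i)" "{s. Re s > 1 - real (Suc n)}", OF _ hol, unfolded o_def])
      (auto intro!: holomorphic_intros)
  have "(\<lambda>s. \<Sum>j. zeta_rem (n + 2) s (real j + \<alpha>)) holomorphic_on {s. Re s > 1 - real (Suc n)}"
    by (rule holomorphic_on_subset[OF holomorphic_zeta_rem_sum[OF \<alpha>]]) auto
  then have "Z' holomorphic_on {s. Re s > 1 - real (Suc n)}"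
    unfolding Z'_def using \<alpha> by (intro holomorphic_intros sh) auto
  moreover have "Z' s = (s - 1) * hurwitz_series \<alpha> s" if "Re s > 1" for s
    using hurwitz_recursion[OF \<alpha> that Z, of n] Z[OF that] by (simp only: Z'_def)
  ultimately show ?case by blast
qed

lemma halfplane_identity:
  fixes f g :: "complex \<Rightarrow> complex"
  assumes "f holomorphic_on {s. Re s > b}" "g holomorphic_on {s. Re s > b}" "b \<le> c"
    and "\<And>s. Re s > c \<Longrightarrow> f s = g s" and "Re s > b"
  shows "f s = g s"
proof (rule analytic_continuation_open[of "{s. Re s > c}" "{s. Re s > b}" f g])
  show "{s. Re s > c} \<noteq> {}" by (auto intro!: exI[of _ "of_real (c + 1)"])
  show "connected {s. Re s > b}" by (intro convex_connected convex_halfspace_Re_gt)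
qed (use assms in \<open>auto simp: open_halfspace_Re_gt\<close>)

text \<open>The continuations to the half-planes agree on overlaps and glue together. The two
  special values come from the recursion with n = 0, which continues to hold for Re s > -1.\<close>

lemma hurwitz_entire:
  assumes \<alpha>: "\<alpha> > 0"
  obtains Z where "Z holomorphic_on UNIV" "\<And>s. Re s > 1 \<Longrightarrow> Z s = (s - 1) * hurwitz_series \<alpha> s"
    "Z 1 = 1" "Z 0 = of_real \<alpha> - 1 / 2"
proof -
  obtain Y where hol: "\<And>n. Y n holomorphic_on {s. Re s > 1 - real n}"
    and Y: "\<And>n s. Re s > 1 \<Longrightarrow> Y n s = (s - 1) * hurwitz_series \<alpha> s"
    using hurwitz_halfplane[OF \<alpha>] by metis
  define N where "N = (\<lambda>s. Suc (nat \<lceil>1 - Re s\<rceil>))"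
  define Z where "Z = (\<lambda>s. Y (N s) s)"
  have N: "Re s > 1 - real (N s)" for s unfolding N_def by linarith
  have Yeq: "Y n s = Y k s" if "n \<le> k" "Re s > 1 - real n" for n k s
  proof (rule halfplane_identity[where f = "Y n" and g = "Y k" and b = "1 - real n" and c = 1])
    show "Y k holomorphic_on {s. Re s > 1 - real n}"
      using that by (intro holomorphic_on_subset[OF hol]) auto
  qed (use hol Y that in auto)
  have ZY: "Z s = Y n s" if "Re s > 1 - real n" for n s
  proof (cases "n \<le> N s")
    case True
    then show ?thesis unfolding Z_def by (rule Yeq[OF _ that, symmetric])
  next
    case False
    then show ?thesis unfolding Z_def by (intro Yeq N) simp
  qed
  have holZ: "Z holomorphic_on UNIV"
  proof -
    have "Z holomorphic_on (\<Union>n. {s. Re s > 1 - real n})"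
    proof (rule holomorphic_on_UN_open)
      show "Z holomorphic_on {s. Re s > 1 - real n}" for n
        by (rule holomorphic_transform[OF hol[of n]]) (simp add: ZY)
    qed (rule open_halfspace_Re_gt)
    moreover have "(\<Union>n. {s. Re s > 1 - real n}) = UNIV" using N by blast
    ultimately show ?thesis by simp
  qed
  have Zs: "Z s = (s - 1) * hurwitz_series \<alpha> s" if "Re s > 1" for s
    using ZY[of 0 s] Y[of s 0] that by simp
  have rec: "Z s = of_real \<alpha> powr (1 - s) - (1 - s) / 2 * Z (s + 1) + (\<Sum>j. zeta_rem 2 s (real j + \<alpha>))"
    if "Re s > - 1" for s
  proof (rule halfplane_identity[where f = Z and b = "- 1" and c = 1 and
      g = "\<lambda>s. of_real \<alpha> powr (1 - s) - (1 - s) / 2 * Z (s + 1) + (\<Sum>j. zeta_rem 2 s (real j + \<alpha>))"])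
    show "Z holomorphic_on {s. Re s > - 1}" by (rule holomorphic_on_subset[OF holZ]) auto
    have "(\<lambda>s. Z (s + 1)) holomorphic_on {s. Re s > - 1}"
      by (intro holomorphic_on_compose_gen[of "\<lambda>s. s + 1" "{s. Re s > - 1}", OF _ holZ, unfolded o_def])
        (auto intro!: holomorphic_intros)
    moreover have "(\<lambda>s. \<Sum>j. zeta_rem 2 s (real j + \<alpha>)) holomorphic_on {s. Re s > - 1}"
      using holomorphic_zeta_rem_sum[OF \<alpha>, of 2] by simp
    ultimately show "(\<lambda>s. of_real \<alpha> powr (1 - s) - (1 - s) / 2 * Z (s + 1) + (\<Sum>j. zeta_rem 2 s (real j + \<alpha>)))
       holomorphic_on {s. Re s > - 1}"
      using \<alpha> by (intro holomorphic_intros) auto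
    show "Z s = of_real \<alpha> powr (1 - s) - (1 - s) / 2 * Z (s + 1) + (\<Sum>j. zeta_rem 2 s (real j + \<alpha>))"
      if "Re s > 1" for s
      using hurwitz_recursion[OF \<alpha> that Zs, of 0] by (simp add: falling_def numeral_2_eq_2)
  qed (use that in auto)
  have x: "complex_of_real x + 1 \<noteq> 0" "x \<noteq> 0" if "x > 0" for x
    using that of_real_eq_0_iff[of "x + 1", where 'a = complex] by (auto simp del: of_real_eq_0_iff)
  \<comment> \<open>For s = 1 and s = 0 the expanded power is a polynomial of degree 0 or 1 in
    \<open>x\<close>, so its Taylor expansion is exact and the series of remainders
    disappears.\<close>
  have r1: "zeta_rem 2 1 x = 0" if "x > 0" for x
    using x[OF that] by (simp add: zeta_rem_def falling_def numeral_2_eq_2)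
  have r0: "zeta_rem 2 0 x = 0" if "x > 0" for x
    using x[OF that] by (simp add: zeta_rem_def falling_def numeral_2_eq_2)
  have pos: "real j + \<alpha> > 0" for j using \<alpha> by simp
  have "Z 1 = of_real \<alpha> powr (1 - 1) - (1 - 1) / 2 * Z (1 + 1) + (\<Sum>j. zeta_rem 2 1 (real j + \<alpha>))"
    by (rule rec) simp
  then have Z1: "Z 1 = 1" unfolding r1[OF pos] using \<alpha> by simp
  have "Z 0 = of_real \<alpha> powr (1 - 0) - (1 - 0) / 2 * Z (0 + 1) + (\<Sum>j. zeta_rem 2 0 (real j + \<alpha>))"
    by (rule rec) simp
  then have Z0: "Z 0 = of_real \<alpha> - 1 / 2" unfolding r0[OF pos] using \<alpha> Z1 by simp
  show thesis by (rule that[OF holZ Zs Z1 Z0])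
qed

text \<open>The continuation is Z s / (s - 1). As \<open>Z 1\<close> is 1, there is a genuine pole
  at 1, and division by zero yields 0 there, which is precisely the value a nicely meromorphic
  function takes at a pole.\<close>

lemma hurwitz_zeta_properties:
  assumes \<alpha>: "\<alpha> > 0"
  shows hurwitz_zeta_eq_series: "Re s > 1 \<Longrightarrow> hurwitz_zeta s \<alpha> = hurwitz_series \<alpha> s"
    and hurwitz_zeta_meromorphic: "(\<lambda>s. hurwitz_zeta s \<alpha>) meromorphic_on UNIV"
    and hurwitz_zeta_analytic: "s \<noteq> 1 \<Longrightarrow> (\<lambda>s. hurwitz_zeta s \<alpha>) analytic_on {s}"
    and hurwitz_zeta_0: "hurwitz_zeta 0 \<alpha> = 1 / 2 - of_real \<alpha>"
proof -
  obtain Z where Z: "Z holomorphic_on UNIV" "\<And>s. Re s > 1 \<Longrightarrow> Z s = (s - 1) * hurwitz_series \<alpha> s"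
    "Z 1 = 1" "Z 0 = of_real \<alpha> - 1 / 2" using hurwitz_entire[OF \<alpha>] by blast
  define F where "F = (\<lambda>s. Z s / (s - 1))"
  have an: "F analytic_on {s}" if "s \<noteq> 1" for s
    unfolding F_def using Z(1) that by (intro analytic_intros) (auto simp: analytic_on_holomorphic)
  have mero: "F meromorphic_on UNIV"
    unfolding F_def by (intro meromorphic_intros analytic_on_imp_meromorphic_on)
      (use Z(1) in \<open>auto simp: analytic_on_open intro!: analytic_intros\<close>)
  have pole: "is_pole F 1"
    unfolding F_def
  proof (rule is_pole_divide)
    show "isCont Z 1" using Z(1) by (metis UNIV_I continuous_on_eq_continuous_at holomorphic_on_imp_continuous_on open_UNIV)
    show "filterlim (\<lambda>s. s - 1 :: complex) (at 0) (at 1)"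
      by (intro filterlim_atI tendsto_eq_intros) (auto simp: eventually_at_filter)
  qed (use Z in auto)
  have "F nicely_meromorphic_on UNIV"
    unfolding nicely_meromorphic_on_def
  proof (intro conjI ballI mero)
    fix z show "(is_pole F z \<and> F z = 0) \<or> F \<midarrow>z\<rightarrow> F z"
    proof (cases "z = 1")
      case True then show ?thesis using pole by (simp add: F_def)
    next
      case False
      then show ?thesis using an analytic_at_imp_isCont isContD by blast
    qed
  qed
  then have eq: "mero_cont 1 (hurwitz_series \<alpha>) = F"
    by (rule mero_cont_eqI) (use Z in \<open>auto simp: F_def\<close>)
  have eq': "(\<lambda>s. hurwitz_zeta s \<alpha>) = F" by (simp only: hurwitz_zeta_def eq)
  have eq'': "hurwitz_zeta s \<alpha> = F s" for s by (simp only: hurwitz_zeta_def eq)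
  show "Re s > 1 \<Longrightarrow> hurwitz_zeta s \<alpha> = hurwitz_series \<alpha> s"
    unfolding eq'' F_def using Z(2) by auto
  show "(\<lambda>s. hurwitz_zeta s \<alpha>) meromorphic_on UNIV" unfolding eq' by (rule mero)
  show "s \<noteq> 1 \<Longrightarrow> (\<lambda>s. hurwitz_zeta s \<alpha>) analytic_on {s}" unfolding eq' by (rule an)
  show "hurwitz_zeta 0 \<alpha> = 1 / 2 - of_real \<alpha>" unfolding eq'' F_def using Z by simp
qed

section \<open>A product of sines\<close>

text \<open>Factor X^p - 1 over the roots of unity, cancel X - 1 against the geometric sum, and
  evaluate the quotient at 1.\<close>

lemma prod_one_minus_roots_of_unity:
  fixes p :: nat
  assumes p: "p \<ge> 1"
  shows "(\<Prod>j=1..<p. 1 - cis (2 * pi * real j / real p)) = of_nat p"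
proof -
  let ?z = "\<lambda>j. cis (2 * pi * real j / real p)"
  have inj: "inj_on ?z {..<p}"
  proof -
    have "(\<lambda>j. exp (2 * of_real pi * \<i> * of_nat j / of_nat p)) = ?z"
      by (simp add: cis_conv_exp mult_ac fun_eq_iff)
    then show ?thesis using bij_betw_roots_unity[of p] p by (simp add: bij_betw_def)
  qed
  have z0: "?z 0 = 1" by simp
  have root: "?z j ^ p = 1" for j
  proof -
    have "real p * (2 * pi * real j / real p) = 2 * pi * real j" using p by simp
    then have "?z j ^ p = cis (2 * pi * real j)" unfolding Complex.DeMoivre by (simp only:)
    then show ?thesis by simp
  qed
  have fac: "Polynomial.monom 1 p - 1 = (\<Prod>j<p. [:- ?z j, 1:])"
  proof (rule poly_eqI_degree_lead_coeff[where A = "?z ` {..<p}" and n = p])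
    show "card (?z ` {..<p}) \<ge> p" using inj by (simp add: card_image)
    show "Polynomial.degree (Polynomial.monom 1 p - 1 :: complex poly) \<le> p"
      by (intro degree_diff_le) (auto simp: degree_monom_eq)
    have d: "Polynomial.degree (\<Prod>j<p. [:- ?z j, 1:]) = p" by (subst degree_prod_eq_sum_degree) auto
    then show "Polynomial.degree (\<Prod>j<p. [:- ?z j, 1:]) \<le> p" by simp
    have "Polynomial.lead_coeff (\<Prod>j<p. [:- ?z j, 1:]) = 1" by (simp add: lead_coeff_prod)
    then show "Polynomial.coeff (Polynomial.monom 1 p - 1) p = Polynomial.coeff (\<Prod>j<p. [:- ?z j, 1:]) p"
      using d p by simp
  qed (use root in \<open>auto simp: poly_prod poly_monom intro!: bexI\<close>)
  have "Polynomial.monom 1 p - 1 = [:- 1, 1:] * (\<Sum>i<p. Polynomial.monom 1 i :: complex poly)"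
  proof -
    have "Polynomial.monom 1 p - 1 = (Polynomial.monom 1 1 :: complex poly) ^ p - 1" by (simp add: monom_power)
    also have "\<dots> = (Polynomial.monom 1 1 - 1) * (\<Sum>i<p. Polynomial.monom 1 1 ^ i)" by (rule power_diff_1_eq)
    finally show ?thesis by (simp add: monom_power monom_altdef one_pCons)
  qed
  moreover have "(\<Prod>j<p. [:- ?z j, 1:]) = [:- 1, 1:] * (\<Prod>j=1..<p. [:- ?z j, 1:])"
    using p by (simp add: lessThan_atLeast0 prod.atLeast_Suc_lessThan)
  ultimately have "(\<Sum>i<p. Polynomial.monom 1 i :: complex poly) = (\<Prod>j=1..<p. [:- ?z j, 1:])"
  proof -
    assume "Polynomial.monom 1 p - 1 = [:- 1, 1:] * (\<Sum>i<p. Polynomial.monom 1 i :: complex poly)"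
      "(\<Prod>j<p. [:- ?z j, 1:]) = [:- 1, 1:] * (\<Prod>j=1..<p. [:- ?z j, 1:])"
    then have "[:- 1, 1:] * (\<Sum>i<p. Polynomial.monom 1 i :: complex poly) = [:- 1, 1:] * (\<Prod>j=1..<p. [:- ?z j, 1:])"
      using fac by (simp only:)
    then show ?thesis by (subst (asm) mult_left_cancel) auto
  qed
  then have "poly (\<Sum>i<p. Polynomial.monom 1 i :: complex poly) 1 = poly (\<Prod>j=1..<p. [:- ?z j, 1:]) 1" by simp
  then show ?thesis by (simp add: poly_sum poly_monom poly_prod)
qed

lemma cmod_one_minus_cis: "cmod (1 - cis (2 * x)) = 2 * \<bar>sin x\<bar>"
proof -
  have "1 - cis (2 * x) = - 2 * \<i> * of_real (sin x) * cis x"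
    by (auto simp: complex_eq_iff cis.simps cos_double_sin sin_double power2_eq_square)
  then show ?thesis by (simp add: norm_mult)
qed

text \<open>The modulus of 1 - exp(2 \<pi> i j / p) is 2 sin(j \<pi> / p). The product over all j is
  p, and the factors for j and p - j agree, so half of them give the square root.\<close>

lemma prod_sin_half:
  fixes p m :: nat
  assumes p: "p = 2 * m + 1"
  shows "(\<Prod>j=1..m. 2 * sin (real j * pi / real p)) = sqrt (real p)"
proof -
  let ?f = "\<lambda>j. 2 * sin (real j * pi / real p)"
  have pos: "?f j \<ge> 0" if "j \<le> p" for j
    using that p by (auto intro!: mult_nonneg_nonneg sin_ge_zero simp: divide_le_eq mult.commute[of pi])
  have "real p = cmod (\<Prod>j=1..<p. 1 - cis (2 * (real j * pi / real p)))"
  proof -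
    have "2 * (real j * pi / real p) = 2 * pi * real j / real p" for j by simp
    then have "(\<Prod>j=1..<p. 1 - cis (2 * (real j * pi / real p))) = of_nat p"
      using prod_one_minus_roots_of_unity[of p] p by (simp only:)
    then show ?thesis by (simp only: norm_of_nat)
  qed
  also have "\<dots> = (\<Prod>j=1..<p. \<bar>?f j\<bar>)" by (simp only: prod_norm[symmetric] cmod_one_minus_cis) (simp add: abs_mult)
  also have "\<dots> = (\<Prod>j=1..<p. ?f j)" using pos by (intro prod.cong refl abs_of_nonneg) auto
  also have "{1..<p} = {1..m} \<union> {m+1..2*m}" using p by auto
  also have "prod ?f \<dots> = prod ?f {1..m} * prod ?f {m+1..2*m}" by (rule prod.union_disjoint) auto
  also have "prod ?f {m+1..2*m} = prod ?f {1..m}"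
  proof (rule prod.reindex_bij_witness[where i = "\<lambda>j. p - j" and j = "\<lambda>j. p - j"])
    fix j assume j: "j \<in> {m+1..2*m}"
    then have "real (p - j) * pi / real p = pi - real j * pi / real p"
      using p by (simp add: of_nat_diff field_simps)
    then show "?f (p - j) = ?f j" by simp
  qed (use p in auto)
  finally have "real p = prod ?f {1..m} ^ 2" by (simp add: power2_eq_square)
  moreover have "prod ?f {1..m} \<ge> 0" using pos p by (intro prod_nonneg) auto
  ultimately show ?thesis by (metis real_sqrt_unique)
qed

text \<open>Gauss's lemma: modulo \<open>p\<close> the multiples \<open>k j\<close> with \<open>1 \<le> j \<le> m\<close> are the numbers \<open>1, \<dots>, m\<close> up to signs
  \<open>\<sigma> j\<close>, whose product is the Legendre symbol.\<close>

lemma prod_sin_Legendre: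
  fixes p k r m :: nat
  assumes pr: "prime p" and p: "p = 4 * r + 3" and m: "m = 2 * r + 1" and k: "k \<in> {1..p-1}"
  shows "(\<Prod>j=1..m. 2 * sin (real j * (real k * pi / real p)))
    = (- 1) ^ ((r + 1) * (k + 1)) * of_int (Legendre (int k) (int p)) * sqrt (real p)"
proof -
  have pm: "p = 2 * m + 1" using p m by simp
  define t where "t = (\<lambda>j. k * j mod p)"
  define q where "q = (\<lambda>j. k * j div p)"
  define g where "g = (\<lambda>j. if t j \<le> m then t j else p - t j)"
  define \<sigma> :: "nat \<Rightarrow> int" where "\<sigma> = (\<lambda>j. if t j \<le> m then 1 else - 1)"
  have kp: "\<not> p dvd k" using k by (auto dest: dvd_imp_le)
  have t0: "t j > 0" "t j < p" if "j \<in> {1..m}" for j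
  proof -
    have "\<not> p dvd j" using that pm by (auto dest: dvd_imp_le)
    then have "\<not> p dvd k * j" using kp pr by (simp add: prime_dvd_mult_iff)
    then show "t j > 0" by (simp add: t_def mod_greater_zero_iff_not_dvd)
    show "t j < p" using pm by (simp add: t_def)
  qed
  have kj: "k * j = p * q j + t j" for j by (simp add: q_def t_def)
  have cong: "[int k * int j = \<sigma> j * int (g j)] (mod int p)" if "j \<in> {1..m}" for j
  proof -
    have "int k * int j = int p * int (q j) + int (t j)" using kj[of j] by (metis of_nat_add of_nat_mult)
    then have "[int k * int j = int (t j)] (mod int p)" by (simp add: cong_def)
    moreover have "[int (t j) = \<sigma> j * int (g j)] (mod int p)"
    proof (cases "t j \<le> m")
      case False
      then have "\<sigma> j * int (g j) = int (t j) - int p"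
        using t0[OF that] by (simp add: \<sigma>_def g_def of_nat_diff)
      then show ?thesis by (simp add: cong_def)
    qed (simp add: \<sigma>_def g_def)
    ultimately show ?thesis by (rule cong_trans)
  qed
  have g_in: "g ` {1..m} \<subseteq> {1..m}"
    using t0 pm by (fastforce simp: g_def)
  have g_inj: "inj_on g {1..m}"
  proof (rule inj_onI)
    fix i j assume i: "i \<in> {1..m}" and j: "j \<in> {1..m}" and e: "g i = g j"
    \<comment> \<open>Equal values of \<open>g\<close> make k i and k j congruent up to sign.
      Cancelling k leaves i congruent to j or -j, and for numbers between 1 and m only i = j is
      possible.\<close>
    have "[int k * int i = \<sigma> i * \<sigma> j * (int k * int j)] (mod int p)"
    proof -
      have "[\<sigma> i * \<sigma> j * (int k * int j) = \<sigma> i * \<sigma> j * (\<sigma> j * int (g j))] (mod int p)"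
        by (rule cong_scalar_left[OF cong[OF j]])
      also have "\<sigma> i * \<sigma> j * (\<sigma> j * int (g j)) = \<sigma> i * int (g i)" using e by (simp add: \<sigma>_def)
      finally show ?thesis using cong[OF i] cong_sym cong_trans by blast
    qed
    then have "int p dvd int k * (int i - \<sigma> i * \<sigma> j * int j)"
      by (simp add: cong_iff_dvd_diff algebra_simps)
    then have d: "int p dvd int i - \<sigma> i * \<sigma> j * int j"
      using kp pr by (simp add: prime_dvd_mult_iff)
    have "\<sigma> i * \<sigma> j = 1 \<or> \<sigma> i * \<sigma> j = - 1" by (simp add: \<sigma>_def)
    then show "i = j"
    proof
      assume "\<sigma> i * \<sigma> j = 1"
      then have "int p dvd int i - int j" using d by simp
      moreover have "\<bar>int i - int j\<bar> < int p" using i j pm by auto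
      ultimately show ?thesis using zdvd_imp_le[of "int p" "\<bar>int i - int j\<bar>"] by fastforce
    next
      assume "\<sigma> i * \<sigma> j = - 1"
      then have "int p dvd int i + int j" using d by simp
      then show ?thesis using i j pm zdvd_imp_le[of "int p" "int i + int j"] by auto
    qed
  qed
  have g_bij: "bij_betw g {1..m} {1..m}"
    using g_in g_inj by (simp add: bij_betw_def endo_inj_surj)
  have reindex: "(\<Prod>j=1..m. f (g j)) = (\<Prod>j=1..m. f j)" for f :: "nat \<Rightarrow> 'a::comm_monoid_mult"
    by (rule prod.reindex_bij_betw[OF g_bij])
  have leg: "(\<Prod>j=1..m. \<sigma> j) = Legendre (int k) (int p)"
  proof -
    have "[(\<Prod>j=1..m. int k * int j) = (\<Prod>j=1..m. \<sigma> j * int (g j))] (mod int p)"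
      by (rule cong_prod[OF cong])
    then have "[int k ^ m * (\<Prod>j=1..m. int j) = (\<Prod>j=1..m. \<sigma> j) * (\<Prod>j=1..m. int j)] (mod int p)"
      unfolding prod.distrib reindex[of int] by simp
    moreover have "coprime (\<Prod>j=1..m. int j) (int p)"
    proof (rule prod_coprime_left)
      fix j assume "j \<in> {1..m}"
      then have "\<not> p dvd j" using pm by (auto dest: dvd_imp_le)
      then have "\<not> int p dvd int j" by simp
      then show "coprime (int j) (int p)" using pr
        by (metis coprime_commute prime_imp_coprime prime_nat_int_transfer)
    qed
    ultimately have "[int k ^ m = (\<Prod>j=1..m. \<sigma> j)] (mod int p)"
      by (simp add: cong_mult_rcancel)
    moreover have "[Legendre (int k) (int p) = int k ^ m] (mod int p)"
      using euler_criterion[of p "int k"] pr p m by simp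
    ultimately have c: "[Legendre (int k) (int p) = (\<Prod>j=1..m. \<sigma> j)] (mod int p)" by (rule cong_trans[rotated])
    \<comment> \<open>Both sides have absolute value at most 1 and p is at least 3, so the
      congruence is an equality.\<close>
    have a: "\<bar>\<Prod>j=1..m. \<sigma> j\<bar> \<le> 1" unfolding abs_prod by (rule prod_le_1) (auto simp: \<sigma>_def)
    have "\<bar>Legendre (int k) (int p)\<bar> \<le> 1" by (simp add: Legendre_def)
    then have "\<bar>Legendre (int k) (int p) - (\<Prod>j=1..m. \<sigma> j)\<bar> < int p" using a p by linarith
    moreover have "int p dvd Legendre (int k) (int p) - (\<Prod>j=1..m. \<sigma> j)" using c by (simp add: cong_iff_dvd_diff)
    ultimately show ?thesis using zdvd_imp_le[of "int p" "\<bar>Legendre (int k) (int p) - (\<Prod>j=1..m. \<sigma> j)\<bar>"]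
      by fastforce
  qed
  have sn: "sin (real j * (real k * pi / real p)) = (- 1) ^ q j * sin (real (g j) * pi / real p)" if "j \<in> {1..m}" for j
  proof -
    have "real k * real j = real p * real (q j) + real (t j)" using kj[of j] by (metis of_nat_add of_nat_mult)
    then have "real j * (real k * pi / real p) = real (t j) * pi / real p + real (q j) * pi"
      using p by (simp add: field_simps)
    then have "sin (real j * (real k * pi / real p)) = (- 1) ^ q j * sin (real (t j) * pi / real p)"
      by (simp add: sin_add)
    also have "sin (real (t j) * pi / real p) = sin (real (g j) * pi / real p)"
    proof (cases "t j \<le> m")
      case False
      then have "real (g j) * pi / real p = pi - real (t j) * pi / real p"
        using t0[OF that] by (simp add: g_def of_nat_diff field_simps)
      then show ?thesis by simp
    qed (simp add: g_def)
    finally show ?thesis .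
  qed
  \<comment> \<open>The sign from sin(x + q \<pi>) is put in terms of k j and \<open>g\<close>. As p
    is odd, k j = p q + t gives q the parity of k j + t; replacing t by p - t changes the parity,
    which \<open>\<sigma>\<close> records.\<close>
  have par: "(- 1 :: real) ^ q j = (- 1) ^ (k * j) * of_int (\<sigma> j) * (- 1) ^ g j" if "j \<in> {1..m}" for j
  proof -
    have "(- 1 :: real) ^ (k * j) = ((- 1) ^ p) ^ q j * (- 1) ^ t j"
      unfolding kj power_add power_mult ..
    also have "(- 1 :: real) ^ p = - 1" using pm by simp
    finally have 1: "(- 1 :: real) ^ (k * j) = (- 1) ^ q j * (- 1) ^ t j" .
    have 2: "(- 1 :: real) ^ t j = of_int (\<sigma> j) * (- 1) ^ g j"
    proof (cases "t j \<le> m")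
      case False
      then have "(- 1 :: real) ^ t j * (- 1) ^ g j = (- 1) ^ p"
        using t0[OF that] by (simp add: g_def flip: power_add)
      then have "(- 1 :: real) ^ t j * (- 1) ^ g j = - 1" using pm by simp
      moreover have "(- 1 :: real) ^ g j * (- 1) ^ g j = 1" by (simp flip: power_add)
      ultimately have "(- 1 :: real) ^ t j = - ((- 1) ^ g j)"
        by (metis mult.assoc mult.left_neutral mult.right_neutral mult_minus_left)
      then show ?thesis using False by (simp add: \<sigma>_def)
    qed (simp add: \<sigma>_def g_def)
    have 3: "of_int (\<sigma> j) * of_int (\<sigma> j) = (1::real)" by (simp add: \<sigma>_def)
    have 4: "(- 1 :: real) ^ g j * (- 1) ^ g j = 1" by (simp flip: power_add)
    show ?thesis unfolding 1 2 using 3 4 by (simp add: algebra_simps)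
  qed
  \<comment> \<open>The exponents sum to m (m + 1) / 2 = (2 r + 1) (r + 1), which has the parity of
    r + 1.\<close>
  have sj: "(\<Prod>j=1..m. (- 1 :: real) ^ j) = (- 1) ^ (r + 1)"
  proof -
    have "(\<Prod>j=1..m. (- 1 :: real) ^ j) = (- 1) ^ (\<Sum>j=1..m. j)" by (simp add: power_sum)
    also have "(\<Sum>j=1..m. j) = (2 * r + 1) * (r + 1)"
    proof -
      have "2 * (\<Sum>j=1..m. j) = m * (m + 1)" by (induction m) auto
      then show ?thesis by (simp add: m)
    qed
    also have "(- 1 :: real) ^ ((2 * r + 1) * (r + 1)) = (- 1) ^ (r + 1)"
    proof -
      have "(- 1 :: real) ^ ((2 * r + 1) * (r + 1)) = ((- 1) ^ (2 * r + 1)) ^ (r + 1)" by (rule power_mult)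
      then show ?thesis by simp
    qed
    finally show ?thesis .
  qed
  have "(\<Prod>j=1..m. 2 * sin (real j * (real k * pi / real p)))
     = (\<Prod>j=1..m. ((- 1) ^ j) ^ k * of_int (\<sigma> j) * (- 1) ^ g j * (2 * sin (real (g j) * pi / real p)))"
  proof (rule prod.cong[OF refl])
    fix j assume j: "j \<in> {1..m}"
    have e: "(- 1 :: real) ^ (k * j) = ((- 1) ^ j) ^ k" by (simp add: mult.commute flip: power_mult)
    show "2 * sin (real j * (real k * pi / real p))
      = ((- 1) ^ j) ^ k * of_int (\<sigma> j) * (- 1) ^ g j * (2 * sin (real (g j) * pi / real p))"
      unfolding sn[OF j] par[OF j] e by (simp only: mult_ac)
  qed
  also have "\<dots> = (\<Prod>j=1..m. (- 1) ^ j) ^ k * of_int (\<Prod>j=1..m. \<sigma> j) * (\<Prod>j=1..m. (- 1) ^ j)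
      * (\<Prod>j=1..m. 2 * sin (real j * pi / real p))"
    unfolding prod.distrib reindex[of "\<lambda>j. (- 1) ^ j"] reindex[of "\<lambda>j. sin (real j * pi / real p)"]
    by (simp add: prod_power_distrib)
  also have "\<dots> = (- 1) ^ ((r + 1) * (k + 1)) * of_int (Legendre (int k) (int p)) * sqrt (real p)"
  proof -
    have "((- 1 :: real) ^ (r + 1)) ^ k * (- 1) ^ (r + 1) = (- 1) ^ ((r + 1) * (k + 1))"
      by (simp only: distrib_left mult_1_right power_add power_mult)
    then show ?thesis unfolding sj leg prod_sin_half[OF pm] by (metis mult.assoc mult.commute)
  qed
  finally show ?thesis .
qed

section \<open>Fourier coefficients on the torus\<close>

definition int_periodic :: "('n::finite rvec \<Rightarrow> 'b) \<Rightarrow> bool" where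
  "int_periodic f \<longleftrightarrow> (\<forall>y i. f (y + axis i 1) = f y)"

lemma int_periodic_of_int:
  assumes "int_periodic f"
  shows "f (y + of_int n *\<^sub>R axis i 1) = f y"
proof (induction n rule: int_induct[where k = 0])
  case (step1 n)
  have "f (y + of_int (n + 1) *\<^sub>R axis i 1) = f ((y + of_int n *\<^sub>R axis i 1) + axis i 1)"
    by (simp add: algebra_simps)
  then show ?case using assms step1 by (simp add: int_periodic_def)
next
  case (step2 n)
  have "f (y + of_int n *\<^sub>R axis i 1) = f ((y + of_int (n - 1) *\<^sub>R axis i 1) + axis i 1)"
    by (simp add: algebra_simps)
  then show ?case using assms step2 by (simp add: int_periodic_def)
qed simp

text \<open>Cut the shifted cube at coordinate 1. The part beyond is the translate by one period of
  the slab that the shift left behind.\<close>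

lemma integral_periodic_shift_axis_unit:
  fixes f :: "'n::finite rvec \<Rightarrow> 'b::euclidean_space"
  assumes cont: "continuous_on UNIV f" and per: "int_periodic f" and t: "0 \<le> t" "t \<le> 1"
  shows "integral (cbox 0 1) (\<lambda>y. f (y + t *\<^sub>R axis i 1)) = integral (cbox 0 1) f"
proof -
  let ?e = "axis i 1 :: 'n rvec" and ?c = "t *\<^sub>R axis i 1 :: 'n rvec"
  define b :: "'n rvec" where "b = (\<chi> j. if j = i then t else 1)"
  have mem: "x \<in> cbox a b \<longleftrightarrow> (a $ i \<le> x $ i \<and> x $ i \<le> b $ i) \<and> (\<forall>j. j \<noteq> i \<longrightarrow> a $ j \<le> x $ j \<and> x $ j \<le> b $ j)"
    for a b x :: "'n rvec" unfolding mem_box_cart by metis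
  have int: "f integrable_on cbox a b" for a b
    by (intro integrable_continuous continuous_on_subset[OF cont]) auto
  have ib: "?e \<in> Basis" by simp
  have xi: "x \<bullet> ?e = x $ i" for x :: "'n rvec" by (simp add: inner_axis)
  have S1: "cbox ?c (1 + ?c) \<inter> {x. x \<bullet> ?e \<le> 1} = cbox 0 1 \<inter> {x. t \<le> x \<bullet> ?e}"
    unfolding xi by (rule Set.set_eqI) (use t in \<open>auto simp: mem axis_def\<close>)
  have S2: "cbox ?c (1 + ?c) \<inter> {x. 1 \<le> x \<bullet> ?e} = cbox (0 + ?e) (b + ?e)"
    unfolding xi by (rule Set.set_eqI) (use t in \<open>auto simp: mem axis_def b_def\<close>)
  have S3: "cbox 0 1 \<inter> {x. x \<bullet> ?e \<le> t} = cbox 0 b"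
    unfolding xi by (rule Set.set_eqI) (use t in \<open>auto simp: mem axis_def b_def\<close>)
  have "integral (cbox 0 1) (\<lambda>y. f (y + ?c)) = integral (cbox ?c (1 + ?c)) f"
    using integral_shift_cbox[of ?c ?c "1 + ?c" f] by simp
  also have "\<dots> = integral (cbox 0 1 \<inter> {x. t \<le> x \<bullet> ?e}) f + integral (cbox (0 + ?e) (b + ?e)) f"
    using integral_split[OF int ib, of ?c "1 + ?c" 1] by (simp only: S1 S2)
  also have "integral (cbox (0 + ?e) (b + ?e)) f = integral (cbox 0 b) (f \<circ> (+) ?e)"
    by (simp only: integral_shift_cbox_plus)
  also have "f \<circ> (+) ?e = f" using per by (auto simp: int_periodic_def fun_eq_iff add.commute)
  also have "integral (cbox 0 1 \<inter> {x. t \<le> x \<bullet> ?e}) f + integral (cbox 0 b) f = integral (cbox 0 1) f"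
    using integral_split[OF int ib, of 0 1 t] by (simp only: S3 add.commute)
  finally show ?thesis .
qed

lemma continuous_on_shift:
  assumes "continuous_on UNIV f" shows "continuous_on UNIV (\<lambda>y. f (y + z :: 'n::finite rvec))"
  by (rule continuous_on_compose2[OF assms]) (auto intro!: continuous_intros)

lemma int_periodic_shift: "int_periodic f \<Longrightarrow> int_periodic (\<lambda>y. f (y + z))"
  by (simp add: int_periodic_def) (metis add.assoc add.commute)

lemma integral_periodic_shift:
  fixes f :: "'n::finite rvec \<Rightarrow> 'b::euclidean_space"
  assumes cont: "continuous_on UNIV f" and per: "int_periodic f"
  shows "integral (cbox 0 1) (\<lambda>y. f (y + z)) = integral (cbox 0 1) f"
proof -
  have ax: "integral (cbox 0 1) (\<lambda>y. g (y + t *\<^sub>R axis i 1)) = integral (cbox 0 1) g"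
    if g: "continuous_on UNIV g" "int_periodic g" for g :: "'n rvec \<Rightarrow> 'b" and t i
  proof -
    have "y + t *\<^sub>R axis i 1 = y + frac t *\<^sub>R axis i 1 + of_int \<lfloor>t\<rfloor> *\<^sub>R axis i 1" for y :: "'n rvec"
      by (simp add: frac_def algebra_simps)
    then have "g (y + t *\<^sub>R axis i 1) = g (y + frac t *\<^sub>R axis i 1)" for y
      using int_periodic_of_int[OF g(2)] by metis
    then show ?thesis
      using integral_periodic_shift_axis_unit[OF g, of "frac t" i] frac_lt_1[of t] by simp
  qed
  have "integral (cbox 0 1) (\<lambda>y. f (y + (\<Sum>i\<in>A. z $ i *\<^sub>R axis i 1))) = integral (cbox 0 1) f"
    if "finite A" for A
    using that
  proof (induction A)
    case (insert i A)
    have "integral (cbox 0 1) (\<lambda>y. f ((y + z $ i *\<^sub>R axis i 1) + (\<Sum>i\<in>A. z $ i *\<^sub>R axis i 1)))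
       = integral (cbox 0 1) (\<lambda>y. f (y + (\<Sum>i\<in>A. z $ i *\<^sub>R axis i 1)))"
      by (rule ax[OF continuous_on_shift[OF cont] int_periodic_shift[OF per]])
    then show ?case using insert by (simp add: add.assoc)
  qed simp
  from this[of UNIV] show ?thesis by (simp add: basis_expansion flip: scalar_mult_eq_scaleR)
qed

text \<open>The integral of the translate of \<open>f\<close> by t v does not depend on t;
  differentiate under the integral at t = 0. This stands in for integration by parts on the
  torus.\<close>

lemma integral_periodic_deriv:
  fixes f f' :: "'n::finite rvec \<Rightarrow> 'b::euclidean_space"
  assumes cont: "continuous_on UNIV f" and per: "int_periodic f"
    and der: "\<And>x. ((\<lambda>t. f (x + t *\<^sub>R v)) has_vector_derivative f' x) (at 0)"
    and cont': "continuous_on UNIV f'"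
  shows "integral (cbox 0 1) f' = 0"
proof -
  let ?F = "\<lambda>t. integral (cbox 0 1) (\<lambda>y. f (y + t *\<^sub>R v))"
  have "(?F has_vector_derivative integral (cbox 0 1) (\<lambda>y. f' (y + 0 *\<^sub>R v))) (at 0 within UNIV)"
  proof (rule leibniz_rule_vector_derivative)
    fix t y
    have "((\<lambda>h. h - t) has_vector_derivative 1) (at t)"
      by (auto intro!: derivative_eq_intros)
    moreover have "((\<lambda>h. f ((y + t *\<^sub>R v) + h *\<^sub>R v)) has_vector_derivative f' (y + t *\<^sub>R v)) (at (t - t))"
      using der by simp
    ultimately have "((\<lambda>h. f ((y + t *\<^sub>R v) + h *\<^sub>R v)) \<circ> (\<lambda>h. h - t) has_vector_derivative 1 *\<^sub>R f' (y + t *\<^sub>R v)) (at t)"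
      by (rule vector_diff_chain_at)
    then show "((\<lambda>x. f (y + x *\<^sub>R v)) has_vector_derivative f' (y + t *\<^sub>R v)) (at t within UNIV)"
      by (simp add: o_def algebra_simps)
  next
    show "(\<lambda>y. f (y + t *\<^sub>R v)) integrable_on cbox 0 1" for t
      by (intro integrable_continuous continuous_on_subset[OF continuous_on_shift[OF cont]]) auto
    show "continuous_on (UNIV \<times> cbox 0 1) (\<lambda>(x, t). f' (t + x *\<^sub>R v))"
      unfolding split_def by (rule continuous_on_compose2[OF cont']) (auto intro!: continuous_intros)
  qed auto
  moreover have "?F t = integral (cbox 0 1) f" for t by (rule integral_periodic_shift[OF cont per])
  ultimately have "((\<lambda>t. integral (cbox 0 1) f) has_vector_derivative integral (cbox 0 1) f') (at (0::real))"
    by simp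
  moreover have "((\<lambda>t. integral (cbox 0 1) f) has_vector_derivative 0) (at (0::real))"
    by (rule has_vector_derivative_const)
  ultimately show ?thesis by (rule vector_derivative_unique_at)
qed

text \<open>Continuity and periodicity are built in so that the class is stable under translations
  and under multiplication by trigonometric polynomials.\<close>

definition zero_coeffs :: "('n::finite rvec \<Rightarrow> complex) \<Rightarrow> bool" where
  "zero_coeffs f \<longleftrightarrow> continuous_on UNIV f \<and> int_periodic f \<and>
     (\<forall>u. (\<forall>i. u $ i \<in> \<int>) \<longrightarrow> integral (cbox 0 1) (\<lambda>y. cis (2 * pi * (u \<bullet> y)) * f y) = 0)"

lemma int_periodic_cis:
  fixes u :: "'n::finite rvec"
  assumes "\<forall>i. u $ i \<in> \<int>" shows "int_periodic (\<lambda>y. cis (2 * pi * (u \<bullet> y)))"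
  unfolding int_periodic_def
proof safe
  fix y i
  have "cis (2 * pi * (u \<bullet> (y + axis i 1))) = cis (2 * pi * (u \<bullet> y)) * cis (2 * pi * (u $ i))"
    by (simp add: inner_add_right inner_axis distrib_left cis_mult)
  then show "cis (2 * pi * (u \<bullet> (y + axis i 1))) = cis (2 * pi * (u \<bullet> y))"
    using assms cis_multiple_2pi by simp
qed

lemma int_periodic_mult: "int_periodic f \<Longrightarrow> int_periodic g \<Longrightarrow> int_periodic (\<lambda>y. f y * g y)"
  by (simp add: int_periodic_def)

lemma integrable_cont:
  fixes f :: "'n::finite rvec \<Rightarrow> 'b::euclidean_space"
  shows "continuous_on UNIV f \<Longrightarrow> f integrable_on cbox a b"
  by (intro integrable_continuous) (rule continuous_on_subset, auto)

lemma zero_coeffs_cis: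
  fixes u :: "'a::finite rvec"
  assumes "zero_coeffs f" "\<forall>i. u $ i \<in> \<int>"
  shows "zero_coeffs (\<lambda>y. cis (2 * pi * (u \<bullet> y)) * f y)"
  unfolding zero_coeffs_def
proof (intro conjI allI impI)
  fix w :: "'a rvec" assume "\<forall>i. w $ i \<in> \<int>"
  then have "\<forall>i. (w + u) $ i \<in> \<int>" using assms by simp
  then have "integral (cbox 0 1) (\<lambda>y. cis (2 * pi * ((w + u) \<bullet> y)) * f y) = 0"
    using assms unfolding zero_coeffs_def by blast
  moreover have "cis (2 * pi * ((w + u) \<bullet> y)) * f y = cis (2 * pi * (w \<bullet> y)) * (cis (2 * pi * (u \<bullet> y)) * f y)" for y
    by (simp add: inner_add_left distrib_left mult.assoc flip: cis_mult)
  ultimately show "integral (cbox 0 1) (\<lambda>y. cis (2 * pi * (w \<bullet> y)) * (cis (2 * pi * (u \<bullet> y)) * f y)) = 0"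
    by simp
qed (use assms int_periodic_cis in \<open>auto simp: zero_coeffs_def intro!: continuous_intros int_periodic_mult\<close>)

lemma zero_coeffs_add:
  assumes f: "zero_coeffs f" and g: "zero_coeffs g"
  shows "zero_coeffs (\<lambda>y. f y + g y)"
  unfolding zero_coeffs_def
proof (intro conjI allI impI)
  have cf: "continuous_on UNIV f" and cg: "continuous_on UNIV g" using f g by (auto simp: zero_coeffs_def)
  show "continuous_on UNIV (\<lambda>y. f y + g y)" by (intro continuous_intros cf cg)
  show "int_periodic (\<lambda>y. f y + g y)" using f g by (simp add: zero_coeffs_def int_periodic_def)
  fix u :: "'a rvec" assume "\<forall>i. u $ i \<in> \<int>"
  then show "integral (cbox 0 1) (\<lambda>y. cis (2 * pi * (u \<bullet> y)) * (f y + g y)) = 0"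
    using f g unfolding distrib_left
    by (subst integral_add) (auto simp: zero_coeffs_def intro!: integrable_cont continuous_intros cf cg)
qed

lemma zero_coeffs_cmult:
  assumes f: "zero_coeffs f" shows "zero_coeffs (\<lambda>y. c * f y)"
proof -
  have "integral (cbox 0 1) (\<lambda>y. cis (2 * pi * (u \<bullet> y)) * (c * f y)) = 0" if "\<forall>i. u $ i \<in> \<int>" for u :: "'a rvec"
  proof -
    have "(\<lambda>y. cis (2 * pi * (u \<bullet> y)) * (c * f y)) = (\<lambda>y. c * (cis (2 * pi * (u \<bullet> y)) * f y))"
      by (simp add: mult_ac)
    then show ?thesis using f that by (simp add: zero_coeffs_def)
  qed
  then show ?thesis using f by (auto simp: zero_coeffs_def int_periodic_def intro!: continuous_intros)
qed

lemma zero_coeffs_sum: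
  assumes "finite A" "\<And>i. i \<in> A \<Longrightarrow> zero_coeffs (f i)"
  shows "zero_coeffs (\<lambda>y. \<Sum>i\<in>A. f i y)"
  using assms
proof (induction A)
  case empty
  show ?case by (simp add: zero_coeffs_def int_periodic_def)
qed (simp add: zero_coeffs_add)

lemma zero_coeffs_cos:
  assumes f: "zero_coeffs f"
  shows "zero_coeffs (\<lambda>y. of_real (cos (2 * pi * (y $ i))) * f y)"
proof -
  have 1: "zero_coeffs (\<lambda>y. cis (2 * pi * (axis i 1 \<bullet> y)) * f y)"
    by (rule zero_coeffs_cis[OF f]) (auto simp: axis_def)
  have 2: "zero_coeffs (\<lambda>y. cis (2 * pi * (axis i (- 1) \<bullet> y)) * f y)"
    by (rule zero_coeffs_cis[OF f]) (auto simp: axis_def)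
  have "zero_coeffs (\<lambda>y. (1 / 2) * (cis (2 * pi * (axis i 1 \<bullet> y)) * f y + cis (2 * pi * (axis i (- 1) \<bullet> y)) * f y))"
    by (intro zero_coeffs_cmult zero_coeffs_add 1 2)
  moreover have "(1 / 2) * (cis (2 * pi * (axis i 1 \<bullet> y)) * f y + cis (2 * pi * (axis i (- 1) \<bullet> y)) * f y)
     = of_real (cos (2 * pi * (y $ i))) * f y" for y
  proof -
    have "cis t + cis (- t) = 2 * of_real (cos t)" for t by (simp add: complex_eq_iff)
    then show ?thesis by (simp add: inner_axis' flip: distrib_right)
  qed
  ultimately show ?thesis by simp
qed

lemma zero_coeffs_shift:
  assumes f: "zero_coeffs f"
  shows "zero_coeffs (\<lambda>y. f (y + z))"
  unfolding zero_coeffs_def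
proof (intro conjI allI impI)
  have c: "continuous_on UNIV f" and p: "int_periodic f" using f by (auto simp: zero_coeffs_def)
  show "continuous_on UNIV (\<lambda>y. f (y + z))" by (rule continuous_on_shift[OF c])
  show "int_periodic (\<lambda>y. f (y + z))" by (rule int_periodic_shift[OF p])
  fix u :: "'a rvec" assume u: "\<forall>i. u $ i \<in> \<int>"
  let ?g = "\<lambda>y. cis (2 * pi * (u \<bullet> y)) * f y"
  have "(\<lambda>y. cis (2 * pi * (u \<bullet> y)) * f (y + z)) = (\<lambda>y. cis (- (2 * pi * (u \<bullet> z))) * ?g (y + z))"
    by (simp add: inner_add_right distrib_left cis_mult flip: mult.assoc)
  then have "integral (cbox 0 1) (\<lambda>y. cis (2 * pi * (u \<bullet> y)) * f (y + z))
     = cis (- (2 * pi * (u \<bullet> z))) * integral (cbox 0 1) (\<lambda>y. ?g (y + z))"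
    by (simp only: integral_mult_right)
  also have "integral (cbox 0 1) (\<lambda>y. ?g (y + z)) = integral (cbox 0 1) ?g"
    by (intro integral_periodic_shift int_periodic_mult int_periodic_cis u p continuous_intros c)
  finally show "integral (cbox 0 1) (\<lambda>y. cis (2 * pi * (u \<bullet> y)) * f (y + z)) = 0"
    using f u by (simp add: zero_coeffs_def)
qed

text \<open>Otherwise normalise \<open>f\<close> to have value 1 at the centre of the cube. The trigonometric polynomial \<open>T\<close>
  exceeds 1 near the centre and lies between 0 and 1 far from it, so the integrals of \<open>T\<^sup>N f\<close> tend to
  infinity, although all of them vanish.\<close>

lemma zero_coeffs_imp_zero:
  fixes f :: "'n::finite rvec \<Rightarrow> complex"
  assumes f: "zero_coeffs f"
  shows "f z = 0"
proof (rule ccontr)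
  assume nz: "f z \<noteq> 0"
  define c :: "'n rvec" where "c = (\<chi> i. 1 / 2)"
  define g where "g = (\<lambda>y. (1 / f z) * f (y + (z - c)))"
  have g: "zero_coeffs g" unfolding g_def by (intro zero_coeffs_cmult zero_coeffs_shift f)
  have gc: "g c = 1" using nz by (simp add: g_def)
  have contg: "continuous_on UNIV g" using g by (simp add: zero_coeffs_def)
  \<comment> \<open>With the minus sign the only maximum on the cube is its centre. The peak then
    lies in the interior and no identification of faces is needed.\<close>
  define h :: "'n rvec \<Rightarrow> real" where "h = (\<lambda>y. \<Sum>i\<in>UNIV. - cos (2 * pi * (y $ i)))"
  have conth: "continuous_on S h" for S unfolding h_def by (intro continuous_intros)
  let ?p = "real CARD('n)"
  have hc: "h c = ?p" by (simp add: h_def c_def)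
  have hge: "h y \<ge> - ?p" for y
  proof -
    have "(\<Sum>i\<in>UNIV. - cos (2 * pi * (y $ i))) \<ge> (\<Sum>i\<in>(UNIV::'n set). - 1)"
      by (intro sum_mono) simp
    then show ?thesis by (simp add: h_def)
  qed
  have hlt: "h y < ?p" if y: "y \<in> cbox 0 1" "y \<noteq> c" for y
  proof -
    obtain i where i: "y $ i \<noteq> 1 / 2" using y(2) by (auto simp: c_def vec_eq_iff)
    have yi: "0 \<le> y $ i" "y $ i \<le> 1" using y(1) by (auto simp: mem_box_cart)
    have "- cos (2 * pi * (y $ i)) \<noteq> 1"
    proof
      assume "- cos (2 * pi * (y $ i)) = 1"
      then have "cos (2 * pi * (y $ i) - pi) = 1" by (simp add: cos_diff)
      then obtain n :: int where "2 * pi * (y $ i) - pi = of_int n * 2 * pi"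
        using cos_one_2pi_int by blast
      then have "pi * (2 * (y $ i) - 1) = pi * (2 * of_int n)" by (simp add: algebra_simps)
      then have e: "2 * (y $ i) - 1 = 2 * of_int n" using pi_neq_zero mult_left_cancel by blast
      then have "\<bar>2 * of_int n\<bar> \<le> (1::real)" using yi by linarith
      then have "n = 0" by linarith
      then show False using e i by simp
    qed
    then have "- cos (2 * pi * (y $ i)) < 1" using cos_ge_minus_one[of "2 * pi * (y $ i)"] by linarith
    then have "(\<Sum>i\<in>UNIV. - cos (2 * pi * (y $ i))) < (\<Sum>i\<in>(UNIV::'n set). 1)"
      by (intro sum_strict_mono_ex1) (auto simp: minus_le_iff)
    then show ?thesis by (simp add: h_def)
  qed
  obtain \<delta> where \<delta>: "\<delta> > 0" "\<And>y. dist y c < \<delta> \<Longrightarrow> dist (g y) (g c) < 1 / 2"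
    using contg unfolding continuous_on_iff by (metis UNIV_I half_gt_zero zero_less_one)
  have near: "Re (g y) > 1 / 2" if "dist y c < \<delta>" for y
    using \<delta>(2)[OF that] abs_Re_le_cmod[of "g y - 1"] unfolding gc dist_norm by auto
  let ?K = "cbox 0 1 - ball c \<delta>"
  have "compact ?K" by (simp add: compact_diff)
  then obtain \<eta> where \<eta>: "\<eta> > 0" "\<And>y. y \<in> ?K \<Longrightarrow> h y \<le> ?p - \<eta>"
  proof (cases "?K = {}")
    case False
    obtain x where x: "x \<in> ?K" "\<And>y. y \<in> ?K \<Longrightarrow> h y \<le> h x"
      using continuous_attains_sup[OF \<open>compact ?K\<close> False conth] by blast
    then have "x \<noteq> c" using \<delta>(1) by auto
    then have "h x < ?p" using hlt x(1) by blast
    then show ?thesis using that[of "?p - h x"] x by auto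
  next
    case True
    show ?thesis using that[of 1] unfolding True by simp
  qed
  \<comment> \<open>As \<open>h\<close> ranges between -p and p, \<open>T\<close> is nonnegative. It
    is at most 1 where \<open>h\<close> is at most p - \<eta>, and at the centre it equals 1 +
    \<eta> / (2 p); the constant \<open>q\<close> keeps half of this excess.\<close>
  define T where "T = (\<lambda>y. 1 + (h y - ?p + \<eta>) / (2 * ?p))"
  have p0: "?p > 0" by simp
  have T0: "T y \<ge> 0" for y using hge[of y] \<eta>(1) p0 by (simp add: T_def field_simps)
  have T1: "T y \<le> 1" if "y \<in> ?K" for y using \<eta>(2)[OF that] p0 by (simp add: T_def field_simps)
  define q where "q = 1 + \<eta> / (4 * ?p)"
  have q: "q > 1" using \<eta>(1) p0 by (simp add: q_def)
  define A where "A = ball c \<delta> \<inter> {y. h y > ?p - \<eta> / 2}"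
  have "open A" unfolding A_def by (intro open_Int open_ball open_Collect_less continuous_intros conth)
  moreover have "c \<in> A" using \<delta>(1) \<eta>(1) hc by (simp add: A_def)
  moreover have "c \<in> box 0 1" by (simp add: c_def mem_box_cart)
  ultimately have "open (A \<inter> box 0 1)" "c \<in> A \<inter> box 0 1" by (auto intro: open_Int open_box)
  then obtain a b where ab: "cbox a b \<subseteq> A \<inter> box 0 1" "c \<in> box a b"
    using open_contains_cbox by (metis (no_types, lifting) )
  define V where "V = Sigma_Algebra.measure lborel (cbox a b)"
  have V: "V > 0"
    using ab(2) unfolding V_def content_pos_lt_eq by (auto simp: mem_box)
  have sub: "cbox a b \<subseteq> cbox 0 1" using ab(1) box_subset_cbox by blast
  have Tq: "T y \<ge> q" "dist y c < \<delta>" if "y \<in> cbox a b" for y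
  proof -
    have "y \<in> A" using that ab(1) by blast
    then have hy: "h y > ?p - \<eta> / 2" and d: "dist y c < \<delta>" by (auto simp: A_def dist_commute)
    have "(h y - ?p + \<eta>) / (2 * ?p) \<ge> (\<eta> / 2) / (2 * ?p)" using hy p0 by (intro divide_right_mono) auto
    then show "T y \<ge> q" by (simp add: T_def q_def)
    show "dist y c < \<delta>" by (rule d)
  qed
  have "compact (g ` cbox 0 1)"
    by (intro compact_continuous_image continuous_on_subset[OF contg]) auto
  then obtain G where G: "\<And>y. y \<in> cbox 0 1 \<Longrightarrow> norm (g y) \<le> G"
    using compact_imp_bounded bounded_iff by (metis image_eqI)
  have G0: "G \<ge> 0" by (rule order_trans[OF norm_ge_zero G[of 0]]) (simp add: mem_box_cart)
  \<comment> \<open>The real part of the integrand is bounded below by q^N / 2 on the small box, by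
    0 on the rest of the ball, where Re g > 1/2, and by -G elsewhere. The integral itself is
    0.\<close>
  have bound: "q ^ N / 2 * V - G \<le> 0" for N
  proof -
    have TN: "zero_coeffs (\<lambda>y. of_real (T y ^ N) * g y)"
    proof (induction N)
      case (Suc N)
      let ?g = "\<lambda>y. of_real (T y ^ N) * g y"
      have "of_real (T y ^ Suc N) * g y = of_real (1 + (\<eta> - ?p) / (2 * ?p)) * ?g y
         + (\<Sum>i\<in>UNIV. of_real (- 1 / (2 * ?p)) * (of_real (cos (2 * pi * (y $ i))) * ?g y))" for y
      proof -
        have "T y = (1 + (\<eta> - ?p) / (2 * ?p)) + (\<Sum>i\<in>UNIV. - 1 / (2 * ?p) * cos (2 * pi * (y $ i)))"
          unfolding T_def h_def sum_distrib_left[symmetric] using p0 by (simp add: sum_negf field_simps)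
        then have "complex_of_real (T y) = of_real (1 + (\<eta> - ?p) / (2 * ?p))
          + (\<Sum>i\<in>UNIV. of_real (- 1 / (2 * ?p)) * of_real (cos (2 * pi * (y $ i))))"
          by (simp only: of_real_add of_real_sum of_real_mult)
        moreover have "of_real (T y ^ Suc N) * g y = of_real (T y) * ?g y" by simp
        ultimately show ?thesis by (simp only: distrib_right sum_distrib_right mult.assoc)
      qed
      moreover have "zero_coeffs (\<lambda>y. of_real (1 + (\<eta> - ?p) / (2 * ?p)) * ?g y
         + (\<Sum>i\<in>UNIV. of_real (- 1 / (2 * ?p)) * (of_real (cos (2 * pi * (y $ i))) * ?g y)))"
        by (intro zero_coeffs_add zero_coeffs_cmult zero_coeffs_sum zero_coeffs_cos Suc) auto
      ultimately show ?case by (simp only:)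
    qed (use g in simp)
    then have "\<forall>u. (\<forall>i. u $ i \<in> \<int>) \<longrightarrow> integral (cbox 0 1) (\<lambda>y. cis (2 * pi * (u \<bullet> y)) * (of_real (T y ^ N) * g y)) = 0"
      by (simp add: zero_coeffs_def)
    from this[rule_format, of 0] have int0: "integral (cbox 0 1) (\<lambda>y. of_real (T y ^ N) * g y) = 0" by simp
    have "continuous_on UNIV (\<lambda>y. of_real (T y ^ N) * g y)" using TN by (simp add: zero_coeffs_def)
    then have "((\<lambda>y. of_real (T y ^ N) * g y) has_integral 0) (cbox 0 1)"
      using integrable_cont int0 by (metis integrable_integral)
    from has_integral_linear[OF this bounded_linear_Re]
    have I1: "((\<lambda>y. T y ^ N * Re (g y)) has_integral 0) (cbox 0 1)" by (simp add: o_def)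
    have "((\<lambda>y. 1 :: real) has_integral V) (cbox a b)" using has_integral_const[of "1::real" a b] by (simp add: V_def)
    then have "((\<lambda>y. if y \<in> cbox a b then (\<lambda>_. 1 :: real) y else 0) has_integral V) (cbox 0 1)"
      by (simp only: has_integral_restrict[OF sub])
    from has_integral_diff[OF has_integral_mult_right[OF this, of "q ^ N / 2"] has_integral_const[of G 0 "1 :: 'n rvec"]]
    have I2: "((\<lambda>y. q ^ N / 2 * (if y \<in> cbox a b then 1 else 0) - G) has_integral (q ^ N / 2 * V - Sigma_Algebra.measure lborel (cbox 0 (1 :: 'n rvec)) * G)) (cbox 0 1)"
      by simp
    have "Sigma_Algebra.measure lborel (cbox 0 (1 :: 'n rvec)) = 1"
    proof -
      have "(0 :: 'n rvec) \<in> cbox 0 1" by (simp add: mem_box_cart)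
      then have "cbox 0 (1 :: 'n rvec) \<noteq> {}" by blast
      then show ?thesis by (simp add: content_cbox_cart)
    qed
    moreover have "q ^ N / 2 * V - Sigma_Algebra.measure lborel (cbox 0 (1 :: 'n rvec)) * G \<le> 0"
    proof (rule has_integral_le[OF I2 I1])
      fix y :: "'n rvec" assume y: "y \<in> cbox 0 1"
      show "q ^ N / 2 * (if y \<in> cbox a b then 1 else 0) - G \<le> T y ^ N * Re (g y)"
      proof (cases "y \<in> cbox a b")
        case True
        have "q ^ N * (1 / 2) \<le> T y ^ N * Re (g y)"
          using Tq[OF True] near[of y] q T0[of y] by (intro mult_mono power_mono) auto
        then show ?thesis using True G0 by simp
      next
        case False
        have "- G \<le> T y ^ N * Re (g y)"
        proof (cases "dist y c < \<delta>")
          case True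
          have "0 \<le> T y ^ N * Re (g y)" using near[OF True] T0[of y] by simp
          then show ?thesis using G0 by linarith
        next
          case far: False
          then have "T y ^ N \<le> 1" using T1[of y] T0[of y] y by (intro power_le_one) (auto simp: dist_commute)
          then have "\<bar>T y ^ N * Re (g y)\<bar> \<le> 1 * G"
            unfolding abs_mult using abs_Re_le_cmod[of "g y"] G[OF y] T0[of y] by (intro mult_mono) auto
          then show ?thesis by linarith
        qed
        then show ?thesis using False by simp
      qed
    qed
    ultimately show ?thesis by simp
  qed
  obtain N where "2 * G / V < q ^ N" using real_arch_pow[OF q] by blast
  then show False using bound[of N] V by (simp add: field_simps)
qed

section \<open>Spaces of vector-valued functions\<close>

definition unit_fun :: "'a \<Rightarrow> 'k \<Rightarrow> 'a \<Rightarrow> complex ^ 'k::finite" where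
  "unit_fun u a = (\<lambda>x. if x = u then axis a 1 else 0)"

lemma sum_apply_fun: "(\<Sum>i\<in>A. f i) x = (\<Sum>i\<in>A. f i x)"
  for f :: "'i \<Rightarrow> 'a \<Rightarrow> 'b::comm_monoid_add"
  by (induction A rule: infinite_finite_induct) auto

lemma fun_eq_sum_unit_fun:
  assumes "finite U" "\<And>x. x \<notin> U \<Longrightarrow> F x = 0"
  shows "F = (\<Sum>(u, a)\<in>U \<times> UNIV. (\<lambda>x. (F u $ a) *s unit_fun u a x))"
proof (rule ext, rule vec_eq_iff[THEN iffD2], rule allI)
  fix x b
  have "(\<Sum>(u, a)\<in>U \<times> UNIV. (\<lambda>x. (F u $ a) *s unit_fun u a x)) x $ b
     = (\<Sum>u\<in>U. \<Sum>a\<in>UNIV. F u $ a * unit_fun u a x $ b)"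
    by (simp add: sum.cartesian_product sum_apply_fun split_def)
  also have "\<dots> = (\<Sum>u\<in>U. \<Sum>a\<in>UNIV. if a = b then (if x = u then F u $ a else 0) else 0)"
    by (intro sum.cong refl) (auto simp: unit_fun_def axis_def)
  also have "\<dots> = (if x \<in> U then F x $ b else 0)" using assms(1) by simp
  finally show "F x $ b = (\<Sum>(u, a)\<in>U \<times> UNIV. (\<lambda>x. (F u $ a) *s unit_fun u a x)) x $ b"
    using assms(2) by auto
qed

lemma finite_dim_supported:
  fixes V :: "('a \<Rightarrow> complex ^ 'k::finite) set"
  assumes "finite U" and V: "\<And>F x. F \<in> V \<Longrightarrow> x \<notin> U \<Longrightarrow> F x = 0"
  shows "V \<subseteq> fun_cvs.span ((\<lambda>(u, a). unit_fun u a) ` (U \<times> UNIV))"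
proof
  fix F assume "F \<in> V"
  then have "F = (\<Sum>(u, a)\<in>U \<times> UNIV. (\<lambda>x. (F u $ a) *s unit_fun u a x))"
    using assms by (intro fun_eq_sum_unit_fun) auto
  moreover have "(\<Sum>(u, a)\<in>U \<times> UNIV. (\<lambda>x. (F u $ a) *s unit_fun u a x))
      \<in> fun_cvs.span ((\<lambda>(u, a). unit_fun u a) ` (U \<times> UNIV))"
  proof (intro fun_cvs.span_sum, clarify)
    fix u :: 'a and a :: 'k assume "u \<in> U"
    then have "unit_fun u a \<in> fun_cvs.span ((\<lambda>(u, a). unit_fun u a) ` (U \<times> UNIV))"
      by (intro fun_cvs.span_base) force
    then show "(\<lambda>x. (F u $ a) *s unit_fun u a x) \<in> fun_cvs.span ((\<lambda>(u, a). unit_fun u a) ` (U \<times> UNIV))"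
      by (rule fun_cvs.span_scale)
  qed
  ultimately show "F \<in> fun_cvs.span ((\<lambda>(u, a). unit_fun u a) ` (U \<times> UNIV))" by simp
qed

lemma dim_supported_le:
  fixes V :: "('a \<Rightarrow> complex ^ 'k::finite) set"
  assumes "finite U" and "\<And>F x. F \<in> V \<Longrightarrow> x \<notin> U \<Longrightarrow> F x = 0"
  shows "fun_cdim V \<le> card U * CARD('k)"
proof -
  have "fun_cdim V \<le> card ((\<lambda>(u, a). unit_fun u a :: 'a \<Rightarrow> complex ^ 'k) ` (U \<times> UNIV))"
    using finite_dim_supported[of U V] assms by (intro fun_cvs.dim_le_card) auto
  also have "\<dots> \<le> card (U \<times> (UNIV :: 'k set))" using assms(1) by (intro card_image_le) auto
  finally show ?thesis by (simp add: card_cartesian_product)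
qed

text \<open>Used to move dimensions from eigenspaces of smooth functions to families of Fourier
  coefficients with finite support.\<close>

lemma dim_injective_image:
  fixes f :: "('a \<Rightarrow> complex ^ 'k::finite) \<Rightarrow> ('b \<Rightarrow> complex ^ 'l::finite)"
  assumes add: "\<And>F G. f (F + G) = f F + f G"
    and scale: "\<And>c F. f (\<lambda>x. c *s F x) = (\<lambda>x. c *s f F x)"
    and V: "fun_cvs.subspace V" and inj: "\<And>F. F \<in> V \<Longrightarrow> f F = 0 \<Longrightarrow> F = 0"
  shows "fun_cdim (f ` V) = fun_cdim V"
proof -
  interpret L: Vector_Spaces.linear "\<lambda>(c::complex) (\<psi> :: 'a \<Rightarrow> complex ^ 'k) x. c *s \<psi> x"
      "\<lambda>(c::complex) (\<psi> :: 'b \<Rightarrow> complex ^ 'l) x. c *s \<psi> x" f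
    by unfold_locales (use add scale in auto)
  obtain B where B: "B \<subseteq> V" "fun_cvs.independent B" "V \<subseteq> fun_cvs.span B" "card B = fun_cdim V"
    using fun_cvs.basis_exists by blast
  have span: "fun_cvs.span B = V" using B V by (metis fun_cvs.span_minimal subset_antisym)
  have inj': "inj_on f (fun_cvs.span B)"
  proof (rule inj_onI)
    fix x y assume "x \<in> fun_cvs.span B" "y \<in> fun_cvs.span B" "f x = f y"
    then have "x - y \<in> V" "f (x - y) = 0"
      using fun_cvs.subspace_diff[OF V] L.diff[of x y] unfolding span by auto
    then show "x = y" using inj by fastforce
  qed
  have "fun_cvs.independent (f ` B)"
    using L.independent_inj_on_image[OF B(2) inj'] by simp
  moreover have "fun_cvs.span (f ` B) = f ` V" using L.span_image[of B] span by simp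
  ultimately have "fun_cdim (f ` V) = card (f ` B)"
    by (metis fun_cvs.dim_eq_card_independent fun_cvs.dim_span)
  also have "\<dots> = card B" by (intro card_image inj_on_subset[OF inj' fun_cvs.span_superset])
  finally show ?thesis using B by simp
qed

text \<open>In terms of a basis \<open>b\<^sub>i\<close> of the range, \<open>P F = (\<Sum>i. \<phi>\<^sub>i(F) b\<^sub>i)\<close> with \<open>\<phi>\<^sub>i(b\<^sub>j) = \<delta>\<^sub>i\<^sub>j\<close>, and then the trace
  of \<open>P\<close> is \<open>\<Sum>i. \<phi>\<^sub>i(b\<^sub>i)\<close>.\<close>

lemma dim_range_projection:
  fixes P :: "('a \<Rightarrow> complex ^ 'k::finite) \<Rightarrow> ('a \<Rightarrow> complex ^ 'k)"
  assumes U: "finite U"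
    and add: "\<And>F G. P (F + G) = P F + P G"
    and scale: "\<And>c F. P (\<lambda>x. c *s F x) = (\<lambda>x. c *s P F x)"
    and V: "fun_cvs.subspace V" and supp: "\<And>F x. F \<in> V \<Longrightarrow> x \<notin> U \<Longrightarrow> F x = 0"
    and into: "\<And>u a. u \<in> U \<Longrightarrow> P (unit_fun u a) \<in> V" and fix_P: "\<And>F. F \<in> V \<Longrightarrow> P F = F"
  shows "of_nat (fun_cdim V) = (\<Sum>u\<in>U. \<Sum>a\<in>UNIV. P (unit_fun u a) u $ a)"
proof -
  interpret L: Vector_Spaces.linear "\<lambda>(c::complex) (\<psi> :: 'a \<Rightarrow> complex ^ 'k) x. c *s \<psi> x"
      "\<lambda>(c::complex) (\<psi> :: 'a \<Rightarrow> complex ^ 'k) x. c *s \<psi> x" P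
    by unfold_locales (use add scale in auto)
  obtain B where B: "B \<subseteq> V" "fun_cvs.independent B" "V \<subseteq> fun_cvs.span B" "card B = fun_cdim V"
    using fun_cvs.basis_exists by blast
  have span: "fun_cvs.span B = V" using B V by (metis fun_cvs.span_minimal subset_antisym)
  have finB: "finite B"
  proof -
    have "finite ((\<lambda>(u, a). unit_fun u a :: 'a \<Rightarrow> complex ^ 'k) ` (U \<times> UNIV))" using U by simp
    moreover have "B \<subseteq> fun_cvs.span ((\<lambda>(u, a). unit_fun u a) ` (U \<times> UNIV))"
      using finite_dim_supported[of U V] U supp B(1) by blast
    ultimately show ?thesis using fun_cvs.independent_span_bound[OF _ B(2)] by blast
  qed
  let ?\<phi> = "\<lambda>F. fun_cvs.representation B F"
  have rep: "(\<Sum>b\<in>B. (\<lambda>x. ?\<phi> F b *s b x)) = F" if "F \<in> V" for F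
    using fun_cvs.sum_representation_eq[OF B(2) _ finB subset_refl, of F] that span by blast
  have dual: "?\<phi> b b = 1" if "b \<in> B" for b
    using fun_cvs.representation_basis[OF B(2) that] by simp
  \<comment> \<open>This is the coordinate along \<open>b\<close> of P b = b, with \<open>b\<close>
    expanded in unit functions before applying \<open>P\<close>. Summing over the basis and
    exchanging the sums produces the trace.\<close>
  have lin: "(\<Sum>(u, a)\<in>U \<times> UNIV. b u $ a * ?\<phi> (P (unit_fun u a)) b) = 1" if b: "b \<in> B" for b
  proof -
    have "P b = b" using b B fix_P by blast
    have bV: "b \<in> V" using b B by blast
    have "b = P (\<Sum>(u, a)\<in>U \<times> UNIV. (\<lambda>x. (b u $ a) *s unit_fun u a x))"
      using fun_eq_sum_unit_fun[OF U, of b] supp[OF bV] fix_P[OF bV] by simp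
    also have "\<dots> = (\<Sum>(u, a)\<in>U \<times> UNIV. (\<lambda>x. (b u $ a) *s P (unit_fun u a) x))"
      by (simp add: L.sum split_def L.scale)
    finally have "b = (\<Sum>(u, a)\<in>U \<times> UNIV. (\<lambda>x. (b u $ a) *s P (unit_fun u a) x))" .
    then have "?\<phi> b b = ?\<phi> (\<Sum>(u, a)\<in>U \<times> UNIV. (\<lambda>x. (b u $ a) *s P (unit_fun u a) x)) b" by metis
    also have "\<dots> = (\<Sum>(u, a)\<in>U \<times> UNIV. ?\<phi> (\<lambda>x. (b u $ a) *s P (unit_fun u a) x) b)"
      using into span by (subst fun_cvs.representation_sum[OF B(2)])
        (auto simp: split_def intro!: fun_cvs.span_scale)
    also have "\<dots> = (\<Sum>(u, a)\<in>U \<times> UNIV. b u $ a * ?\<phi> (P (unit_fun u a)) b)"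
      using into span by (intro sum.cong refl) (auto simp: split_def fun_cvs.representation_scale[OF B(2)])
    finally show ?thesis using dual[OF b] by simp
  qed
  have "(\<Sum>u\<in>U. \<Sum>a\<in>UNIV. P (unit_fun u a) u $ a) = (\<Sum>(u, a)\<in>U \<times> UNIV. \<Sum>b\<in>B. b u $ a * ?\<phi> (P (unit_fun u a)) b)"
    unfolding sum.cartesian_product
  proof (rule sum.cong[OF refl], safe)
    fix u :: 'a and a :: 'k assume u: "u \<in> U"
    have "P (unit_fun u a) u $ a = (\<Sum>b\<in>B. (\<lambda>x. ?\<phi> (P (unit_fun u a)) b *s b x)) u $ a"
      using rep[OF into[OF u]] by simp
    also have "\<dots> = (\<Sum>b\<in>B. b u $ a * ?\<phi> (P (unit_fun u a)) b)"
      by (simp add: sum_apply_fun mult.commute)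
    finally show "P (unit_fun u a) u $ a = (\<Sum>b\<in>B. b u $ a * ?\<phi> (P (unit_fun u a)) b)" .
  qed
  also have "\<dots> = (\<Sum>b\<in>B. (\<Sum>(u, a)\<in>U \<times> UNIV. b u $ a * ?\<phi> (P (unit_fun u a)) b))"
    by (simp add: split_def sum.swap[of _ B])
  also have "\<dots> = of_nat (card B)" using lin by simp
  finally show ?thesis using B by simp
qed

section \<open>Traces in the spinor representation\<close>

lemma cl_vec_add: "cl_vec (v + w) = cl_vec v + cl_vec w"
proof (rule clifford_eqI)
  fix K
  have "(if P then (v + w) $ i else 0) = (if P then v $ i else 0) + (if P then w $ i else 0)" for i P
    by simp
  then show "cl_coeff (cl_vec (v + w)) K = cl_coeff (cl_vec v + cl_vec w) K"
    by (simp add: cl_vec_def plus_clifford_def sum.distrib)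
qed

lemma cl_vec_scale: "cl_vec (c *\<^sub>R v) = c *\<^sub>R cl_vec v"
proof (rule clifford_eqI)
  fix K
  have "(if P then (c *\<^sub>R v) $ i else 0) = c * (if P then v $ i else 0)" for i P
    by simp
  then show "cl_coeff (cl_vec (c *\<^sub>R v)) K = cl_coeff (c *\<^sub>R cl_vec v) K"
    by (simp add: cl_vec_def scaleR_clifford_def sum_distrib_left)
qed

lemma cl_vec_square: "cl_vec v * cl_vec v = - (v \<bullet> v) *\<^sub>R 1"
proof -
  have "2 *\<^sub>R (cl_vec v * cl_vec v) = 2 *\<^sub>R (- (v \<bullet> v) *\<^sub>R (1 :: 'a clifford))"
    using cl_relation[of v v] by (simp add: scaleR_2[of "cl_vec v * cl_vec v"])
  then show ?thesis by (simp only: scaleR_cancel_left) simp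
qed

lemma cl_vec_anticommute: "v \<bullet> w = 0 \<Longrightarrow> cl_vec v * cl_vec w = - (cl_vec w * cl_vec v)"
  using cl_relation[of v w] by (simp add: add_eq_0_iff)

lemma ebasis_inner:
  assumes "i \<in> {1..CARD('n)}" "j \<in> {1..CARD('n)}"
  shows "(ebasis i :: 'n::{finite,linorder} rvec) \<bullet> ebasis j = (if i = j then 1 else 0)"
proof -
  have "distinct (sorted_list_of_set (UNIV :: 'n set))" "length (sorted_list_of_set (UNIV :: 'n set)) = CARD('n)"
    by auto
  then have "sorted_list_of_set (UNIV :: 'n set) ! (i - 1) = sorted_list_of_set UNIV ! (j - 1) \<longleftrightarrow> i - 1 = j - 1"
    using assms by (intro nth_eq_iff_index_eq) auto
  then show ?thesis using assms by (auto simp: ebasis_def inner_axis_axis)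
qed

section \<open>Coordinate planes and the maximal torus of the spin group\<close>

abbreviation ecl :: "nat \<Rightarrow> 'n::{finite,linorder} clifford" where
  "ecl i \<equiv> cl_vec (ebasis i)"

lemma ecl_square:
  assumes "i \<in> {1..CARD('n)}" shows "ecl i * ecl i = (- 1 :: 'n::{finite,linorder} clifford)"
  using cl_vec_square[of "ebasis i :: 'n rvec"] ebasis_inner[OF assms assms] by simp

lemma ecl_anticommute:
  assumes "i \<in> {1..CARD('n)}" "j \<in> {1..CARD('n)}" "i \<noteq> j"
  shows "ecl i * ecl j = - (ecl j * ecl i :: 'n::{finite,linorder} clifford)"
  using ebasis_inner[OF assms(1,2)] assms(3) by (intro cl_vec_anticommute) simp

definition eplane :: "nat \<Rightarrow> 'n::{finite,linorder} clifford" where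
  "eplane j = ecl (2 * j - 1) * ecl (2 * j)"

text \<open>This is the exponential of \<open>t j\<close> times \<open>eplane j\<close>, because
  \<open>eplane j\<close> squares to -1. The products \<open>erots\<close> run through a maximal
  torus.\<close>

definition erot :: "(nat \<Rightarrow> real) \<Rightarrow> nat \<Rightarrow> 'n::{finite,linorder} clifford" where
  "erot t j = of_real (cos (t j)) + sin (t j) *\<^sub>R eplane j"

definition eplanes :: "nat \<Rightarrow> 'n::{finite,linorder} clifford" where
  "eplanes k = prod_list (map eplane [1..<k + 1])"

definition erots :: "(nat \<Rightarrow> real) \<Rightarrow> nat \<Rightarrow> 'n::{finite,linorder} clifford" where
  "erots t k = prod_list (map (erot t) [1..<k + 1])"

lemma eplanes_Suc: "eplanes (Suc k) = eplanes k * eplane (Suc k)" and eplanes_0: "eplanes 0 = 1"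
  and erots_Suc: "erots t (Suc k) = erots t k * erot t (Suc k)" and erots_0: "erots t 0 = 1"
  by (simp_all add: eplanes_def erots_def)

lemma spin_x_erots: "spin_x t = (erots t (rot_dim TYPE('n)) :: 'n::{finite,linorder} clifford)"
  unfolding spin_x_def erots_def erot_def eplane_def ..

lemma prod_ecl_eplanes: "prod_list (map ecl [1..<2 * k + 1]) = eplanes k"
proof (induction k)
  case (Suc k)
  have "[1..<2 * Suc k + 1] = [1..<2 * k + 1] @ [2 * k + 1, 2 * k + 2]"
    by (simp add: upt_rec[of "Suc (2 * k)"])
  then show ?case using Suc by (simp add: eplanes_Suc eplane_def mult.assoc)
qed (simp add: eplanes_0)

lemma eplane_commute_ecl:
  assumes "2 * j \<le> CARD('n)" "1 \<le> j" "i \<in> {1..CARD('n)}" "i \<noteq> 2 * j - 1" "i \<noteq> 2 * j"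
  shows "ecl i * eplane j = (eplane j * ecl i :: 'n::{finite,linorder} clifford)"
proof -
  have 1: "ecl i * ecl (2 * j - 1) = - (ecl (2 * j - 1) * ecl i :: 'n clifford)"
    using assms by (intro ecl_anticommute) auto
  have 2: "ecl i * ecl (2 * j) = - (ecl (2 * j) * ecl i :: 'n clifford)"
    using assms by (intro ecl_anticommute) auto
  have "ecl i * eplane j = (ecl i * ecl (2 * j - 1)) * (ecl (2 * j) :: 'n clifford)"
    by (simp add: eplane_def mult.assoc)
  also have "\<dots> = - ecl (2 * j - 1) * (ecl i * ecl (2 * j)) "
    unfolding 1 by (simp add: mult.assoc)
  also have "\<dots> = eplane j * ecl i" unfolding 2 eplane_def by (simp add: mult.assoc)
  finally show ?thesis .
qed

lemma eplane_anticommute_ecl: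
  assumes "2 * j \<le> CARD('n)" "1 \<le> j"
  shows "ecl (2 * j) * eplane j = - (eplane j * ecl (2 * j) :: 'n::{finite,linorder} clifford)"
proof -
  have 1: "ecl (2 * j) * ecl (2 * j - 1) = - (ecl (2 * j - 1) * ecl (2 * j) :: 'n clifford)"
    using assms by (intro ecl_anticommute) auto
  show ?thesis unfolding eplane_def by (simp only: mult.assoc[symmetric] 1) simp
qed

lemma eplane_commute:
  assumes "2 * i \<le> CARD('n)" "1 \<le> i" "2 * j \<le> CARD('n)" "1 \<le> j"
  shows "eplane i * eplane j = (eplane j * eplane i :: 'n::{finite,linorder} clifford)"
proof (cases "i = j")
  case False
  have 1: "ecl (2 * i) * eplane j = (eplane j * ecl (2 * i) :: 'n clifford)"
    using assms False by (intro eplane_commute_ecl) auto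
  have 2: "ecl (2 * i - 1) * eplane j = (eplane j * ecl (2 * i - 1) :: 'n clifford)"
  proof (intro eplane_commute_ecl)
    show "2 * i - 1 \<noteq> 2 * j" using assms by presburger
  qed (use assms False in auto)
  have "eplane i * eplane j = ecl (2 * i - 1) * eplane j * (ecl (2 * i) :: 'n clifford)"
    unfolding eplane_def[of i] by (simp add: mult.assoc 1)
  then show ?thesis unfolding 2 by (simp add: eplane_def[of i] mult.assoc)
qed simp

lemma eplane_square:
  assumes "2 * j \<le> CARD('n)" "1 \<le> j"
  shows "eplane j * eplane j = (- 1 :: 'n::{finite,linorder} clifford)"
proof -
  have "eplane j * eplane j = ecl (2 * j - 1) * (ecl (2 * j) * eplane j :: 'n clifford)"
    by (simp add: eplane_def mult.assoc)
  also have "\<dots> = - (ecl (2 * j - 1) * ecl (2 * j - 1) * (ecl (2 * j) * ecl (2 * j)))"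
    unfolding eplane_anticommute_ecl[OF assms] by (simp add: eplane_def mult.assoc)
  also have "\<dots> = - 1"
  proof -
    have "2 * j - 1 \<in> {1..CARD('n)}" "2 * j \<in> {1..CARD('n)}" using assms by (simp_all, linarith)
    then show ?thesis by (simp only: ecl_square) simp
  qed
  finally show ?thesis .
qed

lemma erot_commute:
  assumes "2 * i \<le> CARD('n)" "1 \<le> i" "2 * j \<le> CARD('n)" "1 \<le> j"
  shows "erot s i * erot t j = (erot t j * erot s i :: 'n::{finite,linorder} clifford)"
  using eplane_commute[OF assms] unfolding erot_def of_real_def
  by (simp add: distrib_left distrib_right scaleR_right_distrib add_ac mult.commute)

lemma erot_add:
  assumes "2 * j \<le> CARD('n)" "1 \<le> j"
  shows "erot s j * erot t j = (erot (\<lambda>i. s i + t i) j :: 'n::{finite,linorder} clifford)"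
  unfolding erot_def of_real_def
  by (simp add: distrib_left distrib_right eplane_square[OF assms] cos_add sin_add
      scaleR_left_distrib scaleR_left_diff_distrib scaleR_right_distrib
      scaleR_right_diff_distrib mult.commute)

lemma erots_erot_commute:
  assumes "2 * k \<le> CARD('n)" "2 * j \<le> CARD('n)" "1 \<le> j"
  shows "erots t k * erot s j = (erot s j * erots t k :: 'n::{finite,linorder} clifford)"
  using assms(1)
proof (induction k)
  case (Suc k)
  have "erots t (Suc k) * erot s j = erots t k * (erot t (Suc k) * erot s j :: 'n clifford)"
    by (simp add: erots_Suc mult.assoc)
  also have "\<dots> = (erots t k * erot s j) * erot t (Suc k)"
    using Suc.prems assms(2,3) by (subst erot_commute) (auto simp: mult.assoc)
  also have "erots t k * erot s j = (erot s j * erots t k :: 'n clifford)" using Suc by simp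
  finally show ?case by (simp add: erots_Suc mult.assoc)
qed (simp add: erots_0)

lemma erots_add:
  assumes "2 * k \<le> CARD('n)"
  shows "erots s k * erots t k = (erots (\<lambda>i. s i + t i) k :: 'n::{finite,linorder} clifford)"
  using assms
proof (induction k)
  case (Suc k)
  have "erots s (Suc k) * erots t (Suc k) = erots s k * (erot s (Suc k) * erots t k) * (erot t (Suc k) :: 'n clifford)"
    by (simp add: erots_Suc mult.assoc)
  also have "erot s (Suc k) * erots t k = erots t k * (erot s (Suc k) :: 'n clifford)"
    using Suc.prems by (intro erots_erot_commute[symmetric]) auto
  also have "erots s k * (erots t k * erot s (Suc k)) * erot t (Suc k)
     = (erots s k * erots t k) * (erot s (Suc k) * erot t (Suc k) :: 'n clifford)"
    by (simp add: mult.assoc)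
  also have "\<dots> = erots (\<lambda>i. s i + t i) (Suc k)"
    using Suc by (simp add: erots_Suc erot_add)
  finally show ?case .
qed (simp add: erots_0)

lemma two_rot_dim: "2 * rot_dim TYPE('n) \<le> CARD('n::finite)"
  by (simp add: rot_dim_def)

lemma spin_x_power: "spin_x t ^ k = (spin_x (\<lambda>j. real k * t j) :: 'n::{finite,linorder} clifford)"
proof (induction k)
  case 0
  have "erots (\<lambda>j. 0) k = (1 :: 'n clifford)" for k
    by (induction k) (simp_all add: erots_0 erots_Suc erot_def)
  then show ?case by (simp add: spin_x_erots)
next
  case (Suc k)
  have "(\<lambda>j. real (Suc k) * t j) = (\<lambda>j. t j + real k * t j)" by (simp add: algebra_simps)
  then show ?case using Suc by (simp add: spin_x_erots erots_add[OF two_rot_dim])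
qed

text \<open>Each \<open>eplane j\<close> is \<open>erot\<close> at a quarter turn, so multiplying by
  their product adds \<pi>/2 to every angle.\<close>

lemma erots_eplanes: "2 * k \<le> CARD('n) \<Longrightarrow>
  erots t k * eplanes k = (prod_list (map (\<lambda>j. of_real (- sin (t j)) + cos (t j) *\<^sub>R eplane j) [1..<k + 1]) :: 'n::{finite,linorder} clifford)"
proof -
  assume k: "2 * k \<le> CARD('n)"
  have "eplane j = (erot (\<lambda>_. pi / 2) j :: 'n clifford)" for j by (simp add: erot_def)
  then have "eplane = (erot (\<lambda>_. pi / 2) :: nat \<Rightarrow> 'n clifford)" by blast
  then have "eplanes k = (erots (\<lambda>_. pi / 2) k :: 'n clifford)" by (simp add: eplanes_def erots_def)
  then have "erots t k * eplanes k = (erots (\<lambda>i. t i + pi / 2) k :: 'n clifford)"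
    by (simp add: erots_add[OF k])
  moreover have "erot (\<lambda>i. t i + pi / 2) = (\<lambda>j. of_real (- sin (t j)) + cos (t j) *\<^sub>R eplane j :: 'n clifford)"
    by (simp add: erot_def fun_eq_iff cos_add sin_add)
  ultimately show ?thesis by (simp add: erots_def)
qed

section \<open>Traces and Kronecker products of matrices\<close>

lemma trace_scaleR: "trace (c *\<^sub>R A) = of_real c * trace (A :: complex ^ 'k ^ 'k::finite)"
  by (simp add: trace_def sum_distrib_left) (simp add: scaleR_conv_of_real)

lemma matrix_mult_minus: "A ** (- B) = - (A ** B)" "(- A) ** B = - (A ** B)"
  for A B :: "complex ^ 'k ^ 'k::finite"
  by (simp_all add: vec_eq_iff matrix_matrix_mult_def sum_negf)

lemma trace_minus: "trace (- A) = - trace A" for A :: "complex ^ 'k ^ 'k::finite"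
  by (simp add: trace_def sum_negf)

text \<open>Conjugation by the invertible matrix \<open>E\<close> turns \<open>A\<close> into
  -\<open>A\<close> and preserves the trace.\<close>

lemma trace_conj_neg:
  fixes A E :: "complex ^ 'k ^ 'k::finite"
  assumes "E ** A = - (A ** E)" "E ** E = - mat 1"
  shows "trace A = 0"
proof -
  have "trace A = - trace (A ** (E ** E))" by (simp add: assms(2) matrix_mult_minus trace_minus)
  also have "A ** (E ** E) = (A ** E) ** E" by (simp add: matrix_mul_assoc)
  also have "trace \<dots> = trace (E ** (A ** E))" by (rule trace_mul_sym)
  also have "E ** (A ** E) = (E ** A) ** E" by (simp add: matrix_mul_assoc)
  also have "\<dots> = - (A ** (E ** E))" by (simp add: assms(1) matrix_mul_assoc matrix_mult_minus)
  finally show ?thesis by (simp add: assms(2) matrix_mult_minus trace_minus)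
qed

lemma mat_vec: "mat c *v w = c *s (w :: complex ^ 'k::finite)"
proof -
  have "(if i = j then c else 0) * x = (if i = j then c * x else 0)" for i j :: 'k and x :: complex by simp
  then show ?thesis by (simp add: vec_eq_iff matrix_vector_mult_def mat_def)
qed

lemma mat_commute: "A ** mat c = mat c ** (A :: complex ^ 'k ^ 'k::finite)"
  by (subst matrix_eq) (simp add: mat_vec vector_scalar_commute flip: matrix_vector_mul_assoc)

lemma trace_mat_mult: "trace (mat c ** A) = c * trace (A :: complex ^ 'k ^ 'k::finite)"
proof -
  have "(if i = j then c else 0) * x = (if i = j then c * x else 0)" for i j :: 'k and x :: complex by simp
  then show ?thesis by (simp add: trace_def matrix_matrix_mult_def mat_def sum_distrib_left)
qed

lemma mat_mult_mat: "mat c ** mat d = (mat (c * d) :: complex ^ 'k ^ 'k::finite)"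
  by (subst matrix_eq) (simp add: mat_vec flip: matrix_vector_mul_assoc)

lemma trace_mat_1: "trace (mat 1 :: complex ^ 'k ^ 'k::finite) = of_nat CARD('k)"
  by (simp add: trace_def mat_def)

lemma sum_UNIV_prod: "(\<Sum>x\<in>UNIV. f x) = (\<Sum>a\<in>UNIV. \<Sum>b\<in>UNIV. f (a, b))"
  for f :: "'a::finite \<times> 'b::finite \<Rightarrow> 'c::comm_monoid_add"
  by (simp add: sum.cartesian_product)

lemma tensor_mat_mult: "tensor_mat A B ** tensor_mat C D = tensor_mat (A ** C) (B ** D)"
  by (simp add: vec_eq_iff tensor_mat_def matrix_matrix_mult_def sum_UNIV_prod sum_product mult_ac)

lemma tensor_mat_1: "tensor_mat (mat 1) (mat 1) = mat 1"
  by (auto simp: vec_eq_iff tensor_mat_def mat_def)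

lemma trace_tensor_mat: "trace (tensor_mat A B) = trace A * trace B"
  by (simp add: trace_def tensor_mat_def sum_UNIV_prod sum_product)

lemma eplanes_square:
  assumes "2 * k \<le> CARD('n)"
  shows "eplanes k * eplanes k = ((- 1) ^ k :: 'n::{finite,linorder} clifford)"
proof -
  have "eplane j = (erot (\<lambda>_. pi / 2) j :: 'n clifford)" for j by (simp add: erot_def)
  then have "eplane = (erot (\<lambda>_. pi / 2) :: nat \<Rightarrow> 'n clifford)" by blast
  then have "eplanes k = (erots (\<lambda>_. pi / 2) k :: 'n clifford)" by (simp add: eplanes_def erots_def)
  then have "eplanes k * eplanes k = (erots (\<lambda>_. pi) k :: 'n clifford)"
    by (simp add: erots_add[OF assms])
  also have "\<dots> = (- 1) ^ k"
    by (induction k) (simp_all add: erots_0 erots_Suc erot_def)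
  finally show ?thesis .
qed

section \<open>The spinor representation\<close>

locale spinor_representation =
  fixes L :: "'n::{finite,linorder} clifford \<Rightarrow> complex ^ 's ^ 's::finite"
  assumes rep: "spinor_rep L"
begin

lemma L_mult: "L (a * b) = L a ** L b" and L_1: "L 1 = mat 1" and linear_L: "linear L"
  and card_S: "CARD('s) = 2 ^ rot_dim TYPE('n)"
  using rep by (auto simp: spinor_rep_def)

lemma L_minus: "L (- a) = - L a" and L_scale: "L (c *\<^sub>R a) = c *\<^sub>R L a" and L_add: "L (a + b) = L a + L b"
  using linear_L by (simp_all add: linear_neg linear_scale linear_add)

text \<open>The vector \<open>ecl (2 * j)\<close> commutes with \<open>a\<close> but anticommutes
  with \<open>eplane j\<close>, so it negates the product under conjugation.\<close>

lemma trace_L_eplane: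
  assumes j: "2 * j \<le> CARD('n)" "1 \<le> j" and A: "ecl (2 * j) * a = a * ecl (2 * j)"
  shows "trace (L (a * eplane j)) = 0"
proof (rule trace_conj_neg[where E = "L (ecl (2 * j))"])
  have "ecl (2 * j) * (a * eplane j) = a * (ecl (2 * j) * eplane j)"
    by (simp add: A flip: mult.assoc)
  also have "\<dots> = - (a * eplane j * ecl (2 * j))"
    unfolding eplane_anticommute_ecl[OF j] by (simp add: mult.assoc)
  finally show "L (ecl (2 * j)) ** L (a * eplane j) = - (L (a * eplane j) ** L (ecl (2 * j)))"
    by (simp only: L_mult[symmetric] L_minus[symmetric])
  show "L (ecl (2 * j)) ** L (ecl (2 * j)) = - mat 1"
    using j by (simp add: ecl_square L_minus L_1 flip: L_mult)
qed

text \<open>Expanding the product, every term that contains a plane is traceless. Only the scalar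
  parts survive, times the dimension of the representation.\<close>

lemma trace_L_prod_planes:
  fixes a b :: "nat \<Rightarrow> real"
  assumes "2 * k \<le> CARD('n)"
  shows "trace (L (prod_list (map (\<lambda>j. of_real (a j) + b j *\<^sub>R eplane j) [1..<k + 1])))
    = of_real (\<Prod>j=1..k. a j) * 2 ^ rot_dim TYPE('n)"
  using assms
proof (induction k)
  case 0
  show ?case by (simp add: L_1 trace_mat_1 card_S)
next
  case (Suc k)
  let ?f = "\<lambda>j. of_real (a j) + b j *\<^sub>R eplane j :: 'n clifford"
  let ?P = "\<lambda>k. prod_list (map ?f [1..<k + 1])"
  have comm: "ecl (2 * Suc k) * ?P l = ?P l * ecl (2 * Suc k)" if "l \<le> k" for l
    using that
  proof (induction l)
    case (Suc l)
    have 1: "?P (Suc l) = ?P l * ?f (Suc l)" by simp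
    have "ecl (2 * Suc k) * eplane (Suc l) = (eplane (Suc l) * ecl (2 * Suc k) :: 'n clifford)"
      using Suc.prems \<open>2 * Suc k \<le> CARD('n)\<close> by (intro eplane_commute_ecl) auto
    then have "ecl (2 * Suc k) * ?f (Suc l) = ?f (Suc l) * ecl (2 * Suc k)"
      by (simp only: of_real_def distrib_left distrib_right mult_scaleR_left mult_scaleR_right mult_1_left mult_1_right)
    then show ?case unfolding 1 using Suc by (simp only: mult.assoc[symmetric]) (simp only: mult.assoc Suc_leD)
  qed simp
  have "?P (Suc k) = a (Suc k) *\<^sub>R ?P k + b (Suc k) *\<^sub>R (?P k * eplane (Suc k))"
    by (simp add: of_real_def distrib_left)
  then have "trace (L (?P (Suc k))) = of_real (a (Suc k)) * trace (L (?P k))"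
    using trace_L_eplane[of "Suc k" "?P k"] Suc.prems comm[of k]
    by (simp only: L_add L_scale trace_add trace_scaleR) simp
  then show ?case using Suc by (simp add: mult_ac)
qed

text \<open>A unit vector orthogonal to \<open>u\<close> anticommutes with it. This kills the
  contribution of the trivial power of \<gamma> to the spectral asymmetry.\<close>

lemma trace_L_cl_vec:
  assumes "CARD('n) \<ge> 2"
  shows "trace (L (cl_vec u)) = 0"
proof -
  obtain v :: "'n rvec" where v: "v \<noteq> 0" "orthogonal u v"
    using orthogonal_to_vector_exists[of u] assms by auto
  define w where "w = (1 / norm v) *\<^sub>R v"
  have w: "w \<bullet> w = 1" "w \<bullet> u = 0"
    using v by (auto simp: w_def orthogonal_def inner_commute dot_square_norm power2_eq_square)
  show ?thesis
  proof (rule trace_conj_neg[where E = "L (cl_vec w)"])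
    show "L (cl_vec w) ** L (cl_vec u) = - (L (cl_vec u) ** L (cl_vec w))"
      using cl_vec_anticommute[OF w(2)] by (simp add: L_minus flip: L_mult)
    show "L (cl_vec w) ** L (cl_vec w) = - mat 1"
      using cl_vec_square[of w] w(1) by (simp add: L_minus L_1 flip: L_mult)
  qed
qed

text \<open>The representation is normalised only on the eigenvectors of \<omega> = e_1 ... e_2m for
  the eigenvalues \<plusminus>i^m. As \<omega> squares to (-1)^m, every vector is half the sum of w
  + c \<omega> w and w - c \<omega> w, where c = (-i)^m inverts i^m, and these are such
  eigenvectors.\<close>

lemma L_last: "L (ecl CARD('n)) = mat (- \<i> * (- \<i>) ^ rot_dim TYPE('n)) ** L (eplanes (rot_dim TYPE('n)))"
proof (subst matrix_eq, rule allI)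
  fix w :: "complex ^ 's"
  let ?m = "rot_dim TYPE('n)"
  let ?\<omega> = "L (eplanes ?m)"
  define c where "c = (- \<i>) ^ ?m"
  have c: "c * \<i> ^ ?m = 1" "\<i> ^ ?m * c = 1" "c * (- 1) ^ ?m = \<i> ^ ?m"
    unfolding c_def by (simp_all flip: power_mult_distrib)
  have ev: "L (ecl CARD('n)) *v w = (- \<sigma> * \<i>) *s w" if "\<sigma> \<in> {1, -1}" "?\<omega> *v w = (\<sigma> * \<i> ^ ?m) *s w" for \<sigma> w
    using rep that unfolding spinor_rep_def prod_ecl_eplanes by blast
  have mone: "L ((- 1) ^ k) = mat ((- 1) ^ k)" for k
    by (induction k) (simp_all add: L_1 L_minus vec_eq_iff mat_def)
  have sq: "?\<omega> *v (?\<omega> *v w) = (- 1) ^ ?m *s w"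
    by (simp add: matrix_vector_mul_assoc eplanes_square[OF two_rot_dim] mone mat_vec flip: L_mult)
  define wp where "wp = w + c *s (?\<omega> *v w)"
  define wm where "wm = w - c *s (?\<omega> *v w)"
  have "?\<omega> *v wp = (1 * \<i> ^ ?m) *s wp"
    using c by (simp add: wp_def matrix_vector_right_distrib vector_scalar_commute sq vector_add_ldistrib)
  then have 1: "L (ecl CARD('n)) *v wp = (- 1 * \<i>) *s wp" by (intro ev) auto
  have "?\<omega> *v wm = (- 1 * \<i> ^ ?m) *s wm"
    using c by (simp add: wm_def matrix_vector_mult_diff_distrib vector_scalar_commute sq vector_ssub_ldistrib vec_eq_iff algebra_simps)
  then have 2: "L (ecl CARD('n)) *v wm = (- (- 1) * \<i>) *s wm" by (intro ev) auto
  have w: "w = (1 / 2) *s wp + (1 / 2) *s wm" by (simp add: wp_def wm_def vec_eq_iff field_simps)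
  have "L (ecl CARD('n)) *v w = (1 / 2) *s ((- 1 * \<i>) *s wp) + (1 / 2) *s ((- (- 1) * \<i>) *s wm)"
    by (subst w) (simp only: matrix_vector_right_distrib vector_scalar_commute 1 2)
  also have "\<dots> = (- \<i> * c) *s (?\<omega> *v w)"
    by (simp add: wp_def wm_def vec_eq_iff field_simps)
  finally show "L (ecl CARD('n)) *v w = (mat (- \<i> * (- \<i>) ^ ?m) ** ?\<omega>) *v w"
    by (simp add: c_def mat_vec flip: matrix_vector_mul_assoc)
qed

text \<open>By \<open>L_last\<close> the last vector acts as a phase times \<omega>, and \<omega>
  adds a quarter turn to each angle. The scalar parts become -sin, and the dimension 2^m gives each
  sine its factor 2.\<close>

lemma trace_spin_x_last:
  "trace (L (spin_x t) ** L (ecl CARD('n)))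
    = - (\<i> ^ Suc (rot_dim TYPE('n))) * of_real (\<Prod>j=1..rot_dim TYPE('n). 2 * sin (t j))"
proof -
  let ?m = "rot_dim TYPE('n)"
  have "trace (L (spin_x t) ** L (ecl CARD('n)))
     = (- \<i> * (- \<i>) ^ ?m) * trace (L (spin_x t * eplanes ?m))"
    unfolding L_last L_mult matrix_mul_assoc mat_commute by (simp only: trace_mat_mult flip: matrix_mul_assoc)
  also have "trace (L (spin_x t * eplanes ?m)) = of_real (\<Prod>j=1..?m. - sin (t j)) * 2 ^ ?m"
    unfolding spin_x_erots erots_eplanes[OF two_rot_dim] by (rule trace_L_prod_planes[OF two_rot_dim])
  also have "\<dots> = (- 1) ^ ?m * of_real (\<Prod>j=1..?m. 2 * sin (t j))"
    by (simp add: prod.distrib prod_uminus mult_ac)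
  also have "(- \<i> * (- \<i>) ^ ?m) * ((- 1) ^ ?m * of_real (\<Prod>j=1..?m. 2 * sin (t j)))
     = - \<i> * ((- \<i>) * (- 1)) ^ ?m * of_real (\<Prod>j=1..?m. 2 * sin (t j))"
    by (simp only: power_mult_distrib mult.assoc)
  finally show ?thesis by simp
qed

end

section \<open>Rotations of the coordinate planes\<close>

lemma ebasis_expansion: "(\<Sum>i=1..CARD('n). (v \<bullet> ebasis i) *\<^sub>R ebasis i) = (v :: 'n::{finite,linorder} rvec)"
proof -
  let ?xs = "sorted_list_of_set (UNIV :: 'n set)"
  have xs: "distinct ?xs" "length ?xs = CARD('n)" "set ?xs = UNIV" by auto
  have b: "bij_betw (\<lambda>i. ?xs ! (i - 1)) {1..CARD('n)} UNIV"
  proof -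
    have "bij_betw ((!) ?xs) {..<CARD('n)} UNIV"
      using bij_betw_nth[OF xs(1)] xs by metis
    moreover have "bij_betw (\<lambda>i. i - 1) {1..CARD('n)} {..<CARD('n)}"
      by (rule bij_betwI[where g = Suc]) auto
    ultimately show ?thesis using bij_betw_trans by (fastforce simp: o_def)
  qed
  have "v = (\<Sum>i\<in>UNIV. v $ i *\<^sub>R axis i 1)"
    using basis_expansion[of v] by (simp flip: scalar_mult_eq_scaleR)
  also have "\<dots> = (\<Sum>i=1..CARD('n). v $ (?xs ! (i - 1)) *\<^sub>R axis (?xs ! (i - 1)) 1)"
    by (rule sum.reindex_bij_betw[OF b, symmetric])
  also have "\<dots> = (\<Sum>i=1..CARD('n). (v \<bullet> ebasis i) *\<^sub>R ebasis i)"
    by (simp add: ebasis_def inner_axis)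
  finally show ?thesis ..
qed

lemma axis_ebasis: "\<exists>i\<in>{1..CARD('n)}. (axis k 1 :: 'n::{finite,linorder} rvec) = ebasis i"
proof -
  have "k \<in> set (sorted_list_of_set (UNIV :: 'n set))" by simp
  then obtain i where "i < CARD('n)" "sorted_list_of_set UNIV ! i = k"
    unfolding in_set_conv_nth by auto
  then have "Suc i \<in> {1..CARD('n)}" "axis k 1 = ebasis (Suc i)" by (auto simp: ebasis_def)
  then show ?thesis by blast
qed

text \<open>The formula of \<open>Cmap\<close> with arbitrary angles, so that powers and inverses of
  C stay within one family and can be handled by adding angles.\<close>

definition plane_rot :: "(nat \<Rightarrow> real) \<Rightarrow> 'n rvec \<Rightarrow> 'n::{finite,linorder} rvec" where
  "plane_rot \<phi> v =
     (\<Sum>j=1..rot_dim TYPE('n).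
        (cos (\<phi> j) * (v \<bullet> ebasis (2*j-1)) - sin (\<phi> j) * (v \<bullet> ebasis (2*j))) *\<^sub>R ebasis (2*j-1)
      + (sin (\<phi> j) * (v \<bullet> ebasis (2*j-1)) + cos (\<phi> j) * (v \<bullet> ebasis (2*j))) *\<^sub>R ebasis (2*j))
     + (v \<bullet> ebasis CARD('n)) *\<^sub>R ebasis CARD('n)"

lemma Cmap_plane_rot:
  "(Cmap :: 'n rvec \<Rightarrow> 'n::{finite,linorder} rvec) = plane_rot (\<lambda>j. 2 * pi * real j / real CARD('n))"
  by (rule ext) (simp add: Cmap_def plane_rot_def Let_def)

lemma plane_rot_adjoint: "plane_rot \<phi> u \<bullet> v = u \<bullet> plane_rot (\<lambda>j. - \<phi> j) v"
  by (simp add: plane_rot_def inner_add_left inner_add_right inner_sum_left inner_sum_right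
      algebra_simps inner_commute[of u] inner_commute[of v])

text \<open>Both identities are tested against all vectors after moving the rotation to the other
  side with \<open>plane_rot_adjoint\<close>.\<close>

lemma linear_plane_rot: "linear (plane_rot \<phi>)"
proof (rule linearI)
  show "plane_rot \<phi> (x + y) = plane_rot \<phi> x + plane_rot \<phi> y" for x y :: "'n::{finite,linorder} rvec"
    by (subst vector_eq_rdot[symmetric]) (simp add: plane_rot_adjoint inner_add_left)
  show "plane_rot \<phi> (c *\<^sub>R x) = c *\<^sub>R plane_rot \<phi> x" for c and x :: "'n::{finite,linorder} rvec"
    by (subst vector_eq_rdot[symmetric]) (simp add: plane_rot_adjoint)
qed

context
  assumes odd: "odd CARD('n::{finite,linorder})"
begin

lemma card_rot_dim: "CARD('n) = 2 * rot_dim TYPE('n) + 1"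
  using odd by (simp add: rot_dim_def)

lemma plane_rot_coord:
  fixes v :: "'n rvec"
  assumes "j \<in> {1..rot_dim TYPE('n)}"
  shows "plane_rot \<phi> v \<bullet> ebasis (2*j-1) = cos (\<phi> j) * (v \<bullet> ebasis (2*j-1)) - sin (\<phi> j) * (v \<bullet> ebasis (2*j))"
    and "plane_rot \<phi> v \<bullet> ebasis (2*j) = sin (\<phi> j) * (v \<bullet> ebasis (2*j-1)) + cos (\<phi> j) * (v \<bullet> ebasis (2*j))"
proof -
  let ?m = "rot_dim TYPE('n)"
  have e: "(ebasis a :: 'n rvec) \<bullet> ebasis b = (if a = b then 1 else 0)"
    if "a \<in> {1..2*?m+1}" "b \<in> {1..2*?m+1}" for a b
    using that unfolding card_rot_dim[symmetric] by (rule ebasis_inner)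
  have j: "2*j-1 \<in> {1..2*?m+1}" "2*j \<in> {1..2*?m+1}" "2*j-1 \<noteq> CARD('n)" "2*j \<noteq> CARD('n)"
    using assms unfolding card_rot_dim by auto
  have i: "2*i-1 \<in> {1..2*?m+1}" "2*i \<in> {1..2*?m+1}" if "i \<in> {1..?m}" for i
    using that by auto
  have ne: "2*i-1 \<noteq> 2*j" "2*i \<noteq> 2*j-1" "(2*i-1 = 2*j-1) = (i = j)" "(2*i = 2*j) = (i = j)" if "i \<in> {1..?m}" for i
    using that assms by (auto, presburger+)
  have last: "CARD('n) \<in> {1..2*?m+1}" unfolding card_rot_dim by simp
  show "plane_rot \<phi> v \<bullet> ebasis (2*j-1) = cos (\<phi> j) * (v \<bullet> ebasis (2*j-1)) - sin (\<phi> j) * (v \<bullet> ebasis (2*j))"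
  proof -
    have "plane_rot \<phi> v \<bullet> ebasis (2*j-1) = (\<Sum>i=1..?m. if i = j then cos (\<phi> i) * (v \<bullet> ebasis (2*i-1)) - sin (\<phi> i) * (v \<bullet> ebasis (2*i)) else 0)
        + (v \<bullet> ebasis CARD('n)) * ((ebasis CARD('n) :: 'n rvec) \<bullet> ebasis (2*j-1))"
      unfolding plane_rot_def inner_add_left inner_sum_left inner_scaleR_left
    proof (intro arg_cong2[where f = "(+)"] sum.cong refl)
      fix i assume im: "i \<in> {1..?m}"
      show "(cos (\<phi> i) * (v \<bullet> ebasis (2*i-1)) - sin (\<phi> i) * (v \<bullet> ebasis (2*i))) * ((ebasis (2*i-1) :: 'n rvec) \<bullet> ebasis (2*j-1))
          + (sin (\<phi> i) * (v \<bullet> ebasis (2*i-1)) + cos (\<phi> i) * (v \<bullet> ebasis (2*i))) * ((ebasis (2*i) :: 'n rvec) \<bullet> ebasis (2*j-1))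
        = (if i = j then cos (\<phi> i) * (v \<bullet> ebasis (2*i-1)) - sin (\<phi> i) * (v \<bullet> ebasis (2*i)) else 0)"
        unfolding e[OF i(1)[OF im] j(1)] e[OF i(2)[OF im] j(1)] ne(2,3)[OF im] using ne(2)[OF im] by (simp del: One_nat_def)
    qed
    then show ?thesis using assms e[OF last j(1)] j(3) by (simp del: One_nat_def)
  qed
  show "plane_rot \<phi> v \<bullet> ebasis (2*j) = sin (\<phi> j) * (v \<bullet> ebasis (2*j-1)) + cos (\<phi> j) * (v \<bullet> ebasis (2*j))"
  proof -
    have "plane_rot \<phi> v \<bullet> ebasis (2*j) = (\<Sum>i=1..?m. if i = j then sin (\<phi> i) * (v \<bullet> ebasis (2*i-1)) + cos (\<phi> i) * (v \<bullet> ebasis (2*i)) else 0)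
        + (v \<bullet> ebasis CARD('n)) * ((ebasis CARD('n) :: 'n rvec) \<bullet> ebasis (2*j))"
      unfolding plane_rot_def inner_add_left inner_sum_left inner_scaleR_left
    proof (intro arg_cong2[where f = "(+)"] sum.cong refl)
      fix i assume im: "i \<in> {1..?m}"
      show "(cos (\<phi> i) * (v \<bullet> ebasis (2*i-1)) - sin (\<phi> i) * (v \<bullet> ebasis (2*i))) * ((ebasis (2*i-1) :: 'n rvec) \<bullet> ebasis (2*j))
          + (sin (\<phi> i) * (v \<bullet> ebasis (2*i-1)) + cos (\<phi> i) * (v \<bullet> ebasis (2*i))) * ((ebasis (2*i) :: 'n rvec) \<bullet> ebasis (2*j))
        = (if i = j then sin (\<phi> i) * (v \<bullet> ebasis (2*i-1)) + cos (\<phi> i) * (v \<bullet> ebasis (2*i)) else 0)"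
        unfolding e[OF i(1)[OF im] j(2)] e[OF i(2)[OF im] j(2)] ne(4)[OF im] using ne(1)[OF im] by (simp del: One_nat_def)
    qed
    then show ?thesis using assms e[OF last j(2)] j(4) by (simp del: One_nat_def)
  qed
qed

lemma plane_rot_last_coord:
  "plane_rot \<phi> v \<bullet> ebasis CARD('n) = (v :: 'n rvec) \<bullet> ebasis CARD('n)"
proof -
  let ?m = "rot_dim TYPE('n)"
  have e: "(ebasis a :: 'n rvec) \<bullet> ebasis CARD('n) = (if a = CARD('n) then 1 else 0)"
    if "a \<in> {1..2*?m+1}" for a
    using that unfolding card_rot_dim[symmetric] by (rule ebasis_inner) (simp add: card_rot_dim)
  have i: "2*i-1 \<in> {1..2*?m+1}" "2*i \<in> {1..2*?m+1}" "2*i-1 \<noteq> CARD('n)" "2*i \<noteq> CARD('n)" if "i \<in> {1..?m}" for i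
    using that unfolding card_rot_dim by auto
  have last: "CARD('n) \<in> {1..2*?m+1}" unfolding card_rot_dim by simp
  show ?thesis
  proof -
    have "(\<Sum>j=1..?m. (cos (\<phi> j) * (v \<bullet> ebasis (2*j-1)) - sin (\<phi> j) * (v \<bullet> ebasis (2*j))) * ((ebasis (2*j-1) :: 'n rvec) \<bullet> ebasis CARD('n))
      + (sin (\<phi> j) * (v \<bullet> ebasis (2*j-1)) + cos (\<phi> j) * (v \<bullet> ebasis (2*j))) * ((ebasis (2*j) :: 'n rvec) \<bullet> (ebasis CARD('n) :: 'n rvec))) = 0"
    proof (intro sum.neutral ballI)
      fix j assume jm: "j \<in> {1..?m}"
      show "(cos (\<phi> j) * (v \<bullet> ebasis (2*j-1)) - sin (\<phi> j) * (v \<bullet> ebasis (2*j))) * ((ebasis (2*j-1) :: 'n rvec) \<bullet> ebasis CARD('n))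
      + (sin (\<phi> j) * (v \<bullet> ebasis (2*j-1)) + cos (\<phi> j) * (v \<bullet> ebasis (2*j))) * ((ebasis (2*j) :: 'n rvec) \<bullet> (ebasis CARD('n) :: 'n rvec)) = 0"
        unfolding e[OF i(1)[OF jm]] e[OF i(2)[OF jm]] using i(3,4)[OF jm] by (simp del: One_nat_def)
    qed
    then show ?thesis
      unfolding plane_rot_def inner_add_left inner_sum_left inner_scaleR_left by (simp add: e[OF last] del: One_nat_def)
  qed
qed

lemma plane_rot_0: "plane_rot (\<lambda>_. 0) v = (v :: 'n rvec)"
proof -
  have "(\<Sum>i=1..2*m. f i) = (\<Sum>j=1..m. f (2*j-1) + f (2*j))" for m and f :: "nat \<Rightarrow> 'n rvec"
    by (induction m) (simp_all add: add_ac)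
  then show ?thesis
    using ebasis_expansion[of v] unfolding plane_rot_def card_rot_dim by simp
qed

lemma plane_rot_add: "plane_rot \<phi> (plane_rot \<psi> v) = plane_rot (\<lambda>j. \<phi> j + \<psi> j) (v :: 'n rvec)"
  unfolding plane_rot_def[of \<phi>] plane_rot_def[of "\<lambda>j. \<phi> j + \<psi> j"] plane_rot_last_coord
proof (intro arg_cong2[where f = "(+) :: 'n rvec \<Rightarrow> _"] arg_cong2[where f = "scaleR :: _ \<Rightarrow> 'n rvec \<Rightarrow> _"] sum.cong refl)
  fix j assume j: "j \<in> {1..rot_dim TYPE('n)}"
  show "cos (\<phi> j) * (plane_rot \<psi> v \<bullet> ebasis (2*j-1)) - sin (\<phi> j) * (plane_rot \<psi> v \<bullet> ebasis (2*j))
      = cos (\<phi> j + \<psi> j) * (v \<bullet> ebasis (2*j-1)) - sin (\<phi> j + \<psi> j) * (v \<bullet> ebasis (2*j))"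
    "sin (\<phi> j) * (plane_rot \<psi> v \<bullet> ebasis (2*j-1)) + cos (\<phi> j) * (plane_rot \<psi> v \<bullet> ebasis (2*j))
      = sin (\<phi> j + \<psi> j) * (v \<bullet> ebasis (2*j-1)) + cos (\<phi> j + \<psi> j) * (v \<bullet> ebasis (2*j))"
    unfolding plane_rot_coord[OF j] cos_add sin_add by (simp_all add: algebra_simps del: One_nat_def)
qed

lemma plane_rot_cong: "(\<And>j. j \<in> {1..rot_dim TYPE('n)} \<Longrightarrow> cos (\<phi> j) = cos (\<psi> j) \<and> sin (\<phi> j) = sin (\<psi> j)) \<Longrightarrow>
  plane_rot \<phi> v = plane_rot \<psi> (v :: 'n rvec)"
  unfolding plane_rot_def by (intro arg_cong2[where f = "(+)"] sum.cong refl) auto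

lemma norm_plane_rot: "norm (plane_rot \<phi> v) = norm (v :: 'n rvec)"
proof -
  have "plane_rot \<phi> v \<bullet> plane_rot \<phi> v = v \<bullet> v"
    by (simp add: plane_rot_adjoint plane_rot_add plane_rot_0)
  then show ?thesis by (simp add: norm_eq_sqrt_inner)
qed

lemma plane_rot_fixed:
  fixes v :: "'n rvec"
  assumes fixed: "plane_rot \<phi> v = v" and nt: "\<And>j. j \<in> {1..rot_dim TYPE('n)} \<Longrightarrow> cos (\<phi> j) \<noteq> 1"
  shows "v = (v \<bullet> ebasis CARD('n)) *\<^sub>R ebasis CARD('n)"
proof -
  have "v \<bullet> ebasis (2*j-1) = 0 \<and> v \<bullet> ebasis (2*j) = 0" if j: "j \<in> {1..rot_dim TYPE('n)}" for j
  proof -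
    let ?a = "v \<bullet> ebasis (2*j-1)" and ?b = "v \<bullet> ebasis (2*j)" and ?c = "cos (\<phi> j)" and ?s = "sin (\<phi> j)"
    have 1: "?a = ?c * ?a - ?s * ?b" and 2: "?b = ?s * ?a + ?c * ?b"
      using plane_rot_coord[OF j, of \<phi> v] unfolding fixed by auto
    \<comment> \<open>Inner product of (a, b) with its own rotation: the sines cancel. For a fixed
      vector this equals the squared length, so a cosine different from 1 forces it to be 0.\<close>
    have "?a * (?c * ?a - ?s * ?b) + ?b * (?s * ?a + ?c * ?b) = ?c * (?a\<^sup>2 + ?b\<^sup>2)"
      by (simp add: algebra_simps power2_eq_square)
    moreover have "?a * ?a = ?a * (?c * ?a - ?s * ?b)" by (rule arg_cong[OF 1])
    moreover have "?b * ?b = ?b * (?s * ?a + ?c * ?b)" by (rule arg_cong[OF 2])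
    ultimately have "?a\<^sup>2 + ?b\<^sup>2 = ?c * (?a\<^sup>2 + ?b\<^sup>2)" unfolding power2_eq_square by linarith
    then have "(1 - ?c) * (?a\<^sup>2 + ?b\<^sup>2) = 0" by (simp add: left_diff_distrib)
    then have "?a\<^sup>2 + ?b\<^sup>2 = 0" using nt[OF j] by simp
    then show ?thesis by (simp add: sum_power2_eq_zero_iff)
  qed
  then have "plane_rot (\<lambda>_. 0) v = (v \<bullet> ebasis CARD('n)) *\<^sub>R ebasis CARD('n)"
    unfolding plane_rot_def by (simp del: One_nat_def)
  then show ?thesis by (simp add: plane_rot_0)
qed

end

section \<open>Isometries of Euclidean space\<close>

lemma group_isom_group: "group (isom_group :: ('n rvec \<Rightarrow> 'n::finite rvec) monoid)"
proof (rule groupI)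
  fix f :: "'n rvec \<Rightarrow> 'n rvec" assume "f \<in> carrier isom_group"
  then have s: "surj f" and d: "\<And>x y. dist (f x) (f y) = dist x y" by (auto simp: isom_group_def)
  have "inj f" by (rule injI) (metis d dist_eq_0_iff)
  then have b: "bij f" using s by (simp add: bij_def)
  have "dist (inv_into UNIV f x) (inv_into UNIV f y) = dist x y" for x y
    using d[of "inv_into UNIV f x" "inv_into UNIV f y"] s by (simp add: surj_f_inv_f)
  then have "inv_into UNIV f \<in> carrier isom_group"
    unfolding isom_group_def using b by (simp add: bij_imp_bij_inv bij_is_surj)
  moreover have "inv_into UNIV f \<circ> f = id" using b by (simp add: bij_is_inj)
  ultimately show "\<exists>y\<in>carrier isom_group. y \<otimes>\<^bsub>isom_group\<^esub> f = \<one>\<^bsub>isom_group\<^esub>"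
    by (auto simp: isom_group_def intro!: bexI[of _ "inv_into UNIV f"])
next
  fix f g :: "'n rvec \<Rightarrow> 'n rvec" assume "f \<in> carrier isom_group" "g \<in> carrier isom_group"
  then show "f \<otimes>\<^bsub>isom_group\<^esub> g \<in> carrier isom_group"
    using comp_surj[of g f] by (auto simp: isom_group_def comp_def)
qed (simp_all add: isom_group_def o_assoc)

lemma transl_in_isom: "transl b \<in> carrier isom_group"
  by (auto simp: isom_group_def transl_def surj_def dist_norm intro!: exI[of _ "_ - b"])

lemma invertible_mult: "invertible D \<Longrightarrow> matrix_inv D *v (D *v x) = x" "invertible D \<Longrightarrow> D *v (matrix_inv D *v x) = x"
  for D :: "real ^ 'n ^ 'n::finite"
proof -
  assume "invertible D"
  then have "D ** matrix_inv D = mat 1 \<and> matrix_inv D ** D = mat 1"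
    unfolding invertible_def matrix_inv_def by (rule someI_ex)
  then show "matrix_inv D *v (D *v x) = x" "D *v (matrix_inv D *v x) = x"
    by (simp_all add: matrix_vector_mul_assoc)
qed

section \<open>The group \<open>\<Gamma>\<^sub>p\<close> and its representations\<close>

lemma L_cos_scale: "tensor_mat (c *\<^sub>R mat 1) (mat 1) = mat (of_real c)"
  by (auto simp: vec_eq_iff tensor_mat_def mat_def) (simp add: scaleR_conv_of_real)

lemma clifford_scaleR_power: "(c *\<^sub>R a) ^ k = c ^ k *\<^sub>R a ^ k" for a :: "'n::{finite,linorder} clifford"
  by (induction k) simp_all

text \<open>Translation by \<open>e\<^sub>p\<close> multiplies twisted spinors by \<open>exp (2\<pi>ih)\<close>; this is trivial for \<open>\<epsilon>\<^sub>1\<close>, where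
  \<open>h = 1\<close> rather than \<open>0\<close> makes \<open>j + h\<close> with \<open>j \<ge> 0\<close> run over the positive frequencies.\<close>

locale twisted_dirac = spinor_representation L
  for L :: "'n::{finite,linorder} clifford \<Rightarrow> complex ^ 's ^ 's::finite" +
  fixes D :: "('n rvec, 'n) vec"
    and \<rho> :: "('n rvec \<Rightarrow> 'n rvec) \<Rightarrow> complex ^ 'd ^ 'd::finite"
    and \<epsilon> :: "('n rvec \<Rightarrow> 'n rvec) \<Rightarrow> 'n clifford"
    and p r m :: nat and h \<kappa> :: real
  assumes p: "p = CARD('n)" "p = 4 * r + 3" "prime p" and m: "m = rot_dim TYPE('n)"
    and invD: "invertible D" and D_last: "D *v ebasis p = ebasis p"
    and C_conj: "\<And>v. Cmap v = D *v Bmap (matrix_inv D *v v)"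
    and rho: "\<rho> \<in> hom (subgrp (Gamma_p D)) unitary_group"
    and rho_lattice: "\<And>b. b \<in> int_lattice \<Longrightarrow> \<rho> (transl (D *v b)) = mat 1"
    and spin: "spin_structure (Gamma_p D) \<epsilon>"
    and eps_lattice: "\<And>j. j \<in> {1..p-1} \<Longrightarrow> \<epsilon> (transl (D *v ebasis j)) = 1"
    and h: "h = 1 \<or> h = 1 / 2" and eps_last: "\<epsilon> (transl (ebasis p)) = cos (2 * pi * h) *\<^sub>R 1"
    and eps_gamma: "\<epsilon> gamma_p = \<kappa> *\<^sub>R spin_x (\<lambda>j. real j * pi / real p)"
begin

abbreviation ep :: "'n rvec" where "ep \<equiv> ebasis p"
abbreviation \<Gamma> where "\<Gamma> \<equiv> Gamma_p D"

definition Crot :: "real \<Rightarrow> 'n rvec \<Rightarrow> 'n rvec" where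
  "Crot k = plane_rot (\<lambda>j. k * (2 * pi * real j / real p))"

lemma odd: "odd CARD('n)"
proof -
  have "odd (4 * r + 3)" by simp
  then show ?thesis unfolding p(1)[symmetric] p(2) .
qed

lemma p_pos: "p > 0" and p_ge: "p \<ge> 3" using p(2) by simp_all
lemma p_m: "p = 2 * m + 1" using card_rot_dim[OF odd] p m by simp
lemma m_r: "m = 2 * r + 1" using p_m p by simp

lemma Crot_add: "Crot k (Crot l v) = Crot (k + l) v"
  unfolding Crot_def plane_rot_add[OF odd] by (simp only: distrib_right)
lemma Crot_0 [simp]: "Crot 0 v = v" using plane_rot_0[OF odd] by (simp add: Crot_def)
lemma Crot_inverse [simp]: "Crot (- k) (Crot k v) = v" "Crot k (Crot (- k) v) = v"
  by (simp_all add: Crot_add)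
lemma linear_Crot: "linear (Crot k)" unfolding Crot_def by (rule linear_plane_rot)
lemma norm_Crot [simp]: "norm (Crot k v) = norm v" by (simp add: Crot_def norm_plane_rot[OF odd])
lemma Crot_last [simp]: "Crot k v \<bullet> ep = v \<bullet> ep"
  using plane_rot_last_coord[OF odd, of _ v] unfolding Crot_def p(1)[symmetric] by simp
lemma Crot_adjoint: "Crot k u \<bullet> v = u \<bullet> Crot (- k) v"
  unfolding Crot_def plane_rot_adjoint by simp
lemma Cmap_Crot: "Cmap = Crot 1"
  unfolding Cmap_plane_rot Crot_def p(1)[symmetric] by simp
lemma Crot_p [simp]: "Crot (real p) v = v"
proof -
  have "Crot (real p) v = plane_rot (\<lambda>_. 0) v"
    unfolding Crot_def
  proof (rule plane_rot_cong[OF odd])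
    fix j
    have "real p * (2 * pi * real j / real p) = 2 * pi * real j" using p_pos by simp
    then show "cos (real p * (2 * pi * real j / real p)) = cos 0 \<and> sin (real p * (2 * pi * real j / real p)) = sin 0"
      by (simp add: sin_int_2pin[of "int j", simplified] cos_int_2pin[of "int j", simplified])
  qed
  then show ?thesis by (simp add: plane_rot_0[OF odd])
qed

lemma ep_norm [simp]: "ep \<bullet> ep = 1" "norm ep = 1"
  using ebasis_inner[where 'n = 'n, of p p] p by (auto simp: norm_eq_sqrt_inner)

lemma Crot_ep [simp]: "Crot k ep = ep"
proof -
  have "ep \<bullet> Crot k v = ep \<bullet> v" for v k using Crot_last[of k v] by (simp add: inner_commute)
  then have "Crot (- k) ep \<bullet> v = ep \<bullet> v" for v k by (simp add: Crot_adjoint)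
  then have "Crot (- k) ep = ep" for k using vector_eq_rdot by blast
  from this[of "- k"] show ?thesis by simp
qed

text \<open>Here primality of p is used: p divides neither k nor any j up to m, so no rotation angle
  of the k-th power is a multiple of 2 \<pi>.\<close>

lemma Crot_fixed:
  assumes k: "k \<in> {1..p-1}" and fixed: "Crot (- real k) u = u"
  shows "u = (u \<bullet> ep) *\<^sub>R ep"
proof -
  have "plane_rot (\<lambda>j. - real k * (2 * pi * real j / real p)) u = u" using fixed by (simp add: Crot_def)
  then show ?thesis unfolding p(1)
  proof (rule plane_rot_fixed[OF odd])
    fix j assume "j \<in> {1..rot_dim TYPE('n)}"
    then have j: "j \<in> {1..m}" by (simp add: m)
    show "cos (- real k * (2 * pi * real j / real CARD('n))) \<noteq> 1"
    proof
      assume "cos (- real k * (2 * pi * real j / real CARD('n))) = 1"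
      then have "cos (real k * (2 * pi * real j / real p)) = 1" by (simp add: p(1))
      then obtain n :: int where "real k * (2 * pi * real j / real p) = of_int n * 2 * pi"
        using cos_one_2pi_int by blast
      then have "2 * pi * (real k * real j) = 2 * pi * (of_int n * real p)" using p by (simp add: field_simps)
      then have "real k * real j = of_int n * real p" by (subst (asm) mult_left_cancel) auto
      then have "of_int (int k * int j) = (of_int (n * int p) :: real)" by simp
      then have "int k * int j = n * int p" using of_int_eq_iff by blast
      then have "int p dvd int (k * j)" by simp
      then have "p dvd k * j" by (simp only: int_dvd_int_iff)
      then have "p dvd k \<or> p dvd j" using p(3) by (simp add: prime_dvd_mult_iff)
      then show False using k j p_m by (auto dest!: dvd_imp_le)
    qed
  qed
qed

lemma gamma_apply: "gamma_p x = Crot 1 x + (1 / real p) *\<^sub>R ep"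
proof -
  have "gamma_p x = Crot 1 (x + (1 / real p) *\<^sub>R ep)"
    by (simp add: gamma_p_def transl_def Cmap_Crot p(1))
  then show ?thesis by (simp add: linear_add[OF linear_Crot] linear_scale[OF linear_Crot])
qed

lemma gamma_pow_apply: "(gamma_p ^^ k) x = Crot (real k) x + (real k / real p) *\<^sub>R ep"
proof (induction k)
  case (Suc k)
  then show ?case
    by (simp add: gamma_apply linear_add[OF linear_Crot] linear_scale[OF linear_Crot] Crot_add
        add_divide_distrib scaleR_left_distrib add_ac)
qed simp

lemma gamma_pow_p: "gamma_p ^^ p = transl ep"
  using p_pos by (simp add: fun_eq_iff gamma_pow_apply transl_def)

lemma lin_part_gamma: "lin_part gamma_p x = Crot 1 x"
  by (simp add: lin_part_def gamma_apply linear_0[OF linear_Crot])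

lemma gamma_isom: "gamma_p \<in> carrier (isom_group :: ('n rvec \<Rightarrow> 'n rvec) monoid)"
proof -
  have "dist (gamma_p x) (gamma_p y) = dist x y" for x y :: "'n rvec"
    by (simp add: gamma_apply dist_norm flip: linear_diff[OF linear_Crot])
  moreover have "gamma_p (Crot (- 1) (y - (1 / real p) *\<^sub>R ep)) = y" for y
    by (simp add: gamma_apply)
  then have "surj (gamma_p :: 'n rvec \<Rightarrow> 'n rvec)" by (rule surjI)
  ultimately show ?thesis by (simp add: isom_group_def)
qed

lemma gens_subset: "insert gamma_p (transl ` (*v) D ` int_lattice) \<subseteq> carrier (isom_group :: ('n rvec \<Rightarrow> 'n rvec) monoid)"
  using gamma_isom transl_in_isom by auto

lemma subgroup_Gamma: "subgroup \<Gamma> isom_group"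
  unfolding Gamma_p_def by (rule group.generate_is_subgroup[OF group_isom_group gens_subset])

lemma Gamma_comp: "f \<in> \<Gamma> \<Longrightarrow> g \<in> \<Gamma> \<Longrightarrow> f \<circ> g \<in> \<Gamma>"
  using subgroup.m_closed[OF subgroup_Gamma] by (simp add: isom_group_def)

lemma Gamma_id: "id \<in> \<Gamma>"
  using subgroup.one_closed[OF subgroup_Gamma] by (simp add: isom_group_def)

lemma Gamma_gamma: "gamma_p \<in> \<Gamma>" and Gamma_transl: "b \<in> int_lattice \<Longrightarrow> transl (D *v b) \<in> \<Gamma>"
  unfolding Gamma_p_def by (auto intro: generate.incl)

lemma Gamma_gamma_pow: "gamma_p ^^ k \<in> \<Gamma>"
  by (induction k) (simp_all only: funpow.simps Gamma_id Gamma_gamma Gamma_comp)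

lemma Gamma_inv:
  assumes "g \<in> \<Gamma>"
  obtains g' where "g' \<in> \<Gamma>" "g \<circ> g' = id" "g' \<circ> g = id"
proof
  have c: "g \<in> carrier isom_group" using subgroup.subset[OF subgroup_Gamma] assms by blast
  show "inv\<^bsub>isom_group\<^esub> g \<in> \<Gamma>" using subgroup.m_inv_closed[OF subgroup_Gamma assms] .
  show "g \<circ> inv\<^bsub>isom_group\<^esub> g = id" "inv\<^bsub>isom_group\<^esub> g \<circ> g = id"
    using group.r_inv[OF group_isom_group c] group.l_inv[OF group_isom_group c] by (simp_all add: isom_group_def)
qed

lemma int_lattice_0: "0 \<in> int_lattice" and int_lattice_ebasis: "ebasis i \<in> int_lattice"
  by (auto simp: int_lattice_def ebasis_def axis_def)

lemma int_lattice_add: "x \<in> int_lattice \<Longrightarrow> y \<in> int_lattice \<Longrightarrow> x + y \<in> int_lattice"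
  and int_lattice_minus: "x \<in> int_lattice \<Longrightarrow> - x \<in> int_lattice"
  by (auto simp: int_lattice_def)

lemma transl_0: "transl 0 = id" by (auto simp: transl_def)

lemma rho_mult: "f \<in> \<Gamma> \<Longrightarrow> g \<in> \<Gamma> \<Longrightarrow> \<rho> (f \<circ> g) = \<rho> f ** \<rho> g"
  using hom_mult[OF rho] by (simp add: isom_group_def unitary_group_def)

lemma eps_mult: "f \<in> \<Gamma> \<Longrightarrow> g \<in> \<Gamma> \<Longrightarrow> \<epsilon> (f \<circ> g) = \<epsilon> f * \<epsilon> g"
  using hom_mult[of \<epsilon> "subgrp \<Gamma>" Spin] spin by (simp add: isom_group_def Spin_def spin_structure_def)

lemma eps_carrier: "f \<in> \<Gamma> \<Longrightarrow> \<epsilon> f \<in> carrier Spin"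
  using spin by (auto simp: spin_structure_def hom_def)

lemma rho_id: "\<rho> id = mat 1" using rho_lattice[OF int_lattice_0] by (simp add: transl_0)

text \<open>Multiplicativity alone does not give the value at the identity. It is read off from a
  lattice translation t with \<open>\<epsilon> t = 1\<close>, since t is also t composed with the
  identity.\<close>

lemma eps_id: "\<epsilon> id = 1"
proof -
  have "1 \<in> {1..p-1}" using p by simp
  then have "\<epsilon> (transl (D *v ebasis 1)) = 1" by (rule eps_lattice)
  then show ?thesis using eps_mult[OF Gamma_transl[OF int_lattice_ebasis] Gamma_id, of 1] by simp
qed

lemma eps_gamma_pow: "\<epsilon> (gamma_p ^^ k) = \<kappa> ^ k *\<^sub>R spin_x (\<lambda>j. real k * (real j * pi / real p))"
proof -
  have "\<epsilon> (gamma_p ^^ k) = \<epsilon> gamma_p ^ k"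
    by (induction k) (simp_all only: funpow.simps power_0 power_Suc eps_id eps_mult Gamma_gamma Gamma_gamma_pow)
  also have "\<dots> = \<kappa> ^ k *\<^sub>R spin_x (\<lambda>j. real k * (real j * pi / real p))"
    by (simp only: eps_gamma clifford_scaleR_power spin_x_power)
  finally show ?thesis .
qed

section \<open>The matrices acting on twisted spinors\<close>

definition N :: "('n rvec \<Rightarrow> 'n rvec) \<Rightarrow> complex ^ ('s \<times> 'd) ^ ('s \<times> 'd)" where
  "N g = tensor_mat (L (\<epsilon> g)) (\<rho> g)"

definition LT :: "'n rvec \<Rightarrow> complex ^ ('s \<times> 'd) ^ ('s \<times> 'd)" where
  "LT u = tensor_mat (L (cl_vec u)) (mat 1)"

lemma N_mult: "f \<in> \<Gamma> \<Longrightarrow> g \<in> \<Gamma> \<Longrightarrow> N (f \<circ> g) = N f ** N g"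
  by (simp add: N_def eps_mult rho_mult L_mult tensor_mat_mult)

lemma N_id: "N id = mat 1" by (simp add: N_def eps_id rho_id L_1 tensor_mat_1)

text \<open>Exponents of the multipliers of the lattice: translation by the j-th basis vector acts
  on twisted spinors as exp(2 \<pi> i \<open>hj j\<close>).\<close>

definition hj :: "nat \<Rightarrow> real" where "hj j = (if j = p then h else 0)"

lemma two_h_int: "2 * h \<in> \<int>"
proof -
  have "2 * h = 2 \<or> 2 * h = 1" using h by linarith
  then show ?thesis by (elim disjE) simp_all
qed

lemma cis_h: "cis (2 * pi * h) = of_real (cos (2 * pi * h))"
proof -
  have "2 * pi * h = 2 * pi \<or> 2 * pi * h = pi" using h by (elim disjE) simp_all
  moreover have "cis t = of_real (cos t)" if "t = 2 * pi \<or> t = pi" for t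
    using that by (elim disjE) (simp_all add: complex_eq_iff)
  ultimately show ?thesis by blast
qed

lemma N_lattice:
  assumes "j \<in> {1..p}" shows "N (transl (D *v ebasis j)) = mat (cis (2 * pi * hj j))"
proof (cases "j = p")
  case True
  then show ?thesis
    by (simp add: N_def D_last eps_last rho_lattice[OF int_lattice_ebasis, of p, unfolded D_last] L_scale L_1
        L_cos_scale hj_def cis_h)
next
  case False
  then have "j \<in> {1..p-1}" using assms by auto
  then show ?thesis using False
    by (simp add: N_def eps_lattice rho_lattice[OF int_lattice_ebasis] L_1 tensor_mat_1 hj_def)
qed

lemma N_gamma_p: "N (gamma_p ^^ p) = mat (cis (2 * pi * h))"
  using N_lattice[of p] p_pos by (simp add: gamma_pow_p D_last hj_def)

lemma LT_square: "LT u ** LT u = mat (- of_real ((norm u)\<^sup>2))"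
proof -
  have "L (cl_vec u * cl_vec u) = (- (u \<bullet> u)) *\<^sub>R mat 1" by (simp only: cl_vec_square L_scale L_1)
  then have "LT u ** LT u = tensor_mat ((- (u \<bullet> u)) *\<^sub>R mat 1) (mat 1)"
    by (simp add: LT_def tensor_mat_mult flip: L_mult)
  then show ?thesis by (simp only: L_cos_scale dot_square_norm of_real_minus)
qed

lemma LT_add: "LT (u + v) = LT u + LT v" and LT_scale: "LT (c *\<^sub>R u) = c *\<^sub>R LT u"
  by (simp_all add: LT_def cl_vec_add cl_vec_scale L_add L_scale vec_eq_iff tensor_mat_def algebra_simps)

lemma trace_LT: "trace (LT u) = 0"
  using trace_L_cl_vec[of u] p by (simp add: LT_def trace_tensor_mat)

text \<open>The defining relation of a spin structure says that conjugation by \<epsilon>(\<gamma>)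
  is C on vectors; \<rho>(\<gamma>) acts on the other tensor factor and does not interfere.\<close>

lemma LT_gamma: "LT (Crot 1 u) ** N gamma_p = N gamma_p ** LT u"
proof -
  obtain g' where g': "g' \<in> \<Gamma>" "gamma_p \<circ> g' = id" "g' \<circ> gamma_p = id"
    using Gamma_inv[OF Gamma_gamma] by blast
  have i: "\<epsilon> gamma_p * \<epsilon> g' = 1" "\<epsilon> g' * \<epsilon> gamma_p = 1"
    using eps_mult[OF Gamma_gamma g'(1)] eps_mult[OF g'(1) Gamma_gamma] g' eps_id by auto
  \<comment> \<open>The inverse in \<open>Spin\<close> is a definite description. The value of
    \<epsilon> at the inverse isometry is a two-sided inverse, hence the only candidate.\<close>
  have "inv\<^bsub>Spin\<^esub> (\<epsilon> gamma_p) = \<epsilon> g'"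
    unfolding m_inv_def
  proof (rule the_equality)
    fix y assume "y \<in> carrier Spin \<and> \<epsilon> gamma_p \<otimes>\<^bsub>Spin\<^esub> y = \<one>\<^bsub>Spin\<^esub> \<and> y \<otimes>\<^bsub>Spin\<^esub> \<epsilon> gamma_p = \<one>\<^bsub>Spin\<^esub>"
    then have "y * \<epsilon> gamma_p = 1" by (simp add: Spin_def)
    then have "y * (\<epsilon> gamma_p * \<epsilon> g') = \<epsilon> g'" by (simp flip: mult.assoc)
    then show "y = \<epsilon> g'" using i by simp
  qed (use i eps_carrier[OF g'(1)] in \<open>simp add: Spin_def\<close>)
  then have "cl_vec (Crot 1 u) = \<epsilon> gamma_p * cl_vec u * \<epsilon> g'"
    using spin Gamma_gamma unfolding spin_structure_def by (metis lin_part_gamma)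
  then have "cl_vec (Crot 1 u) * \<epsilon> gamma_p = \<epsilon> gamma_p * cl_vec u"
    by (simp add: mult.assoc i)
  then show ?thesis by (simp add: LT_def N_def tensor_mat_mult flip: L_mult)
qed

lemma LT_gamma_pow: "LT (Crot (real k) u) ** N (gamma_p ^^ k) = N (gamma_p ^^ k) ** LT u"
proof (induction k)
  case (Suc k)
  have S: "N (gamma_p ^^ Suc k) = N gamma_p ** N (gamma_p ^^ k)"
    by (simp add: N_mult Gamma_gamma Gamma_gamma_pow)
  have "LT (Crot (real (Suc k)) u) ** N (gamma_p ^^ Suc k)
     = (LT (Crot 1 (Crot (real k) u)) ** N gamma_p) ** N (gamma_p ^^ k)"
    unfolding S by (simp add: Crot_add add.commute matrix_mul_assoc)
  also have "\<dots> = N gamma_p ** (LT (Crot (real k) u) ** N (gamma_p ^^ k))"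
    unfolding LT_gamma by (simp add: matrix_mul_assoc)
  also have "\<dots> = N (gamma_p ^^ Suc k) ** LT u" unfolding Suc S by (simp add: matrix_mul_assoc)
  finally show ?case .
qed (simp add: N_id[unfolded id_def] N_id)

definition chi :: "nat \<Rightarrow> complex" where "chi k = trace (\<rho> (gamma_p ^^ k))"

lemma trace_N_LT:
  assumes k: "k \<in> {1..p-1}"
  shows "trace (N (gamma_p ^^ k) ** LT ep)
    = of_real (\<kappa> ^ k * (- 1) ^ r * ((- 1) ^ ((r + 1) * (k + 1)) * of_int (Legendre (int k) (int p)) * sqrt (real p))) * chi k"
proof -
  have "trace (N (gamma_p ^^ k) ** LT ep) = trace (L (\<epsilon> (gamma_p ^^ k)) ** L (cl_vec ep)) * chi k"
    by (simp add: N_def LT_def tensor_mat_mult trace_tensor_mat chi_def)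
  also have "trace (L (\<epsilon> (gamma_p ^^ k)) ** L (cl_vec ep))
     = of_real (\<kappa> ^ k) * trace (L (spin_x (\<lambda>j. real k * (real j * pi / real p))) ** L (ecl CARD('n)))"
    unfolding eps_gamma_pow L_scale p(1)[symmetric] by (simp only: trace_scaleR flip: scalar_matrix_assoc)
  also have "\<dots> = of_real (\<kappa> ^ k) * (- (\<i> ^ Suc m) * of_real (\<Prod>j=1..m. 2 * sin (real k * (real j * pi / real p))))"
    unfolding trace_spin_x_last m by simp
  also have "(\<Prod>j=1..m. 2 * sin (real k * (real j * pi / real p)))
      = (- 1) ^ ((r + 1) * (k + 1)) * of_int (Legendre (int k) (int p)) * sqrt (real p)"
    unfolding prod_sin_Legendre[OF p(3) p(2) m_r k, symmetric]
    by (intro prod.cong refl) (simp add: mult.left_commute)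
  \<comment> \<open>The number of planes is m = 2 r + 1, so m + 1 is even and the phase is
    real.\<close>
  also have "- (\<i> ^ Suc m) = (- 1) ^ r"
  proof -
    have "\<i> ^ Suc m = (\<i> ^ 2) ^ (r + 1)" unfolding power_mult[symmetric] m_r by (intro arg_cong[where f = "power \<i>"]) simp
    then show ?thesis by simp
  qed
  finally show ?thesis by simp
qed

end

section \<open>Fourier coefficients of twisted spinors\<close>

lemma bounded_bilinear_smult: "bounded_bilinear (\<lambda>(c::complex) (v :: complex ^ 'k::finite). c *s v)"
  unfolding bilinear_conv_bounded_bilinear[symmetric] bilinear_def
  by (intro conjI allI linearI) (simp_all add: vec_eq_iff algebra_simps)

lemma bounded_linear_mat_vec: "bounded_linear (\<lambda>v. A *v v)" for A :: "complex ^ 'k::finite ^ 'l::finite"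
  unfolding linear_conv_bounded_linear[symmetric]
  by (rule linearI) (simp_all add: vec_eq_iff matrix_vector_mult_def algebra_simps sum.distrib scaleR_sum_right)

lemma bounded_linear_smult: "bounded_linear (\<lambda>v :: complex ^ 'k::finite. c *s v)"
  by (rule bounded_bilinear.bounded_linear_right[OF bounded_bilinear_smult])

lemma integral_bounded_linear:
  assumes "bounded_linear h" "f integrable_on S"
  shows "integral S (\<lambda>x. h (f x)) = h (integral S f)"
  using integral_linear[OF assms(2,1)] by (simp add: o_def)

definition chr :: "'n::finite rvec \<Rightarrow> 'n rvec \<Rightarrow> complex" where
  "chr u x = cis (2 * pi * (u \<bullet> x))"

lemma chr_add_right: "chr u (x + y) = chr u x * chr u y"
  by (simp add: chr_def inner_add_right distrib_left cis_mult)

lemma chr_add_left: "chr (u + v) x = chr u x * chr v x"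
  by (simp add: chr_def inner_add_left distrib_left cis_mult)

lemma chr_minus_mult [simp]: "chr (- u) x * chr u x = 1" "chr u x * chr (- u) x = 1"
  by (simp_all add: chr_def cis_mult)

lemma chr_0 [simp]: "chr 0 x = 1" by (simp add: chr_def)

lemma continuous_on_chr [continuous_intros]:
  assumes "continuous_on S f" shows "continuous_on S (\<lambda>x. chr u (f x))"
  unfolding chr_def cis_conv_exp by (intro continuous_intros assms)

lemma chr_has_vector_derivative:
  "((\<lambda>t. chr u (x + t *\<^sub>R v)) has_vector_derivative (2 * pi * \<i> * (u \<bullet> v)) * chr u x) (at 0)"
proof -
  let ?A = "\<i> * complex_of_real (2 * pi * (u \<bullet> v))"
  have "((\<lambda>t. exp (t *\<^sub>R ?A)) has_vector_derivative exp (0 *\<^sub>R ?A) * ?A) (at 0)"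
    by (rule exp_scaleR_has_vector_derivative_right)
  then have "((\<lambda>t. chr u x * exp (t *\<^sub>R ?A)) has_vector_derivative chr u x * (exp (0 *\<^sub>R ?A) * ?A)) (at 0)"
    by (rule has_vector_derivative_mult_right)
  moreover have "chr u (x + t *\<^sub>R v) = chr u x * exp (t *\<^sub>R ?A)" for t
  proof -
    have "chr u (t *\<^sub>R v) = exp (t *\<^sub>R ?A)"
      by (simp add: chr_def cis_conv_exp) (simp add: scaleR_conv_of_real mult_ac)
    then show ?thesis by (simp add: chr_add_right)
  qed
  ultimately show ?thesis by (simp add: mult_ac)
qed

lemma smult_has_vector_derivative:
  fixes g :: "real \<Rightarrow> complex ^ 'k::finite"
  assumes "(f has_vector_derivative f') (at t)" "(g has_vector_derivative g') (at t)"
  shows "((\<lambda>t. f t *s g t) has_vector_derivative f t *s g' + f' *s g t) (at t)"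
  by (rule bounded_bilinear.has_vector_derivative[OF bounded_bilinear_smult assms])

lemma partial_deriv_works:
  assumes "f differentiable (at x)"
  shows "((\<lambda>t. f (x + t *\<^sub>R v)) has_vector_derivative partial_deriv v f x) (at 0)"
proof -
  have "(\<lambda>t. f (x + t *\<^sub>R v)) differentiable (at 0)"
    using differentiable_chain_at[of "\<lambda>t. x + t *\<^sub>R v" 0 f] assms
    by (simp add: o_def differentiable_add)
  then show ?thesis unfolding partial_deriv_def by (rule vector_derivative_works[THEN iffD1])
qed

lemma smooth_funD:
  assumes "smooth_fun f"
  shows "f differentiable (at x)" "continuous_on UNIV f" "continuous_on UNIV (partial_deriv (axis i 1) f)"
proof -
  have "Ck 0 f" "Ck 1 f" using assms unfolding smooth_fun_def by blast+
  then show "f differentiable (at x)" "continuous_on UNIV f" "continuous_on UNIV (partial_deriv (axis i 1) f)"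
    by auto
qed

context twisted_dirac
begin

abbreviation Eig :: "real \<Rightarrow> ('n rvec \<Rightarrow> complex ^ ('s \<times> 'd)) set" where
  "Eig \<mu> \<equiv> eigenspinors \<Gamma> L \<epsilon> \<rho> \<mu>"

text \<open>Equivariance under the basis translations only, in the scalar form that makes a product
  with a character of \<open>Lam\<close> periodic.\<close>

definition qp :: "('n rvec \<Rightarrow> complex ^ ('s \<times> 'd)) \<Rightarrow> bool" where
  "qp \<psi> \<longleftrightarrow> (\<forall>j\<in>{1..p}. \<forall>x. \<psi> (x + D *v ebasis j) = cis (2 * pi * hj j) *s \<psi> x)"

definition equivar :: "('n rvec \<Rightarrow> complex ^ ('s \<times> 'd)) \<Rightarrow> ('n rvec \<Rightarrow> 'n rvec) \<Rightarrow> bool" where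
  "equivar \<psi> g \<longleftrightarrow> g \<in> \<Gamma> \<and> (\<forall>x. \<psi> (g x) = N g *v \<psi> x)"

lemma equivar_comp:
  assumes "equivar \<psi> f" "equivar \<psi> g" shows "equivar \<psi> (f \<circ> g)"
proof -
  have G: "f \<in> \<Gamma>" "g \<in> \<Gamma>" using assms by (auto simp: equivar_def)
  have "\<psi> ((f \<circ> g) x) = N (f \<circ> g) *v \<psi> x" for x
    using assms unfolding N_mult[OF G] by (simp add: equivar_def matrix_vector_mul_assoc)
  then show ?thesis using Gamma_comp[OF G] by (simp add: equivar_def)
qed

lemma equivar_inv:
  assumes g: "equivar \<psi> g" and g': "g' \<in> \<Gamma>" "g \<circ> g' = id" "g' \<circ> g = id"
  shows "equivar \<psi> g'"
proof -
  have "\<psi> (g' x) = N g' *v \<psi> x" for x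
  proof -
    have "g (g' x) = x" using g'(2) by (metis comp_apply id_apply)
    then have "\<psi> x = N g *v \<psi> (g' x)" using g by (metis equivar_def)
    then have "N g' *v \<psi> x = (N g' ** N g) *v \<psi> (g' x)" by (simp add: matrix_vector_mul_assoc)
    also have "N g' ** N g = mat 1"
      using N_mult[of g' g] g g' N_id by (simp add: equivar_def)
    finally show ?thesis by simp
  qed
  then show ?thesis using g' by (simp add: equivar_def)
qed

lemma transl_add: "transl (a + b) = transl a \<circ> transl b"
  by (rule ext) (simp add: transl_def add_ac)

text \<open>Equivariance is stable under composition and inversion, so it spreads from the basis to
  its integer multiples and then to all sums.\<close>

lemma equivar_lattice:
  assumes \<psi>: "qp \<psi>" and b: "b \<in> int_lattice"
  shows "equivar \<psi> (transl (D *v b))"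
proof -
  have base: "equivar \<psi> (transl (D *v ebasis j))" if "j \<in> {1..p}" for j
    using \<psi> that Gamma_transl[OF int_lattice_ebasis, of j]
    by (simp add: equivar_def qp_def N_lattice mat_vec) (simp add: transl_def)
  have id: "equivar \<psi> (transl (D *v 0))" using Gamma_id by (simp add: equivar_def transl_0 N_id)
  have add: "equivar \<psi> (transl (D *v (a + c)))" if "equivar \<psi> (transl (D *v a))" "equivar \<psi> (transl (D *v c))" for a c
    using equivar_comp[OF that] by (simp add: matrix_vector_right_distrib transl_add)
  have minus: "equivar \<psi> (transl (D *v (- a)))" if "equivar \<psi> (transl (D *v a))" "a \<in> int_lattice" for a
  proof (rule equivar_inv[OF that(1)])
    show "transl (D *v (- a)) \<in> \<Gamma>" by (intro Gamma_transl int_lattice_minus that)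
    have "D *v a + D *v (- a) = 0" by (simp flip: matrix_vector_right_distrib)
    then show "transl (D *v a) \<circ> transl (D *v (- a)) = id" "transl (D *v (- a)) \<circ> transl (D *v a) = id"
      by (simp_all add: transl_0 add.commute flip: transl_add)
  qed
  have nat: "equivar \<psi> (transl (D *v (real n *\<^sub>R ebasis j))) \<and> real n *\<^sub>R (ebasis j :: 'n rvec) \<in> int_lattice" if "j \<in> {1..p}" for j n
  proof (induction n)
    case (Suc n)
    have "real (Suc n) *\<^sub>R ebasis j = real n *\<^sub>R ebasis j + (ebasis j :: 'n rvec)"
      by (simp add: scaleR_left_distrib)
    moreover have "real n *\<^sub>R ebasis j + (ebasis j :: 'n rvec) \<in> int_lattice"
      by (rule int_lattice_add[OF _ int_lattice_ebasis]) (use Suc in simp)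
    ultimately show ?case using add[OF _ base[OF that]] Suc by (simp only:)
  qed (use id int_lattice_0 in simp)
  have int: "equivar \<psi> (transl (D *v (of_int n *\<^sub>R ebasis j)))" if j: "j \<in> {1..p}" for j n
  proof (cases "n \<ge> 0")
    case True
    then show ?thesis using nat[OF j, of "nat n"] by simp
  next
    case False
    then show ?thesis using minus[of "real (nat (- n)) *\<^sub>R ebasis j"] nat[OF j, of "nat (- n)"] by simp
  qed
  have "equivar \<psi> (transl (D *v (\<Sum>j\<in>A. (b \<bullet> ebasis j) *\<^sub>R ebasis j)))" if "finite A" "A \<subseteq> {1..p}" for A
    using that
  proof (induction A)
    case (insert j A)
    have "b \<bullet> ebasis j \<in> \<int>" using b by (simp add: ebasis_def inner_axis int_lattice_def)
    then obtain n where "b \<bullet> ebasis j = of_int n" by (auto elim: Ints_cases)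
    then have "equivar \<psi> (transl (D *v ((b \<bullet> ebasis j) *\<^sub>R ebasis j)))" using int insert by simp
    then show ?case using insert add by simp
  qed (use id in simp)
  from this[of "{1..p}"] show ?thesis using ebasis_expansion[of b] by (simp add: p(1))
qed

text \<open>By induction over the generated group only p + 1 conditions remain. Those of
  \<open>qp\<close> select the admissible frequencies; the one for \<gamma> relates the coefficients
  along an orbit of C.\<close>

lemma twisted_spinors_iff:
  "\<psi> \<in> twisted_spinors \<Gamma> L \<epsilon> \<rho> \<longleftrightarrow> smooth_fun \<psi> \<and> qp \<psi> \<and> (\<forall>x. \<psi> (gamma_p x) = N gamma_p *v \<psi> x)"
proof safe
  assume \<psi>: "\<psi> \<in> twisted_spinors \<Gamma> L \<epsilon> \<rho>"
  then have eq: "\<psi> (g x) = N g *v \<psi> x" if "g \<in> \<Gamma>" for g x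
    using that by (simp add: twisted_spinors_def N_def)
  show "smooth_fun \<psi>" using \<psi> by (simp add: twisted_spinors_def)
  show "\<psi> (gamma_p x) = N gamma_p *v \<psi> x" for x by (rule eq[OF Gamma_gamma])
  show "qp \<psi>"
    unfolding qp_def
  proof safe
    fix j x assume j: "j \<in> {1..p}"
    show "\<psi> (x + D *v ebasis j) = cis (2 * pi * hj j) *s \<psi> x"
      using eq[OF Gamma_transl[OF int_lattice_ebasis], of j x]
      unfolding N_lattice[OF j] mat_vec by (simp add: transl_def)
  qed
next
  assume sm: "smooth_fun \<psi>" and q: "qp \<psi>" and ga: "\<forall>x. \<psi> (gamma_p x) = N gamma_p *v \<psi> x"
  have gens: "equivar \<psi> g" if "g \<in> insert gamma_p (transl ` (*v) D ` int_lattice)" for g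
    using that ga Gamma_gamma equivar_lattice[OF q] by (auto simp: equivar_def)
  have "equivar \<psi> g" if "g \<in> generate isom_group (insert gamma_p (transl ` (*v) D ` int_lattice))" for g
    using that
  proof (induction rule: generate.induct)
    case one
    then show ?case using Gamma_id N_id by (simp add: equivar_def isom_group_def id_def)
  next
    case (incl g) then show ?case by (rule gens)
  next
    case (inv g)
    have eg: "equivar \<psi> g" by (rule gens[OF inv])
    then have gG: "g \<in> \<Gamma>" by (simp add: equivar_def)
    have c: "g \<in> carrier isom_group" using subgroup.subset[OF subgroup_Gamma] gG by blast
    show ?case
    proof (rule equivar_inv[OF eg])
      show "inv\<^bsub>isom_group\<^esub> g \<in> \<Gamma>" using subgroup.m_inv_closed[OF subgroup_Gamma gG] .
      show "g \<circ> inv\<^bsub>isom_group\<^esub> g = id" "inv\<^bsub>isom_group\<^esub> g \<circ> g = id"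
        using group.r_inv[OF group_isom_group c] group.l_inv[OF group_isom_group c] by (simp_all add: isom_group_def)
    qed
  next
    case (eng f g) then show ?case using equivar_comp[of \<psi> f g] by (simp add: isom_group_def comp_def)
  qed
  then show "\<psi> \<in> twisted_spinors \<Gamma> L \<epsilon> \<rho>"
    using sm by (simp add: twisted_spinors_def equivar_def N_def Gamma_p_def)
qed

text \<open>Frequencies u for which exp(2 \<pi> i <u, x>) has the same multipliers under lattice
  translations as the spinors: the dual lattice, displaced by \<open>h\<close> in the coordinate
  dual to \<open>e_p\<close>.\<close>

definition Lam :: "'n rvec set" where
  "Lam = {u. \<forall>j\<in>{1..p}. u \<bullet> (D *v ebasis j) - hj j \<in> \<int>}"

lemma Lam_chr:
  assumes "u \<in> Lam" "j \<in> {1..p}" shows "chr u (D *v ebasis j) = cis (2 * pi * hj j)"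
proof -
  have "u \<bullet> (D *v ebasis j) - hj j \<in> \<int>" using assms unfolding Lam_def by blast
  then obtain n where "u \<bullet> (D *v ebasis j) - hj j = of_int n" by (rule Ints_cases)
  then have e: "2 * pi * (u \<bullet> (D *v ebasis j)) = 2 * pi * hj j + 2 * pi * of_int n" by (simp add: algebra_simps)
  show ?thesis unfolding chr_def e by (simp flip: cis_mult)
qed

lemma int_periodic_D:
  assumes "\<And>j x. j \<in> {1..p} \<Longrightarrow> F (x + D *v ebasis j) = F x"
  shows "int_periodic (\<lambda>y. F (D *v y))"
  unfolding int_periodic_def
proof safe
  fix y i
  obtain j where "j \<in> {1..p}" "(axis i 1 :: 'n rvec) = ebasis j" using axis_ebasis[of i] p(1) by auto
  then show "F (D *v (y + axis i 1)) = F (D *v y)" using assms by (simp add: matrix_vector_right_distrib)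
qed

lemma qp_periodic:
  assumes "qp \<psi>" "u \<in> Lam"
  shows "int_periodic (\<lambda>y. chr (- u) (D *v y) *s \<psi> (D *v y))"
proof (rule int_periodic_D[where F = "\<lambda>x. chr (- u) x *s \<psi> x"])
  fix j x assume j: "j \<in> {1..p}"
  have "chr (- u) (D *v ebasis j) * cis (2 * pi * hj j) = 1"
    using Lam_chr[OF assms(2) j] chr_minus_mult[of u "D *v ebasis j"] by simp
  then show "chr (- u) (x + D *v ebasis j) *s \<psi> (x + D *v ebasis j) = chr (- u) x *s \<psi> x"
    using assms(1) j by (simp add: qp_def chr_add_right vector_smult_assoc mult.assoc)
qed

text \<open>The integral is taken in lattice coordinates, where the fundamental domain is the unit
  cube of measure 1; hence there is no volume factor.\<close>

definition four :: "('n rvec \<Rightarrow> complex ^ ('s \<times> 'd)) \<Rightarrow> 'n rvec \<Rightarrow> complex ^ ('s \<times> 'd)" where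
  "four \<psi> u = integral (cbox 0 1) (\<lambda>y. chr (- u) (D *v y) *s \<psi> (D *v y))"

lemma continuous_on_smult [continuous_intros]:
  fixes g :: "'n rvec \<Rightarrow> complex ^ 'k::finite"
  shows "continuous_on S f \<Longrightarrow> continuous_on S g \<Longrightarrow> continuous_on S (\<lambda>x. f x *s g x)"
  by (rule bounded_bilinear.continuous_on[OF bounded_bilinear_smult])

lemma continuous_on_D: "continuous_on UNIV g \<Longrightarrow> continuous_on UNIV (\<lambda>y. g (D *v y))"
  by (rule continuous_on_compose2[of UNIV g UNIV "\<lambda>y. D *v y"])
    (auto intro: linear_continuous_on matrix_vector_mul_bounded_linear)

lemma continuous_four:
  "continuous_on UNIV \<psi> \<Longrightarrow> continuous_on UNIV (\<lambda>y. chr u (D *v y) *s \<psi> (D *v y))"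
  for \<psi> :: "'n rvec \<Rightarrow> complex ^ 'k::finite"
  by (rule continuous_on_smult[OF continuous_on_D[OF continuous_on_chr[OF continuous_on_id]] continuous_on_D])

text \<open>The product of \<open>\<psi>\<close> with the conjugate character is periodic, so its
  derivative integrates to 0. The product rule then transfers the derivative to the
  character.\<close>

lemma four_partial_deriv:
  assumes sm: "smooth_fun \<psi>" and q: "qp \<psi>" and u: "u \<in> Lam"
  shows "integral (cbox 0 1) (\<lambda>y. chr (- u) (D *v y) *s partial_deriv (axis i 1) \<psi> (D *v y))
    = (2 * pi * \<i> * (u \<bullet> axis i 1)) *s four \<psi> u"
proof -
  \<comment> \<open>The i-th coordinate direction, pulled back to lattice coordinates.\<close>
  define v where "v = matrix_inv D *v axis i 1"
  let ?w = "axis i 1 :: 'n rvec" and ?c = "2 * pi * \<i> * complex_of_real (u \<bullet> axis i 1)"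
  have Dv: "D *v v = ?w" by (simp add: v_def invertible_mult[OF invD])
  let ?A = "\<lambda>y. chr (- u) (D *v y) *s partial_deriv ?w \<psi> (D *v y)"
  let ?B = "\<lambda>y. chr (- u) (D *v y) *s \<psi> (D *v y)"
  let ?f' = "\<lambda>y. ?A y + (- ?c) *s ?B y"
  have cA: "continuous_on UNIV ?A" and cB: "continuous_on UNIV ?B"
    using smooth_funD[OF sm] by (intro continuous_four; simp)+
  have cc: "continuous_on UNIV (\<lambda>y. (- ?c) *s ?B y)" by (intro continuous_intros cB)
  have "integral (cbox 0 1) ?f' = 0"
  proof (rule integral_periodic_deriv[where v = v, OF cB qp_periodic[OF q u]])
    fix x
    have "((\<lambda>t. \<psi> (D *v x + t *\<^sub>R ?w)) has_vector_derivative partial_deriv ?w \<psi> (D *v x)) (at 0)"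
      by (rule partial_deriv_works[OF smooth_funD(1)[OF sm]])
    from smult_has_vector_derivative[OF chr_has_vector_derivative[of "- u" "D *v x" ?w] this]
    have "((\<lambda>t. chr (- u) (D *v x + t *\<^sub>R ?w) *s \<psi> (D *v x + t *\<^sub>R ?w)) has_vector_derivative ?f' x) (at 0)"
      by (simp add: vector_smult_assoc)
    moreover have "D *v (x + t *\<^sub>R v) = D *v x + t *\<^sub>R ?w" for t
      by (simp add: matrix_vector_right_distrib Dv matrix_vector_mult_scaleR)
    ultimately show "((\<lambda>t. chr (- u) (D *v (x + t *\<^sub>R v)) *s \<psi> (D *v (x + t *\<^sub>R v))) has_vector_derivative ?f' x) (at 0)"
      by simp
  next
    show "continuous_on UNIV ?f'" by (intro continuous_on_add cA cc)
  qed
  then have "integral (cbox 0 1) ?A + integral (cbox 0 1) (\<lambda>y. (- ?c) *s ?B y) = 0"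
    by (subst (asm) integral_add[OF integrable_cont[OF cA] integrable_cont[OF cc]])
  also have "integral (cbox 0 1) (\<lambda>y. (- ?c) *s ?B y) = (- ?c) *s integral (cbox 0 1) ?B"
    by (rule integral_bounded_linear[OF bounded_linear_smult integrable_cont[OF cB]])
  finally show ?thesis unfolding four_def by (simp add: vec_eq_iff add_eq_0_iff)
qed

lemma LT_expansion: "LT u = (\<Sum>i=1..p. (u \<bullet> ebasis i) *\<^sub>R LT (ebasis i))"
proof -
  have "LT (\<Sum>i\<in>A. c i *\<^sub>R ebasis i) = (\<Sum>i\<in>A. c i *\<^sub>R LT (ebasis i))" if "finite A" for c and A :: "nat set"
    using that LT_scale[of 0 0] by (induction A) (simp_all add: LT_add LT_scale)
  from this[of "{1..p}" "\<lambda>i. u \<bullet> ebasis i"] show ?thesis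
    using ebasis_expansion[of u] by (simp add: p(1))
qed

lemma mat_vec_sum_left: "(\<Sum>i\<in>A. c i *\<^sub>R M i) *v w = (\<Sum>i\<in>A. of_real (c i) *s (M i *v w))"
  for M :: "'i \<Rightarrow> complex ^ 'k::finite ^ 'l::finite"
proof -
  have "(c *\<^sub>R M) *v w = of_real c *s (M *v w)" for c and M :: "complex ^ 'k ^ 'l"
    by (simp add: vec_eq_iff matrix_vector_mult_def sum_distrib_left) (simp add: scaleR_conv_of_real mult.assoc)
  moreover have "(M + M') *v w = M *v w + M' *v w" for M M' :: "complex ^ 'k ^ 'l"
    by (rule matrix_vector_mult_add_rdistrib)
  ultimately show ?thesis
    by (induction A rule: infinite_finite_induct) (simp_all add: matrix_vector_mult_0)
qed

text \<open>On Fourier coefficients the Dirac operator becomes Clifford multiplication by 2 \<pi> i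
  u, one coordinate at a time.\<close>

lemma four_eigen:
  assumes \<psi>: "\<psi> \<in> Eig \<mu>" and u: "u \<in> Lam"
  shows "(2 * pi * \<i>) *s (LT u *v four \<psi> u) = of_real \<mu> *s four \<psi> u"
proof -
  have sm: "smooth_fun \<psi>" and q: "qp \<psi>" and ev: "\<And>x. dirac L \<psi> x = of_real \<mu> *s \<psi> x"
    using \<psi> by (auto simp: eigenspinors_def twisted_spinors_iff)
  let ?P = "\<lambda>i y. chr (- u) (D *v y) *s partial_deriv (ebasis i) \<psi> (D *v y)"
  have cP: "continuous_on UNIV (?P i)" for i
    unfolding ebasis_def using smooth_funD[OF sm] by (intro continuous_four) simp
  have cB: "continuous_on UNIV (\<lambda>y. chr (- u) (D *v y) *s \<psi> (D *v y))"
    using smooth_funD[OF sm] by (intro continuous_four) simp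
  have "of_real \<mu> *s four \<psi> u = integral (cbox 0 1) (\<lambda>y. of_real \<mu> *s (chr (- u) (D *v y) *s \<psi> (D *v y)))"
    unfolding four_def by (rule integral_bounded_linear[OF bounded_linear_smult integrable_cont[OF cB], symmetric])
  also have "\<dots> = integral (cbox 0 1) (\<lambda>y. \<Sum>i=1..p. LT (ebasis i) *v ?P i y)"
  proof (rule arg_cong[where f = "integral (cbox 0 1)"], rule ext)
    fix y
    have "of_real \<mu> *s (chr (- u) (D *v y) *s \<psi> (D *v y)) = chr (- u) (D *v y) *s dirac L \<psi> (D *v y)"
      by (simp add: ev vector_smult_assoc mult.commute)
    also have "\<dots> = (\<Sum>i=1..p. LT (ebasis i) *v ?P i y)"
      by (simp add: dirac_def LT_def p(1) vec.scale_sum_right vector_scalar_commute)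
    finally show "of_real \<mu> *s (chr (- u) (D *v y) *s \<psi> (D *v y)) = (\<Sum>i=1..p. LT (ebasis i) *v ?P i y)" .
  qed
  also have "\<dots> = (\<Sum>i=1..p. integral (cbox 0 1) (\<lambda>y. LT (ebasis i) *v ?P i y))"
    by (intro integral_sum integrable_cont bounded_linear.continuous_on[OF bounded_linear_mat_vec] cP) auto
  also have "\<dots> = (\<Sum>i=1..p. LT (ebasis i) *v ((2 * pi * \<i> * (u \<bullet> ebasis i)) *s four \<psi> u))"
  proof (rule sum.cong[OF refl])
    fix i
    have "integral (cbox 0 1) (\<lambda>y. LT (ebasis i) *v ?P i y) = LT (ebasis i) *v integral (cbox 0 1) (?P i)"
      by (rule integral_bounded_linear[OF bounded_linear_mat_vec integrable_cont[OF cP]])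
    also have "integral (cbox 0 1) (?P i) = (2 * pi * \<i> * (u \<bullet> ebasis i)) *s four \<psi> u"
      unfolding ebasis_def by (rule four_partial_deriv[OF sm q u])
    finally show "integral (cbox 0 1) (\<lambda>y. LT (ebasis i) *v ?P i y) = LT (ebasis i) *v ((2 * pi * \<i> * (u \<bullet> ebasis i)) *s four \<psi> u)" .
  qed
  also have "\<dots> = (2 * pi * \<i>) *s (LT u *v four \<psi> u)"
    unfolding LT_expansion[of u] mat_vec_sum_left
    by (simp add: vec.scale_sum_right vector_scalar_commute vector_smult_assoc mult_ac)
  finally show ?thesis by simp
qed

text \<open>The square of 2 \<pi> i L(u) is the scalar (2 \<pi> |u|)^2. Hence the coefficients of an
  eigenspinor are supported on a sphere.\<close>

lemma LT_eigen_norm: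
  assumes "(2 * pi * \<i>) *s (LT u *v w) = of_real \<mu> *s w" "w \<noteq> 0"
  shows "2 * pi * norm u = \<bar>\<mu>\<bar>"
proof -
  define c where "c = 2 * pi * \<i>"
  have ev: "c *s (LT u *v w) = of_real \<mu> *s w" using assms(1) by (simp add: c_def)
  have "of_real (\<mu>\<^sup>2) *s w = of_real \<mu> *s (c *s (LT u *v w))"
    unfolding ev by (simp add: vector_smult_assoc power2_eq_square)
  also have "\<dots> = c *s (LT u *v (of_real \<mu> *s w))"
    by (simp add: vector_scalar_commute vector_smult_assoc mult.commute)
  also have "\<dots> = c *s (LT u *v (c *s (LT u *v w)))" by (simp only: ev)
  also have "\<dots> = (c * c) *s ((LT u ** LT u) *v w)"
    by (simp add: vector_scalar_commute vector_smult_assoc matrix_vector_mul_assoc)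
  also have "\<dots> = of_real ((2 * pi * norm u)\<^sup>2) *s w"
    by (simp add: LT_square mat_vec vector_smult_assoc power2_eq_square c_def mult_ac)
  finally have "of_real (\<mu>\<^sup>2 - (2 * pi * norm u)\<^sup>2) *s w = 0" by (simp add: vector_sub_rdistrib)
  then have "\<mu>\<^sup>2 = (2 * pi * norm u)\<^sup>2"
    using assms(2) unfolding vector_mul_eq_0 of_real_eq_0_iff by simp
  then have "\<bar>\<mu>\<bar> = \<bar>2 * pi * norm u\<bar>" using power2_eq_iff abs_eq_iff by metis
  then show ?thesis by simp
qed

end

section \<open>Eigenspaces of the Dirac operator\<close>

lemma differentiable_chr: "chr u differentiable (at x)"
proof -
  have 1: "(\<lambda>x. \<i> * complex_of_real (2 * pi * (u \<bullet> x))) differentiable (at x)"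
  proof -
    have "bounded_linear (\<lambda>x. (u \<bullet> x) *\<^sub>R (2 * pi * \<i>))"
      by (rule bounded_linear_compose[OF bounded_linear_scaleR_left bounded_linear_inner_right])
    moreover have "(\<lambda>x. (u \<bullet> x) *\<^sub>R (2 * pi * \<i>)) = (\<lambda>x. \<i> * complex_of_real (2 * pi * (u \<bullet> x)))"
      by (simp add: scaleR_conv_of_real mult_ac)
    ultimately show ?thesis using bounded_linear_imp_differentiable by metis
  qed
  have "exp differentiable (at (\<i> * complex_of_real (2 * pi * (u \<bullet> x))))"
    by (rule differentiableI[OF has_field_derivative_imp_has_derivative[OF DERIV_exp]])
  from differentiable_chain_at[OF 1 this] show ?thesis
    unfolding chr_def[abs_def] cis_conv_exp o_def .
qed

lemma differentiable_smult:
  assumes "f differentiable (at x)" shows "(\<lambda>x. f x *s (w :: complex ^ 'k::finite)) differentiable (at x)"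
proof -
  obtain f' where "(f has_derivative f') (at x)" using assms unfolding differentiable_def by blast
  from bounded_linear.has_derivative[OF bounded_bilinear.bounded_linear_left[OF bounded_bilinear_smult] this]
  show ?thesis unfolding differentiable_def by blast
qed

lemma partial_deriv_trig:
  fixes w :: "'n::finite rvec \<Rightarrow> complex ^ 'k::finite"
  shows "partial_deriv v (\<lambda>x. \<Sum>u\<in>A. chr u x *s w u) = (\<lambda>x. \<Sum>u\<in>A. chr u x *s ((2 * pi * \<i> * (u \<bullet> v)) *s w u))"
proof
  fix x
  have "((\<lambda>t. \<Sum>u\<in>A. chr u (x + t *\<^sub>R v) *s w u) has_vector_derivative
      (\<Sum>u\<in>A. chr u x *s 0 + ((2 * pi * \<i> * (u \<bullet> v)) * chr u x) *s w u)) (at 0)"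
  proof (rule has_vector_derivative_sum)
    fix u
    show "((\<lambda>t. chr u (x + t *\<^sub>R v) *s w u) has_vector_derivative chr u x *s 0 + ((2 * pi * \<i> * (u \<bullet> v)) * chr u x) *s w u) (at 0)"
      using smult_has_vector_derivative[OF chr_has_vector_derivative has_vector_derivative_const, of u x v "w u"] by simp
  qed
  then show "partial_deriv v (\<lambda>x. \<Sum>u\<in>A. chr u x *s w u) x = (\<Sum>u\<in>A. chr u x *s ((2 * pi * \<i> * (u \<bullet> v)) *s w u))"
    unfolding partial_deriv_def by (subst vector_derivative_at) (simp_all add: vector_smult_assoc mult_ac)
qed

lemma differentiable_trig:
  fixes w :: "'n::finite rvec \<Rightarrow> complex ^ 'k::finite"
  assumes "finite A"
  shows "(\<lambda>x. \<Sum>u\<in>A. chr u x *s w u) differentiable (at x)"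
  using assms by (intro differentiable_sum ballI differentiable_smult differentiable_chr)

lemma smooth_trig:
  fixes w :: "'n::finite rvec \<Rightarrow> complex ^ 'k::finite"
  assumes "finite A"
  shows "smooth_fun (\<lambda>x. \<Sum>u\<in>A. chr u x *s w u)"
proof -
  have "Ck k (\<lambda>x. \<Sum>u\<in>A. chr u x *s w u)" for k
  \<comment> \<open>A partial derivative is a sum of the same characters with other coefficients,
    hence the generalisation over \<open>w\<close>.\<close>
  proof (induction k arbitrary: w)
    case 0
    show ?case using differentiable_trig[OF assms, of w]
      by (simp add: continuous_at_imp_continuous_on differentiable_imp_continuous_within)
  next
    case (Suc k)
    show ?case unfolding Ck.simps partial_deriv_trig
      by (intro conjI allI differentiable_trig[OF assms] Suc)
  qed
  then show ?thesis by (simp add: smooth_fun_def)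
qed

context twisted_dirac
begin

text \<open>The derivative of the character along \<open>z\<close> is 2 \<pi> i |z|^2 times the
  character itself, and the integral of a derivative of a periodic function is 0.\<close>

lemma integral_chr_zero:
  assumes z: "\<And>j. j \<in> {1..p} \<Longrightarrow> chr z (D *v ebasis j) = 1" and nz: "z \<noteq> 0"
  shows "integral (cbox 0 1) (\<lambda>y. chr z (D *v y)) = 0"
proof -
  let ?c = "2 * pi * \<i> * complex_of_real (z \<bullet> z)"
  have cont: "continuous_on UNIV (\<lambda>y. chr z (D *v y))"
    by (rule continuous_on_D[OF continuous_on_chr[OF continuous_on_id]])
  have per: "int_periodic (\<lambda>y. chr z (D *v y))"
    by (rule int_periodic_D[where F = "chr z"]) (simp add: chr_add_right z)
  have "integral (cbox 0 1) (\<lambda>y. ?c * chr z (D *v y)) = 0"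
  proof (rule integral_periodic_deriv[where v = "matrix_inv D *v z", OF cont per])
    fix x
    show "((\<lambda>t. chr z (D *v (x + t *\<^sub>R (matrix_inv D *v z)))) has_vector_derivative ?c * chr z (D *v x)) (at 0)"
      using chr_has_vector_derivative[of z "D *v x" z]
      by (simp add: matrix_vector_right_distrib matrix_vector_mult_scaleR invertible_mult[OF invD])
  qed (intro continuous_on_mult continuous_on_const cont)
  then have "?c * integral (cbox 0 1) (\<lambda>y. chr z (D *v y)) = 0" by (simp only: integral_mult_right)
  then show ?thesis using nz by simp
qed

lemma measure_unit_cube: "Sigma_Algebra.measure lborel (cbox 0 (1 :: 'n rvec)) = 1"
proof -
  have "(0 :: 'n rvec) \<in> cbox 0 1" by (simp add: mem_box_cart)
  then have "cbox 0 (1 :: 'n rvec) \<noteq> {}" by blast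
  then show ?thesis by (simp add: content_cbox_cart)
qed

lemma four_chr:
  assumes "u \<in> Lam" "u' \<in> Lam"
  shows "four (\<lambda>x. chr u' x *s w) u = (if u = u' then w else 0)"
proof -
  have e: "chr (- u) x *s (chr u' x *s w) = chr (u' - u) x *s w" for x
    using chr_add_left[of u' "- u" x] by (simp add: vector_smult_assoc mult.commute)
  show ?thesis
  proof (cases "u = u'")
    case True
    then show ?thesis unfolding four_def e by (simp add: measure_unit_cube)
  next
    case False
    have "integral (cbox 0 1) (\<lambda>y. chr (u' - u) (D *v y)) = 0"
    proof (rule integral_chr_zero)
      fix j assume j: "j \<in> {1..p}"
      have "chr (u' - u) (D *v ebasis j) = chr u (D *v ebasis j) * chr (- u) (D *v ebasis j)"
        using chr_add_left[of u' "- u" "D *v ebasis j"] Lam_chr[OF assms(1) j] Lam_chr[OF assms(2) j] by simp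
      then show "chr (u' - u) (D *v ebasis j) = 1" by simp
    qed (use False in simp)
    moreover have "integral (cbox 0 1) (\<lambda>y. chr (u' - u) (D *v y) *s w) = integral (cbox 0 1) (\<lambda>y. chr (u' - u) (D *v y)) *s w"
      by (rule integral_bounded_linear[OF bounded_bilinear.bounded_linear_left[OF bounded_bilinear_smult]])
        (intro integrable_cont continuous_on_D[OF continuous_on_chr[OF continuous_on_id]])
    ultimately show ?thesis using False unfolding four_def e by simp
  qed
qed

section \<open>The shifted dual lattice and its symmetry\<close>

lemma Crot_D: "Crot 1 (D *v ebasis j) = D *v Bmap (ebasis j)"
  using C_conj[of "D *v ebasis j"] by (simp add: invertible_mult[OF invD] Cmap_Crot)

lemma Bmap_ebasis:
  assumes "j \<in> {1..p}"
  shows "Bmap (ebasis j :: 'n rvec) = (if j = p then ebasis p else if j = p - 1 then - (\<Sum>i=1..p-1. ebasis i) else ebasis (j + 1))"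
proof -
  have e: "(ebasis j :: 'n rvec) \<bullet> ebasis i = (if i = j then 1 else 0)" if "i \<in> {1..p}" for i
    using ebasis_inner[where 'n = 'n, of j i] assms that p(1) by auto
  have "(\<Sum>i=1..p-2. ((ebasis j :: 'n rvec) \<bullet> ebasis i) *\<^sub>R ebasis (i + 1)) = (\<Sum>i=1..p-2. if i = j then ebasis (j + 1) else 0 :: 'n rvec)"
  proof (rule sum.cong[OF refl])
    fix i assume "i \<in> {1..p-2}"
    then have "i \<in> {1..p}" by auto
    then show "((ebasis j :: 'n rvec) \<bullet> ebasis i) *\<^sub>R ebasis (i + 1) = (if i = j then ebasis (j + 1) else 0 :: 'n rvec)"
      by (simp add: e)
  qed
  also have "\<dots> = (if j \<in> {1..p-2} then ebasis (j + 1) else 0)" by simp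
  finally show ?thesis
    using assms p_ge e[of p] e[of "p - 1"] unfolding Bmap_def Let_def p(1)[symmetric] by auto
qed

text \<open>C fixes \<open>e_p\<close>, so the inner products of \<open>e_p\<close> with the images
  of the first p - 1 basis vectors do not change along the cycle of B and all equal some c. The last
  step of the cycle gives c = -(p - 1) c.\<close>

lemma ep_orth:
  assumes "j \<in> {1..p-1}" shows "ep \<bullet> (D *v ebasis j) = 0"
proof -
  define c where "c = ep \<bullet> (D *v ebasis 1)"
  have C: "ep \<bullet> (D *v Bmap (ebasis j)) = ep \<bullet> (D *v ebasis j)" for j
    unfolding Crot_D[symmetric] by (metis Crot_last inner_commute)
  have all: "ep \<bullet> (D *v ebasis j) = c" if "1 \<le> j" "j \<le> p - 1" for j
    using that
  proof (induction j rule: dec_induct)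
    case (step i)
    then have "Bmap (ebasis i :: 'n rvec) = ebasis (Suc i)" using Bmap_ebasis[of i] p_ge by auto
    then show ?case using C[of i] step by simp
  qed (simp add: c_def)
  have "c = ep \<bullet> (D *v (- (\<Sum>i=1..p-1. ebasis i)))"
  proof -
    have "Bmap (ebasis (p - 1) :: 'n rvec) = - (\<Sum>i=1..p-1. ebasis i)"
      using Bmap_ebasis[of "p - 1"] p_ge by auto
    moreover have "ep \<bullet> (D *v ebasis (p - 1)) = c" using p_ge by (intro all) auto
    ultimately show ?thesis using C[of "p - 1"] by (simp only:)
  qed
  also have "\<dots> = - (\<Sum>i=1..p-1. ep \<bullet> (D *v ebasis i))"
    by (simp add: vec.neg vec.sum inner_sum_right)
  also have "\<dots> = - (real (p - 1) * c)" using all by simp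
  finally have "real p * c = 0" using p_ge by (simp add: of_nat_diff algebra_simps)
  then show ?thesis using all assms p_pos by simp
qed

lemma ep_Lam: "\<nu> *\<^sub>R ep \<in> Lam \<longleftrightarrow> \<nu> - h \<in> \<int>"
proof -
  have "(\<nu> *\<^sub>R ep) \<bullet> (D *v ebasis j) - hj j = (if j = p then \<nu> - h else 0)" if "j \<in> {1..p}" for j
  proof (cases "j = p")
    case False
    then have "j \<in> {1..p-1}" using that by auto
    then show ?thesis using False by (simp add: hj_def ep_orth)
  qed (simp add: hj_def D_last)
  then show ?thesis using p_pos unfolding Lam_def by force
qed

text \<open>On pairings with the lattice the inverse of C acts through B, whose matrix is integral.
  The shift survives because B fixes \<open>e_p\<close> and maps the other basis vectors to
  combinations without \<open>e_p\<close>.\<close>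

lemma Crot_Lam_neg:
  assumes u: "u \<in> Lam" shows "Crot (- 1) u \<in> Lam"
  unfolding Lam_def
proof safe
  fix j assume j: "j \<in> {1..p}"
  have L: "u \<bullet> (D *v ebasis i) - hj i \<in> \<int>" if "i \<in> {1..p}" for i using u that by (simp add: Lam_def)
  have e: "Crot (- 1) u \<bullet> (D *v ebasis j) = u \<bullet> (D *v Bmap (ebasis j))"
    by (simp add: Crot_adjoint Crot_D)
  consider "j = p" | "j = p - 1" "j \<noteq> p" | "j + 1 \<in> {1..p-1}" "j \<noteq> p" "j \<noteq> p - 1" using j by fastforce
  then show "Crot (- 1) u \<bullet> (D *v ebasis j) - hj j \<in> \<int>"
  proof cases
    case 1
    then show ?thesis unfolding e using L[of p] p_pos Bmap_ebasis[OF j] by simp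
  next
    case 2
    have "u \<bullet> (D *v ebasis i) \<in> \<int>" if "i \<in> {1..p-1}" for i
    proof -
      have "i \<in> {1..p}" "i \<noteq> p" using that p_pos by auto
      then show ?thesis using L[of i] by (simp add: hj_def)
    qed
    then have "- (\<Sum>i=1..p-1. u \<bullet> (D *v ebasis i)) \<in> \<int>" by (intro Ints_minus Ints_sum) auto
    moreover have "u \<bullet> (D *v Bmap (ebasis j)) = - (\<Sum>i=1..p-1. u \<bullet> (D *v ebasis i))"
      using Bmap_ebasis[OF j] 2 by (simp add: vec.neg vec.sum inner_sum_right)
    ultimately show ?thesis unfolding e using 2 by (simp add: hj_def)
  next
    case 3
    then have "j + 1 \<in> {1..p}" "j + 1 \<noteq> p" by auto
    then show ?thesis unfolding e using L[of "j + 1"] Bmap_ebasis[OF j] 3 by (simp add: hj_def)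
  qed
qed

lemma Crot_Lam_nneg: "u \<in> Lam \<Longrightarrow> Crot (- real k) u \<in> Lam"
proof (induction k)
  case (Suc k)
  then have "Crot (- 1) (Crot (- real k) u) \<in> Lam" by (intro Crot_Lam_neg) simp
  then show ?case by (simp add: Crot_add algebra_simps)
qed simp

text \<open>C has order p, so C itself is a power of its inverse.\<close>

lemma Crot_Lam:
  assumes "u \<in> Lam" shows "Crot (real k) u \<in> Lam"
proof -
  have step: "Crot 1 v \<in> Lam" if "v \<in> Lam" for v
  proof -
    have "Crot (- real (p - 1)) (Crot (real p) v) = Crot 1 v"
      using p_pos unfolding Crot_add by (simp add: of_nat_diff)
    then show ?thesis using Crot_Lam_nneg[OF that, of "p - 1"] by simp
  qed
  show ?thesis
  proof (induction k)
    case (Suc k)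
    then show ?case using step[of "Crot (real k) u"] by (simp add: Crot_add add.commute)
  qed (use assms in simp)
qed

text \<open>Multiplying by the conjugate character of one frequency h \<open>e_p\<close> makes every
  component of \<open>\<psi>\<close> periodic. Its ordinary Fourier coefficients are then values of
  \<open>four\<close>, and uniqueness on the torus applies.\<close>

lemma four_complete:
  assumes cont: "continuous_on UNIV \<psi>" and q: "qp \<psi>" and zero: "\<And>u. u \<in> Lam \<Longrightarrow> four \<psi> u = 0"
  shows "\<psi> x = 0"
proof -
  have u0: "h *\<^sub>R ep \<in> Lam" by (simp add: ep_Lam)
  let ?u0 = "h *\<^sub>R ep"
  have comp: "\<psi> (D *v y) $ a = 0" for y a
  proof -
    define f where "f = (\<lambda>y. (chr (- ?u0) (D *v y) *s \<psi> (D *v y)) $ a)"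
    have cf: "continuous_on UNIV (\<lambda>y. chr v (D *v y) *s \<psi> (D *v y))" for v
      by (rule continuous_four[OF cont])
    have "zero_coeffs f"
      unfolding zero_coeffs_def
    proof (intro conjI allI impI)
      show "continuous_on UNIV f" unfolding f_def by (rule bounded_linear.continuous_on[OF bounded_linear_vec_nth cf])
      show "int_periodic f" using qp_periodic[OF q u0] unfolding f_def int_periodic_def by (simp only: simp_thms)
      fix n :: "'n rvec" assume n: "\<forall>i. n $ i \<in> \<int>"
      \<comment> \<open>The dual lattice vector that pairs with D y as \<open>n\<close> pairs with
        y.\<close>
      define z where "z = n v* matrix_inv D"
      have z: "z \<bullet> (D *v y) = n \<bullet> y" for y by (simp add: z_def dot_lmul_matrix invertible_mult[OF invD])
      have u: "?u0 - z \<in> Lam"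
        unfolding Lam_def
      proof safe
        fix j assume j: "j \<in> {1..p}"
        have "?u0 \<bullet> (D *v ebasis j) - hj j \<in> \<int>" using u0 j by (simp add: Lam_def)
        moreover have "n \<bullet> ebasis j \<in> \<int>" using n by (simp add: ebasis_def inner_axis)
        ultimately have "(?u0 \<bullet> (D *v ebasis j) - hj j) - n \<bullet> ebasis j \<in> \<int>" by (rule Ints_diff)
        then show "(?u0 - z) \<bullet> (D *v ebasis j) - hj j \<in> \<int>" by (simp add: inner_diff_left z algebra_simps)
      qed
      have "cis (2 * pi * (n \<bullet> y)) * f y = (chr (- (?u0 - z)) (D *v y) *s \<psi> (D *v y)) $ a" for y
        using chr_add_left[of "- ?u0" z "D *v y"] by (simp add: f_def z chr_def[of z] mult_ac)
      then have "integral (cbox 0 1) (\<lambda>y. cis (2 * pi * (n \<bullet> y)) * f y) = four \<psi> (?u0 - z) $ a"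
        unfolding four_def using integral_bounded_linear[OF bounded_linear_vec_nth integrable_cont[OF cf]] by simp
      then show "integral (cbox 0 1) (\<lambda>y. cis (2 * pi * (n \<bullet> y)) * f y) = 0" using zero[OF u] by simp
    qed
    then have "f y = 0" by (rule zero_coeffs_imp_zero)
    moreover have "chr (- ?u0) (D *v y) \<noteq> 0" by (simp add: chr_def)
    ultimately show ?thesis by (simp add: f_def)
  qed
  have "\<psi> (D *v (matrix_inv D *v x)) = 0" using comp[of "matrix_inv D *v x"] by (simp add: vec_eq_iff)
  then show ?thesis by (simp add: invertible_mult[OF invD])
qed

text \<open>Only the coordinate dual to \<open>e\<^sub>p\<close> can be non-integral, with fractional part \<open>1/2\<close>, so rounding loses nothing.\<close>

definition nu :: "'n rvec \<Rightarrow> 'n \<Rightarrow> int" where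
  "nu u k = \<lfloor>u \<bullet> (D *v axis k 1)\<rfloor>"

lemma inj_nu: "inj_on nu Lam"
proof (rule inj_onI)
  fix u v assume u: "u \<in> Lam" and v: "v \<in> Lam" and e: "nu u = nu v"
  have "u \<bullet> (D *v axis k 1) = v \<bullet> (D *v axis k 1)" for k
  proof -
    obtain j where j: "j \<in> {1..p}" "(axis k 1 :: 'n rvec) = ebasis j" using axis_ebasis[of k] p(1) by auto
    have "u \<bullet> (D *v axis k 1) - hj j \<in> \<int>" "v \<bullet> (D *v axis k 1) - hj j \<in> \<int>"
      using u v j by (simp_all add: Lam_def)
    then have "(u \<bullet> (D *v axis k 1) - hj j) - (v \<bullet> (D *v axis k 1) - hj j) \<in> \<int>" by (rule Ints_diff)
    then have "u \<bullet> (D *v axis k 1) - v \<bullet> (D *v axis k 1) \<in> \<int>" by simp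
    then obtain n where n: "u \<bullet> (D *v axis k 1) - v \<bullet> (D *v axis k 1) = of_int n" by (rule Ints_cases)
    have "\<lfloor>u \<bullet> (D *v axis k 1)\<rfloor> = \<lfloor>v \<bullet> (D *v axis k 1)\<rfloor>" using e by (metis nu_def)
    then have "n = 0" using n by linarith
    then show ?thesis using n by simp
  qed
  then have zero: "(u - v) \<bullet> (D *v axis k 1) = 0" for k by (simp add: inner_diff_left)
  have expand: "(u - v) \<bullet> (D *v x) = (\<Sum>k\<in>UNIV. x $ k * ((u - v) \<bullet> (D *v axis k 1)))" for x
  proof -
    have "D *v x = (\<Sum>k\<in>UNIV. x $ k *\<^sub>R (D *v axis k 1))"
    proof -
      have "D *v x = D *v (\<Sum>k\<in>UNIV. x $ k *\<^sub>R axis k 1)"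
        using basis_expansion[of x] by (simp add: scalar_mult_eq_scaleR)
      also have "\<dots> = (\<Sum>k\<in>UNIV. D *v (x $ k *\<^sub>R axis k 1))"
        by (rule linear_sum[OF matrix_vector_mul_linear])
      finally show ?thesis by (simp add: matrix_vector_mult_scaleR)
    qed
    then show ?thesis by (simp add: inner_sum_right)
  qed
  have "(u - v) \<bullet> (D *v x) = 0" for x
    unfolding expand[of x] by (simp only: zero mult_zero_right sum.neutral_const)
  from this[of "matrix_inv D *v (u - v)"] show "u = v" by (simp add: invertible_mult[OF invD])
qed

lemma nu_bound: "\<bar>real_of_int (nu u k)\<bar> \<le> norm u * (\<Sum>k\<in>UNIV. norm (D *v axis k 1)) + 1"
proof -
  have "\<bar>u \<bullet> (D *v axis k 1)\<bar> \<le> norm u * norm (D *v axis k 1)" by (rule Cauchy_Schwarz_ineq2)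
  also have "\<dots> \<le> norm u * (\<Sum>k\<in>UNIV. norm (D *v axis k 1))"
    by (intro mult_left_mono member_le_sum) auto
  finally show ?thesis unfolding nu_def by linarith
qed

lemma finite_Lam_ball: "finite {u \<in> Lam. norm u \<le> B}"
proof -
  define K where "K = (\<Sum>k\<in>UNIV. norm (D *v axis k 1))"
  have K: "K \<ge> 0" unfolding K_def by (intro sum_nonneg) auto
  let ?I = "{- \<lceil>B * K + 1\<rceil>..\<lceil>B * K + 1\<rceil>}"
  have "nu ` {u \<in> Lam. norm u \<le> B} \<subseteq> (\<Pi>\<^sub>E k\<in>UNIV. ?I)"
  proof (rule image_subsetI)
    fix u assume "u \<in> {u \<in> Lam. norm u \<le> B}"
    then have u: "norm u \<le> B" by simp
    have "nu u k \<in> ?I" for k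
    proof -
      have "\<bar>real_of_int (nu u k)\<bar> \<le> norm u * K + 1" using nu_bound unfolding K_def .
      also have "\<dots> \<le> B * K + 1" using u K by (simp add: mult_right_mono)
      finally have "\<bar>nu u k\<bar> \<le> \<lceil>B * K + 1\<rceil>" by linarith
      then show ?thesis by auto
    qed
    then show "nu u \<in> (\<Pi>\<^sub>E k\<in>UNIV. ?I)" by (simp add: PiE_def Pi_def)
  qed
  then have "finite (nu ` {u \<in> Lam. norm u \<le> B})" by (rule finite_subset) (simp add: finite_PiE)
  then show ?thesis by (rule finite_imageD) (rule inj_on_subset[OF inj_nu], auto)
qed

section \<open>From eigenspinors to Fourier coefficients\<close>

definition U :: "real \<Rightarrow> 'n rvec set" where "U \<mu> = {u \<in> Lam. 2 * pi * norm u = \<bar>\<mu>\<bar>}"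

lemma finite_U: "finite (U \<mu>)"
  by (rule finite_subset[OF _ finite_Lam_ball[of "\<bar>\<mu>\<bar> / (2 * pi)"]]) (auto simp: U_def field_simps)

lemma U_Lam: "u \<in> U \<mu> \<Longrightarrow> u \<in> Lam" by (simp add: U_def)

lemma U_minus: "U (- \<mu>) = U \<mu>" by (simp add: U_def)

lemma Crot_U: "u \<in> U \<mu> \<Longrightarrow> Crot (real k) u \<in> U \<mu>" "u \<in> U \<mu> \<Longrightarrow> Crot (- real k) u \<in> U \<mu>"
  using Crot_Lam Crot_Lam_nneg by (auto simp: U_def)

lemma Crot_1_U: "u \<in> U \<mu> \<Longrightarrow> Crot 1 u \<in> U \<mu>" "u \<in> U \<mu> \<Longrightarrow> Crot (- 1) u \<in> U \<mu>"
  using Crot_U[of u \<mu> 1] by auto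

text \<open>The Fourier coefficients of the eigenspinors for \<open>\<mu>\<close>.\<close>

definition W :: "real \<Rightarrow> ('n rvec \<Rightarrow> complex ^ ('s \<times> 'd)) set" where
  "W \<mu> = {w. (\<forall>u. u \<notin> U \<mu> \<longrightarrow> w u = 0) \<and>
     (\<forall>u\<in>U \<mu>. (2 * pi * \<i>) *s (LT u *v w u) = of_real \<mu> *s w u) \<and>
     (\<forall>u\<in>U \<mu>. w (Crot 1 u) = cis (- (2 * pi * (u \<bullet> ep) / p)) *s (N gamma_p *v w u))}"

definition Phi :: "real \<Rightarrow> ('n rvec \<Rightarrow> complex ^ ('s \<times> 'd)) \<Rightarrow> 'n rvec \<Rightarrow> complex ^ ('s \<times> 'd)" where
  "Phi \<mu> w = (\<lambda>x. \<Sum>u\<in>U \<mu>. chr u x *s w u)"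

lemma continuous_trig: "continuous_on UNIV (\<lambda>x. chr (u :: 'n rvec) x *s (w :: complex ^ 'k::finite))"
  by (intro continuous_intros)

lemma four_sum:
  assumes "finite A" "\<And>i. i \<in> A \<Longrightarrow> continuous_on UNIV (f i)"
  shows "four (\<lambda>x. \<Sum>i\<in>A. f i x) u = (\<Sum>i\<in>A. four (f i) u)"
  unfolding four_def vec.scale_sum_right
  by (rule integral_sum) (use assms in \<open>auto intro!: integrable_cont continuous_four\<close>)

lemma four_Phi:
  assumes "u \<in> Lam" shows "four (Phi \<mu> w) u = (if u \<in> U \<mu> then w u else 0)"
proof -
  have "four (Phi \<mu> w) u = (\<Sum>v\<in>U \<mu>. four (\<lambda>x. chr v x *s w v) u)"
    unfolding Phi_def by (intro four_sum finite_U continuous_trig)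
  also have "\<dots> = (\<Sum>v\<in>U \<mu>. if u = v then w v else 0)"
    by (rule sum.cong[OF refl], rule four_chr[OF assms U_Lam])
  finally show ?thesis using finite_U by simp
qed

lemma smooth_Phi: "smooth_fun (Phi \<mu> w)"
  unfolding Phi_def by (rule smooth_trig[OF finite_U])

lemma qp_Phi: "qp (Phi \<mu> w)"
  unfolding qp_def
proof safe
  fix j x assume j: "j \<in> {1..p}"
  show "Phi \<mu> w (x + D *v ebasis j) = cis (2 * pi * hj j) *s Phi \<mu> w x"
    unfolding Phi_def vec.scale_sum_right
    by (intro sum.cong refl) (simp add: chr_add_right Lam_chr[OF U_Lam j] vector_smult_assoc mult.commute)
qed

lemma Phi_gamma: "Phi \<mu> w (gamma_p x) = (\<Sum>u\<in>U \<mu>. chr u x *s (cis (2 * pi * (u \<bullet> ep) / p) *s w (Crot 1 u)))"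
  unfolding Phi_def
proof (rule sum.reindex_bij_witness[where j = "Crot (- 1)" and i = "Crot 1"])
  fix u assume "u \<in> U \<mu>"
  have "chr u (gamma_p x) = chr u (Crot 1 x) * chr u ((1 / real p) *\<^sub>R ep)"
    by (simp add: gamma_apply chr_add_right)
  also have "chr u (Crot 1 x) = chr (Crot (- 1) u) x" by (simp add: chr_def Crot_adjoint)
  finally show "chr (Crot (- 1) u) x *s (cis (2 * pi * (Crot (- 1) u \<bullet> ep) / p) *s w (Crot 1 (Crot (- 1) u))) = chr u (gamma_p x) *s w u"
    by (simp add: vector_smult_assoc chr_def[of u "(1 / real p) *\<^sub>R ep"])
qed (use Crot_1_U in auto)

lemma Phi_mat: "A *v Phi \<mu> w x = (\<Sum>u\<in>U \<mu>. chr u x *s (A *v w u))"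
  unfolding Phi_def by (simp add: vec.sum vector_scalar_commute)

lemma Phi_smult: "c *s Phi \<mu> w x = (\<Sum>u\<in>U \<mu>. chr u x *s (c *s w u))"
  unfolding Phi_def vec.scale_sum_right by (simp add: vector_smult_assoc mult.commute)

lemma dirac_Phi: "dirac L (Phi \<mu> w) x = (\<Sum>u\<in>U \<mu>. chr u x *s ((2 * pi * \<i>) *s (LT u *v w u)))"
proof -
  have "dirac L (Phi \<mu> w) x = (\<Sum>i=1..p. LT (ebasis i) *v (\<Sum>u\<in>U \<mu>. chr u x *s ((2 * pi * \<i> * (u \<bullet> ebasis i)) *s w u)))"
    unfolding dirac_def p(1)[symmetric] LT_def Phi_def partial_deriv_trig ..
  also have "\<dots> = (\<Sum>i=1..p. \<Sum>u\<in>U \<mu>. chr u x *s ((2 * pi * \<i> * (u \<bullet> ebasis i)) *s (LT (ebasis i) *v w u)))"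
    by (simp add: vec.sum vector_scalar_commute)
  also have "\<dots> = (\<Sum>u\<in>U \<mu>. \<Sum>i=1..p. chr u x *s ((2 * pi * \<i> * (u \<bullet> ebasis i)) *s (LT (ebasis i) *v w u)))"
    by (rule sum.swap)
  also have "\<dots> = (\<Sum>u\<in>U \<mu>. chr u x *s ((2 * pi * \<i>) *s (LT u *v w u)))"
    by (intro sum.cong refl, subst (2) LT_expansion) (simp add: mat_vec_sum_left vec.scale_sum_right vector_smult_assoc)
  finally show ?thesis .
qed

text \<open>An eigenspinor has coefficients on the finite set \<open>U \<mu>\<close> only, so
  completeness identifies it with a finite trigonometric sum. The conditions in \<open>W\<close> are
  the eigenvalue equation and the equivariance under \<gamma>, read coefficient by
  coefficient.\<close>

lemma Eig_eq: "Eig \<mu> = Phi \<mu> ` W \<mu>"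
proof (intro Set.equalityI subsetI)
  fix \<psi> assume \<psi>: "\<psi> \<in> Eig \<mu>"
  then have sm: "smooth_fun \<psi>" and q: "qp \<psi>" and ga: "\<And>x. \<psi> (gamma_p x) = N gamma_p *v \<psi> x"
    by (auto simp: eigenspinors_def twisted_spinors_iff)
  define w where "w = (\<lambda>u. if u \<in> U \<mu> then four \<psi> u else 0)"
  have supp: "four \<psi> u = 0" if "u \<in> Lam" "u \<notin> U \<mu>" for u
    using LT_eigen_norm[OF four_eigen[OF \<psi> that(1)]] that by (auto simp: U_def)
  have cPhi: "continuous_on UNIV (Phi \<mu> w)" by (rule smooth_funD(2)[OF smooth_Phi])
  have c\<psi>: "continuous_on UNIV \<psi>" by (rule smooth_funD(2)[OF sm])
  have "\<psi> x - Phi \<mu> w x = 0" for x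
  proof (rule four_complete[where \<psi> = "\<lambda>x. \<psi> x - Phi \<mu> w x"])
    show "continuous_on UNIV (\<lambda>x. \<psi> x - Phi \<mu> w x)" by (intro continuous_on_diff c\<psi> cPhi)
    show "qp (\<lambda>x. \<psi> x - Phi \<mu> w x)" using q qp_Phi[of \<mu> w] by (simp add: qp_def vec.scale_right_diff_distrib)
    fix u assume u: "u \<in> Lam"
    have "four (\<lambda>x. \<psi> x - Phi \<mu> w x) u = four \<psi> u - four (Phi \<mu> w) u"
      unfolding four_def vec.scale_right_diff_distrib
      by (rule integral_diff) (intro integrable_cont continuous_four c\<psi> cPhi)+
    then show "four (\<lambda>x. \<psi> x - Phi \<mu> w x) u = 0" using supp[OF u] by (simp add: four_Phi[OF u] w_def)
  qed
  then have eq: "\<psi> = Phi \<mu> w" by (simp add: fun_eq_iff)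
  have "w \<in> W \<mu>"
    unfolding W_def
  proof (intro CollectI conjI allI ballI impI)
    show "w u = 0" if "u \<notin> U \<mu>" for u using that by (simp add: w_def)
    show "(2 * pi * \<i>) *s (LT u *v w u) = of_real \<mu> *s w u" if "u \<in> U \<mu>" for u
      using four_eigen[OF \<psi> U_Lam[OF that]] that by (simp add: w_def)
    fix u assume u: "u \<in> U \<mu>"
    \<comment> \<open>The Fourier coefficients of \<psi>(\<gamma> x) - \<open>N gamma_p\<close>
      \<psi>(x), a function that vanishes identically.\<close>
    define v where "v = (\<lambda>u. cis (2 * pi * (u \<bullet> ep) / p) *s w (Crot 1 u) - N gamma_p *v w u)"
    have "Phi \<mu> v x = 0" for x
    proof -
      have "Phi \<mu> v x = Phi \<mu> w (gamma_p x) - N gamma_p *v Phi \<mu> w x"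
        unfolding Phi_gamma Phi_mat unfolding Phi_def v_def by (simp add: vec.scale_right_diff_distrib sum_subtractf)
      then show ?thesis using ga unfolding eq by simp
    qed
    then have "Phi \<mu> v = (\<lambda>x. 0)" by blast
    then have "v u = 0" using four_Phi[OF U_Lam[OF u], of \<mu> v] u by (simp add: four_def)
    then have "cis (- (2 * pi * (u \<bullet> ep) / p)) *s (cis (2 * pi * (u \<bullet> ep) / p) *s w (Crot 1 u)) = cis (- (2 * pi * (u \<bullet> ep) / p)) *s (N gamma_p *v w u)"
      by (simp add: v_def)
    then show "w (Crot 1 u) = cis (- (2 * pi * (u \<bullet> ep) / p)) *s (N gamma_p *v w u)"
      by (simp add: vector_smult_assoc cis_mult)
  qed
  then show "\<psi> \<in> Phi \<mu> ` W \<mu>" using eq by blast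
next
  fix \<psi> assume "\<psi> \<in> Phi \<mu> ` W \<mu>"
  then obtain w where w: "w \<in> W \<mu>" and eq: "\<psi> = Phi \<mu> w" by blast
  have "Phi \<mu> w (gamma_p x) = N gamma_p *v Phi \<mu> w x" for x
    unfolding Phi_gamma Phi_mat
  proof (rule sum.cong[OF refl])
    fix u assume "u \<in> U \<mu>"
    then have "w (Crot 1 u) = cis (- (2 * pi * (u \<bullet> ep) / p)) *s (N gamma_p *v w u)" using w by (simp add: W_def)
    then show "chr u x *s (cis (2 * pi * (u \<bullet> ep) / p) *s w (Crot 1 u)) = chr u x *s (N gamma_p *v w u)"
      by (simp add: vector_smult_assoc cis_mult mult.assoc)
  qed
  moreover have "dirac L (Phi \<mu> w) x = of_real \<mu> *s Phi \<mu> w x" for x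
    unfolding dirac_Phi Phi_smult using w by (intro sum.cong refl) (simp add: W_def)
  ultimately show "\<psi> \<in> Eig \<mu>"
    unfolding eq eigenspinors_def twisted_spinors_iff using smooth_Phi qp_Phi by simp
qed

lemma subspace_W: "fun_cvs.subspace (W \<mu>)"
proof (rule fun_cvs.subspaceI)
  show "0 \<in> W \<mu>" by (simp add: W_def)
  show "x + y \<in> W \<mu>" if "x \<in> W \<mu>" "y \<in> W \<mu>" for x y
    using that by (simp add: W_def matrix_vector_right_distrib vector_add_ldistrib)
  show "(\<lambda>u. c *s w u) \<in> W \<mu>" if w: "w \<in> W \<mu>" for c w
    unfolding W_def
  proof (intro CollectI conjI allI ballI impI)
    show "c *s w u = 0" if "u \<notin> U \<mu>" for u using w that by (simp add: W_def)
    fix u assume u: "u \<in> U \<mu>"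
    have "(2 * pi * \<i>) *s (LT u *v (c *s w u)) = c *s ((2 * pi * \<i>) *s (LT u *v w u))"
      by (simp add: vector_scalar_commute vector_smult_assoc mult_ac)
    also have "(2 * pi * \<i>) *s (LT u *v w u) = of_real \<mu> *s w u" using w u unfolding W_def by blast
    finally show "(2 * pi * \<i>) *s (LT u *v (c *s w u)) = of_real \<mu> *s (c *s w u)"
      by (simp add: vector_smult_assoc mult.commute)
    have "w (Crot 1 u) = cis (- (2 * pi * (u \<bullet> ep) / p)) *s (N gamma_p *v w u)" using w u unfolding W_def by blast
    then show "c *s w (Crot 1 u) = cis (- (2 * pi * (u \<bullet> ep) / p)) *s (N gamma_p *v (c *s w u))"
      by (simp add: vector_scalar_commute vector_smult_assoc mult.commute)
  qed
qed

lemma dim_Eig: "fun_cdim (Eig \<mu>) = fun_cdim (W \<mu>)"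
  unfolding Eig_eq
proof (rule dim_injective_image[OF _ _ subspace_W])
  show "Phi \<mu> (F + G) = Phi \<mu> F + Phi \<mu> G" for F G
    by (simp add: Phi_def fun_eq_iff vector_add_ldistrib sum.distrib)
  show "Phi \<mu> (\<lambda>x. c *s F x) = (\<lambda>x. c *s Phi \<mu> F x)" for c F
    by (simp add: Phi_smult fun_eq_iff) (simp add: Phi_def)
  fix w assume w: "w \<in> W \<mu>" and z: "Phi \<mu> w = 0"
  have "w u = 0" for u
  proof (cases "u \<in> U \<mu>")
    case True
    then show ?thesis using four_Phi[OF U_Lam[OF True], of \<mu> w] z by (simp add: four_def)
  qed (use w in \<open>simp add: W_def\<close>)
  then show "w = 0" by (simp add: fun_eq_iff)
qed

text \<open>A crude bound; its only purpose is the convergence of the eta series.\<close>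

lemma dim_Eig_le: "fun_cdim (Eig \<mu>) \<le> card (U \<mu>) * CARD('s \<times> 'd)"
  unfolding dim_Eig by (rule dim_supported_le[OF finite_U]) (simp add: W_def)

end

section \<open>Spectral asymmetry\<close>

lemma matrix_vector_axis_component: "(A *v axis a 1) $ a = A $ a $ a" for A :: "complex ^ 'k::finite ^ 'k"
proof -
  have "A $ a $ j * axis a 1 $ j = (if j = a then A $ a $ a else 0)" for j by (simp add: axis_def)
  then show ?thesis by (simp add: matrix_vector_mult_def)
qed

context twisted_dirac
begin

text \<open>Since \<open>(2\<pi>i LT u)\<^sup>2 = \<mu>\<^sup>2\<close> for \<open>u \<in> U \<mu>\<close>, \<open>Sop \<mu>\<close> projects onto the eigenvalue \<open>\<mu>\<close> of \<open>2\<pi>i LT u\<close>. Averaging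
  over the powers of \<open>\<gamma>\<close> turns it into the projection \<open>Q \<mu>\<close> onto \<open>W \<mu>\<close>.\<close>

definition Gm :: "nat \<Rightarrow> 'n rvec \<Rightarrow> complex ^ ('s \<times> 'd) ^ ('s \<times> 'd)" where
  "Gm k u = mat (cis (- (2 * pi * (real k * (u \<bullet> ep)) / p))) ** N (gamma_p ^^ k)"

lemma Gm_vec: "Gm k u *v x = cis (- (2 * pi * (real k * (u \<bullet> ep)) / p)) *s (N (gamma_p ^^ k) *v x)"
  by (simp add: Gm_def mat_vec flip: matrix_vector_mul_assoc)

definition Sop :: "real \<Rightarrow> ('n rvec \<Rightarrow> complex ^ ('s \<times> 'd)) \<Rightarrow> 'n rvec \<Rightarrow> complex ^ ('s \<times> 'd)" where
  "Sop \<mu> w u = (1 / 2) *s (w u + (2 * pi * \<i> / of_real \<mu>) *s (LT u *v w u))"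

definition Q :: "real \<Rightarrow> ('n rvec \<Rightarrow> complex ^ ('s \<times> 'd)) \<Rightarrow> 'n rvec \<Rightarrow> complex ^ ('s \<times> 'd)" where
  "Q \<mu> w u = (if u \<in> U \<mu> then (1 / of_nat p) *s (\<Sum>k<p. Gm k u *v Sop \<mu> w (Crot (- real k) u)) else 0)"

lemma LT_Gm: "LT u *v (Gm k u *v x) = Gm k u *v (LT (Crot (- real k) u) *v x)"
proof -
  have a: "LT u ** N (gamma_p ^^ k) = N (gamma_p ^^ k) ** LT (Crot (- real k) u)"
    using LT_gamma_pow[of k "Crot (- real k) u"] by simp
  have b: "LT u *v (Gm k u *v x) = cis (- (2 * pi * (real k * (u \<bullet> ep)) / p)) *s ((LT u ** N (gamma_p ^^ k)) *v x)"
    by (simp add: Gm_vec vector_scalar_commute matrix_vector_mul_assoc)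
  have "LT u *v (Gm k u *v x) = cis (- (2 * pi * (real k * (u \<bullet> ep)) / p)) *s ((N (gamma_p ^^ k) ** LT (Crot (- real k) u)) *v x)"
    by (simp only: b a)
  also have "\<dots> = Gm k u *v (LT (Crot (- real k) u) *v x)" by (simp only: Gm_vec matrix_vector_mul_assoc[symmetric])
  finally show ?thesis .
qed

lemma Sop_eigen:
  assumes u: "u \<in> U \<mu>" and \<mu>: "\<mu> \<noteq> 0"
  shows "(2 * pi * \<i>) *s (LT u *v Sop \<mu> w u) = of_real \<mu> *s Sop \<mu> w u"
proof -
  define c where "c = 2 * pi * \<i> / of_real \<mu>"
  have "(2 * pi * norm u)\<^sup>2 = \<mu>\<^sup>2" using u by (simp add: U_def)
  then have "of_real ((2 * pi * norm u)\<^sup>2) = (of_real (\<mu>\<^sup>2) :: complex)" by simp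
  then have "c * (c * (- of_real ((norm u)\<^sup>2))) = 1"
    using \<mu> by (simp add: c_def power2_eq_square field_simps)
  moreover have "c *s (LT u *v (c *s (LT u *v x))) = (c * (c * (- of_real ((norm u)\<^sup>2)))) *s x" for x
    by (simp only: vector_scalar_commute vector_smult_assoc matrix_vector_mul_assoc LT_square mat_vec mult.assoc)
  ultimately have cc: "c *s (LT u *v (c *s (LT u *v x))) = x" for x by simp
  have "c *s (LT u *v Sop \<mu> w u) = Sop \<mu> w u"
  proof -
    have S: "Sop \<mu> w u = (1 / 2) *s (w u + c *s (LT u *v w u))" by (simp add: Sop_def c_def)
    have "c *s (LT u *v Sop \<mu> w u) = (1 / 2) *s (c *s (LT u *v w u) + c *s (LT u *v (c *s (LT u *v w u))))"
      unfolding S by (simp add: vector_scalar_commute matrix_vector_right_distrib vector_smult_assoc vector_add_ldistrib mult_ac)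
    then show ?thesis unfolding cc S by (simp only: add.commute)
  qed
  then have "of_real \<mu> *s (c *s (LT u *v Sop \<mu> w u)) = of_real \<mu> *s Sop \<mu> w u" by simp
  then show ?thesis using \<mu> by (simp add: vector_smult_assoc c_def)
qed

text \<open>The p-th power of \<gamma> is translation by \<open>e_p\<close>. Its multiplier exp(2
  \<pi> i h) cancels the phase, because the last coordinate of \<open>v\<close> lies in h + Z. This
  makes the average over p powers consistent.\<close>

lemma Gm_period:
  assumes "v \<in> Lam" shows "Gm p v = mat 1"
proof -
  have "v \<bullet> (D *v ebasis p) - hj p \<in> \<int>" using assms p_pos by (simp add: Lam_def)
  then have "v \<bullet> ep - h \<in> \<int>" by (simp add: D_last hj_def)
  then obtain n where "v \<bullet> ep - h = of_int n" by (rule Ints_cases)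
  then have "2 * pi * (v \<bullet> ep) = 2 * pi * h + 2 * pi * of_int n" by (simp add: algebra_simps)
  moreover have "2 * pi * (real p * (v \<bullet> ep)) / p = 2 * pi * (v \<bullet> ep)" using p_pos by simp
  ultimately have e: "- (2 * pi * (real p * (v \<bullet> ep)) / p) = - (2 * pi * h) + 2 * pi * of_int (- n)"
    by simp
  have "cis (- (2 * pi * (real p * (v \<bullet> ep)) / p)) * cis (2 * pi * h) = 1"
  proof -
    have "cis (2 * pi * of_int (- n)) = 1" by (rule cis_multiple_2pi) simp
    then show ?thesis unfolding e cis_mult[symmetric] by (simp add: cis_mult)
  qed
  then show ?thesis by (simp add: Gm_def N_gamma_p mat_mult_mat)
qed

lemma Gm_0: "Gm 0 v = mat 1"
  by (simp add: Gm_def N_id[unfolded id_def] N_id)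

lemma Gm_Suc:
  "Gm (Suc k) v *v x = cis (- (2 * pi * (v \<bullet> ep) / p)) *s (N gamma_p *v (Gm k v *v x))"
proof -
  have S: "N (gamma_p ^^ Suc k) = N gamma_p ** N (gamma_p ^^ k)"
    unfolding funpow.simps by (rule N_mult[OF Gamma_gamma Gamma_gamma_pow])
  have "- (2 * pi * (real (Suc k) * (v \<bullet> ep)) / p) = - (2 * pi * (v \<bullet> ep) / p) + - (2 * pi * (real k * (v \<bullet> ep)) / p)"
    using p_pos by (simp add: field_simps)
  then show ?thesis unfolding Gm_vec S by (simp only: cis_mult[symmetric])
      (simp add: vector_scalar_commute vector_smult_assoc flip: matrix_vector_mul_assoc)
qed

lemma Gm_cong: "u \<bullet> ep = v \<bullet> ep \<Longrightarrow> Gm k u = Gm k v"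
  by (simp add: Gm_def)

lemma Q_W:
  assumes \<mu>: "\<mu> \<noteq> 0" shows "Q \<mu> w \<in> W \<mu>"
  unfolding W_def
proof (intro CollectI conjI allI ballI impI)
  show "Q \<mu> w u = 0" if "u \<notin> U \<mu>" for u using that by (simp add: Q_def)
  fix u assume u: "u \<in> U \<mu>"
  have "(2 * pi * \<i>) *s (LT u *v Q \<mu> w u)
     = (1 / of_nat p) *s (\<Sum>k<p. Gm k u *v ((2 * pi * \<i>) *s (LT (Crot (- real k) u) *v Sop \<mu> w (Crot (- real k) u))))"
    using u by (simp add: Q_def vector_scalar_commute vec.sum LT_Gm vec.scale_sum_right vector_smult_assoc mult_ac)
  also have "\<dots> = of_real \<mu> *s Q \<mu> w u"
    using u Sop_eigen[OF Crot_U(2)[OF u] \<mu>]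
    by (simp add: Q_def vector_scalar_commute vec.scale_sum_right vector_smult_assoc mult_ac)
  finally show "(2 * pi * \<i>) *s (LT u *v Q \<mu> w u) = of_real \<mu> *s Q \<mu> w u" .
  \<comment> \<open>These are the summands of the average at C u. The summand k + 1 is \<gamma>
    applied to the summand k at u, and g p = g 0, so shifting the index leaves the cyclic sum
    unchanged.\<close>
  define g where "g = (\<lambda>k. Gm k (Crot 1 u) *v Sop \<mu> w (Crot (- real k) (Crot 1 u)))"
  have gS: "g (Suc k) = cis (- (2 * pi * (u \<bullet> ep) / p)) *s (N gamma_p *v (Gm k u *v Sop \<mu> w (Crot (- real k) u)))" for k
  proof -
    have "Crot (- real (Suc k)) (Crot 1 u) = Crot (- real k) u" by (simp add: Crot_add)
    moreover have "Gm k (Crot 1 u) = Gm k u" by (rule Gm_cong) simp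
    ultimately show ?thesis unfolding g_def Gm_Suc by (simp only: Crot_last)
  qed
  have "Crot (- real p) (Crot 1 u) = Crot 1 u"
    by (metis Crot_p Crot_inverse(1))
  then have "g p = g 0"
    unfolding g_def using Gm_period[OF U_Lam[OF Crot_1_U(1)[OF u]]] by (simp add: Gm_0)
  then have "(\<Sum>k<p. g k) = (\<Sum>k<p. g (Suc k))"
    using sum.lessThan_Suc_shift[of g p] by simp
  then have "Q \<mu> w (Crot 1 u) = (1 / of_nat p) *s (\<Sum>k<p. g (Suc k))"
    using Crot_1_U(1)[OF u] by (simp add: Q_def g_def)
  also have "\<dots> = cis (- (2 * pi * (u \<bullet> ep) / p)) *s (N gamma_p *v Q \<mu> w u)"
    unfolding gS using u by (simp add: Q_def vec.sum vector_scalar_commute vec.scale_sum_right vector_smult_assoc mult_ac)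
  finally show "Q \<mu> w (Crot 1 u) = cis (- (2 * pi * (u \<bullet> ep) / p)) *s (N gamma_p *v Q \<mu> w u)" .
qed

lemma Q_fix:
  assumes \<mu>: "\<mu> \<noteq> 0" and w: "w \<in> W \<mu>" shows "Q \<mu> w = w"
proof
  fix u
  have S: "Sop \<mu> w v = w v" if v: "v \<in> U \<mu>" for v
  proof -
    have "(2 * pi * \<i>) *s (LT v *v w v) = of_real \<mu> *s w v" using w v unfolding W_def by blast
    then have "(1 / of_real \<mu>) *s ((2 * pi * \<i>) *s (LT v *v w v)) = (1 / of_real \<mu>) *s (of_real \<mu> *s w v)" by simp
    then have e: "(2 * pi * \<i> / of_real \<mu>) *s (LT v *v w v) = w v" using \<mu> by (simp add: vector_smult_assoc)
    show ?thesis unfolding Sop_def e by (simp add: vec_eq_iff)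
  qed
  have Gw: "w (Crot (real k) v) = Gm k v *v w v" if v: "v \<in> U \<mu>" for k v
  proof (induction k)
    case (Suc k)
    have "w (Crot (real (Suc k)) v) = w (Crot 1 (Crot (real k) v))" by (simp add: Crot_add add.commute)
    also have "\<dots> = cis (- (2 * pi * (Crot (real k) v \<bullet> ep) / p)) *s (N gamma_p *v w (Crot (real k) v))"
      using w Crot_U(1)[OF v] unfolding W_def by blast
    finally show ?case unfolding Suc Gm_Suc by simp
  qed (simp add: Gm_0)
  show "Q \<mu> w u = w u"
  proof (cases "u \<in> U \<mu>")
    case True
    have "Gm k u *v Sop \<mu> w (Crot (- real k) u) = w u" for k
    proof -
      have v: "Crot (- real k) u \<in> U \<mu>" by (rule Crot_U(2)[OF True])
      have "Gm k u = Gm k (Crot (- real k) u)" by (rule Gm_cong) simp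
      then show ?thesis using Gw[OF v, of k] S[OF v] by simp
    qed
    then have "Q \<mu> w u = (1 / of_nat p) *s (\<Sum>k<p. w u)" using True by (simp only: Q_def if_True)
    moreover have "(\<Sum>k<p. w u) $ i = of_nat p * (w u $ i)" for i by (subst sum_component) simp
    ultimately show ?thesis using p_pos by (simp add: vec_eq_iff del: sum_constant)
  qed (use w in \<open>simp add: Q_def W_def\<close>)
qed

lemma Sop_add: "Sop \<mu> (F + G) u = Sop \<mu> F u + Sop \<mu> G u"
  by (simp add: Sop_def matrix_vector_right_distrib vector_add_ldistrib)

lemma Sop_smult: "Sop \<mu> (\<lambda>x. c *s F x) u = c *s Sop \<mu> F u"
  by (simp add: Sop_def vector_scalar_commute vector_add_ldistrib vector_smult_assoc mult_ac)

text \<open>Trace of the projection \<open>Q \<mu>\<close>. The k-th summand moves the coefficient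
  at the inverse image of u under C^k to u, so it meets the diagonal only where C^k fixes u.\<close>

lemma dim_W:
  assumes \<mu>: "\<mu> \<noteq> 0"
  shows "of_nat (fun_cdim (W \<mu>)) = (1 / of_nat p) * (\<Sum>k<p. \<Sum>u\<in>{u\<in>U \<mu>. Crot (- real k) u = u}.
     (1 / 2) * (trace (Gm k u) + (2 * pi * \<i> / of_real \<mu>) * trace (Gm k u ** LT u)))"
proof -
  let ?c = "2 * pi * \<i> / complex_of_real \<mu>"
  have "of_nat (fun_cdim (W \<mu>)) = (\<Sum>u\<in>U \<mu>. \<Sum>a\<in>UNIV. Q \<mu> (unit_fun u a) u $ a)"
  proof (rule dim_range_projection[OF finite_U _ _ subspace_W])
    show "Q \<mu> (F + G) = Q \<mu> F + Q \<mu> G" for F G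
      by (rule ext) (simp add: Q_def Sop_add matrix_vector_right_distrib sum.distrib vector_add_ldistrib)
    show "Q \<mu> (\<lambda>x. c *s F x) = (\<lambda>x. c *s Q \<mu> F x)" for c F
      by (rule ext) (simp add: Q_def Sop_smult vector_scalar_commute vec.scale_sum_right vector_smult_assoc mult_ac)
    show "F x = 0" if "F \<in> W \<mu>" "x \<notin> U \<mu>" for F x using that by (simp add: W_def)
  qed (use Q_W Q_fix \<mu> in auto)
  also have "\<dots> = (\<Sum>u\<in>U \<mu>. (1 / of_nat p) * (\<Sum>k<p. if Crot (- real k) u = u then
     (1 / 2) * (trace (Gm k u) + ?c * trace (Gm k u ** LT u)) else 0))"
  proof (rule sum.cong[OF refl])
    fix u assume u: "u \<in> U \<mu>"
    have S: "Sop \<mu> (unit_fun u a) v = (if v = u then (1 / 2) *s (axis a 1 + ?c *s (LT u *v axis a 1)) else 0)" for v a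
      by (simp add: Sop_def unit_fun_def)
    have T: "(\<Sum>a\<in>UNIV. (Gm k u *v ((1 / 2) *s (axis a 1 + ?c *s (LT u *v axis a 1)))) $ a)
       = (1 / 2) * (trace (Gm k u) + ?c * trace (Gm k u ** LT u))" for k
    proof -
      have "(Gm k u *v ((1 / 2) *s (axis a 1 + ?c *s (LT u *v axis a 1)))) $ a
         = (1 / 2) * (Gm k u $ a $ a + ?c * (Gm k u ** LT u) $ a $ a)" for a
        by (simp add: vector_scalar_commute matrix_vector_right_distrib matrix_vector_mul_assoc matrix_vector_axis_component)
      then have "(\<Sum>a\<in>UNIV. (Gm k u *v ((1 / 2) *s (axis a 1 + ?c *s (LT u *v axis a 1)))) $ a)
         = (\<Sum>a\<in>UNIV. (1 / 2) * (Gm k u $ a $ a + ?c * (Gm k u ** LT u) $ a $ a))" by (rule sum.cong[OF refl])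
      then show ?thesis unfolding trace_def sum_distrib_left[symmetric] sum.distrib .
    qed
    have "(\<Sum>a\<in>UNIV. Q \<mu> (unit_fun u a) u $ a)
       = (\<Sum>a\<in>UNIV. (1 / of_nat p) * (\<Sum>k<p. if Crot (- real k) u = u then (Gm k u *v ((1 / 2) *s (axis a 1 + ?c *s (LT u *v axis a 1)))) $ a else 0))"
    proof (rule sum.cong[OF refl])
      fix a
      have eq: "Q \<mu> (unit_fun u a) u $ a = (1 / of_nat p) * (\<Sum>k<p. (Gm k u *v Sop \<mu> (unit_fun u a) (Crot (- real k) u)) $ a)"
        using u by (simp add: Q_def sum_component)
      have "(Gm k u *v Sop \<mu> (unit_fun u a) (Crot (- real k) u)) $ a
         = (if Crot (- real k) u = u then (Gm k u *v ((1 / 2) *s (axis a 1 + ?c *s (LT u *v axis a 1)))) $ a else 0)" for k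
        unfolding S by simp
      then show "Q \<mu> (unit_fun u a) u $ a = (1 / of_nat p) * (\<Sum>k<p. if Crot (- real k) u = u then (Gm k u *v ((1 / 2) *s (axis a 1 + ?c *s (LT u *v axis a 1)))) $ a else 0)"
        unfolding eq by (simp only:)
    qed
    also have "\<dots> = (1 / of_nat p) * (\<Sum>k<p. \<Sum>a\<in>UNIV. if Crot (- real k) u = u then (Gm k u *v ((1 / 2) *s (axis a 1 + ?c *s (LT u *v axis a 1)))) $ a else 0)"
      unfolding sum_distrib_left[symmetric] by (subst sum.swap) (rule refl)
    also have "\<dots> = (1 / of_nat p) * (\<Sum>k<p. if Crot (- real k) u = u then (1 / 2) * (trace (Gm k u) + ?c * trace (Gm k u ** LT u)) else 0)"
      unfolding T[symmetric] by (intro arg_cong[where f = "\<lambda>x. _ * x"] sum.cong refl) simp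
    finally show "(\<Sum>a\<in>UNIV. Q \<mu> (unit_fun u a) u $ a)
       = (1 / of_nat p) * (\<Sum>k<p. if Crot (- real k) u = u then (1 / 2) * (trace (Gm k u) + ?c * trace (Gm k u ** LT u)) else 0)" .
  qed
  also have "\<dots> = (1 / of_nat p) * (\<Sum>k<p. \<Sum>u\<in>U \<mu>. if Crot (- real k) u = u then
     (1 / 2) * (trace (Gm k u) + ?c * trace (Gm k u ** LT u)) else 0)"
    unfolding sum_distrib_left[symmetric] by (subst sum.swap) (rule refl)
  finally show ?thesis by (simp only: sum.inter_filter[OF finite_U])
qed

text \<open>Subtracting \<open>dim_W\<close> for \<mu> and -\<mu> removes the traces of
  \<open>Gm k u\<close> and doubles the others. The power k = 0 drops out since L(u) is traceless.
  For the other powers only the two points \<plusminus>\<nu> \<open>e_p\<close> remain, and their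
  opposite phases combine to a sine.\<close>

lemma dim_asymmetry:
  assumes \<nu>: "\<nu> > 0"
  shows "complex_of_nat (fun_cdim (Eig (2 * pi * \<nu>))) - of_nat (fun_cdim (Eig (- (2 * pi * \<nu>))))
    = (if \<nu> - h \<in> \<int> then (2 / of_nat p) * (\<Sum>k=1..p-1. of_real (sin (2 * pi * real k * \<nu> / p)) * trace (N (gamma_p ^^ k) ** LT ep)) else 0)"
proof -
  define \<mu> where "\<mu> = 2 * pi * \<nu>"
  have \<mu>: "\<mu> \<noteq> 0" "- \<mu> \<noteq> 0" using \<nu> by (simp_all add: \<mu>_def)
  let ?c = "2 * pi * \<i> / complex_of_real \<mu>"
  let ?F = "\<lambda>k. {u\<in>U \<mu>. Crot (- real k) u = u}"
  have "complex_of_nat (fun_cdim (Eig \<mu>)) - of_nat (fun_cdim (Eig (- \<mu>)))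
    = (1 / of_nat p) * (\<Sum>k<p. \<Sum>u\<in>?F k. ?c * trace (Gm k u ** LT u))"
    unfolding dim_Eig dim_W[OF \<mu>(1)] dim_W[OF \<mu>(2)] U_minus right_diff_distrib[symmetric] sum_subtractf[symmetric]
    by (intro arg_cong[where f = "\<lambda>x. _ * x"] sum.cong refl) (simp add: algebra_simps)
  also have "(\<Sum>k<p. \<Sum>u\<in>?F k. ?c * trace (Gm k u ** LT u)) = (\<Sum>k=1..p-1. \<Sum>u\<in>?F k. ?c * trace (Gm k u ** LT u))"
  proof (rule sum.mono_neutral_right)
    show "\<forall>k\<in>{..<p} - {1..p-1}. (\<Sum>u\<in>?F k. ?c * trace (Gm k u ** LT u)) = 0"
    proof
      fix k assume "k \<in> {..<p} - {1..p-1}"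
      then have "k = 0" by auto
      then show "(\<Sum>u\<in>?F k. ?c * trace (Gm k u ** LT u)) = 0" by (simp add: Gm_0 trace_LT)
    qed
  qed (use p_pos in auto)
  also have "\<dots> = (if \<nu> - h \<in> \<int> then 2 * (\<Sum>k=1..p-1. of_real (sin (2 * pi * real k * \<nu> / p)) * trace (N (gamma_p ^^ k) ** LT ep)) else 0)"
  proof -
    have sub: "?F k \<subseteq> {\<nu> *\<^sub>R ep, (- \<nu>) *\<^sub>R ep}" if k: "k \<in> {1..p-1}" for k
    proof
      fix u assume "u \<in> ?F k"
      then have u: "u \<in> U \<mu>" and e: "u = (u \<bullet> ep) *\<^sub>R ep" using Crot_fixed[OF k] by auto
      have "2 * pi * norm u = 2 * pi * \<nu>" using u \<nu> by (simp add: U_def \<mu>_def)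
      then have "norm u = \<nu>" by simp
      moreover have "norm u = \<bar>u \<bullet> ep\<bar>" by (subst e) simp
      ultimately have "u \<bullet> ep = \<nu> \<or> u \<bullet> ep = - \<nu>" by linarith
      moreover have "u = c *\<^sub>R ep" if "u \<bullet> ep = c" for c using e unfolding that .
      ultimately show "u \<in> {\<nu> *\<^sub>R ep, (- \<nu>) *\<^sub>R ep}" by blast
    qed
    have mem: "c *\<^sub>R ep \<in> ?F k \<longleftrightarrow> c - h \<in> \<int>" if "c = \<nu> \<or> c = - \<nu>" for c k
      using that \<nu> by (auto simp: U_def ep_Lam \<mu>_def linear_scale[OF linear_Crot])
    \<comment> \<open>Since 2 h is an integer, the two points of the axis lie in the shifted lattice
      together or not at all.\<close>
    have sym: "- \<nu> - h \<in> \<int> \<longleftrightarrow> \<nu> - h \<in> \<int>"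
    proof -
      have "- \<nu> - h = - (\<nu> - h) - 2 * h" "\<nu> - h = - (- \<nu> - h) - 2 * h" by simp_all
      then show ?thesis using two_h_int Ints_minus Ints_diff by metis
    qed
    show ?thesis
    proof (cases "\<nu> - h \<in> \<int>")
      case False
      then have F: "?F k = {}" if "k \<in> {1..p-1}" for k
        using sub[OF that] mem[of \<nu> k] mem[of "- \<nu>" k] sym by blast
      have "(\<Sum>k=1..p-1. \<Sum>u\<in>?F k. ?c * trace (Gm k u ** LT u)) = 0"
        by (rule sum.neutral, rule ballI) (simp only: F sum.empty)
      then show ?thesis using False by (simp only: if_False)
    next
      case True
      have F: "?F k = {\<nu> *\<^sub>R ep, (- \<nu>) *\<^sub>R ep}" if "k \<in> {1..p-1}" for k
        using sub[OF that] mem[of \<nu> k] mem[of "- \<nu>" k] sym True by blast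
      have ne: "\<nu> *\<^sub>R ep \<noteq> (- \<nu>) *\<^sub>R ep"
      proof
        assume "\<nu> *\<^sub>R ep = (- \<nu>) *\<^sub>R ep"
        from arg_cong[OF this, of "\<lambda>x. x \<bullet> ep"] show False using \<nu> by simp
      qed
      have tr: "trace (Gm k (c *\<^sub>R ep) ** LT (c *\<^sub>R ep)) = of_real c * cis (- (2 * pi * real k * c / p)) * trace (N (gamma_p ^^ k) ** LT ep)" for k c
      proof -
        have "Gm k (c *\<^sub>R ep) ** LT (c *\<^sub>R ep) = c *\<^sub>R (mat (cis (- (2 * pi * real k * c / p))) ** (N (gamma_p ^^ k) ** LT ep))"
          by (simp add: Gm_def LT_scale matrix_mul_assoc mult.assoc matrix_scalar_ac flip: scalar_matrix_assoc)
        then show ?thesis by (simp add: trace_scaleR trace_mat_mult)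
      qed
      have "(\<Sum>u\<in>?F k. ?c * trace (Gm k u ** LT u)) = 2 * (of_real (sin (2 * pi * real k * \<nu> / p)) * trace (N (gamma_p ^^ k) ** LT ep))"
        if k: "k \<in> {1..p-1}" for k
      proof -
        let ?x = "2 * pi * real k * \<nu> / p" and ?t = "trace (N (gamma_p ^^ k) ** LT ep)"
        have c\<nu>: "?c * of_real \<nu> = \<i>" using \<nu> by (simp add: \<mu>_def)
        have cs: "cis (- ?x) - cis ?x = - 2 * \<i> * of_real (sin ?x)" by (simp add: complex_eq_iff)
        have "(\<Sum>u\<in>?F k. ?c * trace (Gm k u ** LT u))
           = ?c * trace (Gm k (\<nu> *\<^sub>R ep) ** LT (\<nu> *\<^sub>R ep)) + ?c * trace (Gm k ((- \<nu>) *\<^sub>R ep) ** LT ((- \<nu>) *\<^sub>R ep))"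
          unfolding F[OF k] using ne by (subst sum.insert) auto
        also have "\<dots> = (?c * of_real \<nu>) * (cis (- ?x) - cis ?x) * ?t"
          unfolding tr by (simp add: algebra_simps)
        also have "\<dots> = 2 * (of_real (sin ?x) * ?t)" unfolding c\<nu> cs by simp
        finally show ?thesis .
      qed
      then have "(\<Sum>k=1..p-1. \<Sum>u\<in>?F k. ?c * trace (Gm k u ** LT u))
         = (\<Sum>k=1..p-1. 2 * (of_real (sin (2 * pi * real k * \<nu> / p)) * trace (N (gamma_p ^^ k) ** LT ep)))"
        by (rule sum.cong[OF refl])
      then show ?thesis using True by (simp add: sum_distrib_left)
    qed
  qed
  finally show ?thesis by (simp add: \<mu>_def)
qed

end

section \<open>The eta series\<close>

lemma summable_int_powr:
  assumes a: "a > 1"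
  shows "(\<lambda>n::int. (1 + \<bar>real_of_int n\<bar>) powr (- a)) summable_on UNIV"
proof -
  let ?g = "\<lambda>n::int. (1 + \<bar>real_of_int n\<bar>) powr (- a)"
  have s: "summable (\<lambda>j. (1 + real j) powr (- a))"
    using summable_nat_powr[of "- a"] a summable_iff_shift[of "\<lambda>j. real j powr (- a)" 1] by (simp add: add.commute)
  then have n: "(\<lambda>j. (1 + real j) powr (- a)) summable_on UNIV" by (subst summable_on_UNIV_nonneg_real_iff) auto
  have inj1: "inj int" and inj2: "inj (\<lambda>j. - int j)" by (auto simp: inj_on_def)
  have 1: "?g summable_on range int" using n by (subst summable_on_reindex[OF inj1]) (simp add: o_def)
  have 2: "?g summable_on range (\<lambda>j. - int j)" using n by (subst summable_on_reindex[OF inj2]) (simp add: o_def)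
  have 3: "?g summable_on (range (\<lambda>j. - int j) - range int)" by (rule summable_on_subset_banach[OF 2]) auto
  have "UNIV = range int \<union> (range (\<lambda>j. - int j) - range int)"
  proof -
    have "x \<in> range int \<or> x \<in> range (\<lambda>j. - int j)" for x
    proof (cases "x \<ge> 0")
      case True
      then have "x = int (nat x)" by simp
      then show ?thesis by blast
    next
      case False
      then have "x = - int (nat (- x))" by simp
      then show ?thesis by blast
    qed
    then show ?thesis by blast
  qed
  then show ?thesis using summable_on_Un_disjoint[OF 1 3] by auto
qed

text \<open>Majorant for sums over the p-dimensional lattice: the exponent is distributed evenly
  over the coordinates, each of which gives a convergent one-dimensional sum.\<close>

lemma summable_prod_int_powr:
  assumes a: "a > 1"
  shows "(\<lambda>f::'n::finite \<Rightarrow> int. \<Prod>k\<in>UNIV. (1 + \<bar>real_of_int (f k)\<bar>) powr (- a)) summable_on UNIV"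
proof -
  let ?w = "\<lambda>(k::'n) (n::int). (1 + \<bar>real_of_int n\<bar>) powr (- a)"
  have "Infinite_Set_Sum.abs_summable_on (?w k) UNIV" for k
    using summable_int_powr[OF a] unfolding abs_summable_equivalent[symmetric] by simp
  then have "Infinite_Set_Sum.abs_summable_on (\<lambda>f. \<Prod>k\<in>UNIV. ?w k (f k)) (PiE UNIV (\<lambda>_. UNIV))"
    by (intro abs_summable_on_prod_PiE) auto
  then show ?thesis
    unfolding abs_summable_equivalent[symmetric] by (simp add: abs_prod)
qed

lemma norm_of_real_powr: "x > 0 \<Longrightarrow> norm (complex_of_real x powr s) = x powr Re s"
  using norm_powr_real_powr[of "complex_of_real x" s] by simp

lemma analytic_on_real_powr: "x > 0 \<Longrightarrow> (\<lambda>s. complex_of_real x powr (- s)) analytic_on A"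
  unfolding powr_def by (simp, intro analytic_intros)

lemma sin_plus_2pi_int: "sin (x + of_int n * (2 * pi)) = sin (x :: real)"
  and cos_plus_2pi_int: "cos (x + of_int n * (2 * pi)) = cos (x :: real)"
  by (simp_all add: sin_add cos_add mult.commute[of _ "2 * pi"] sin_int_2pin cos_int_2pin del: mult.assoc)

text \<open>Multiplication by 2 sin(\<theta>/2) makes the sum telescope, and its two ends differ by
  a multiple of 2 \<pi>.\<close>

lemma sum_cos_progression:
  assumes s: "sin (\<theta> / 2) \<noteq> 0" and per: "real p * \<theta> = 2 * pi * of_int n"
  shows "(\<Sum>l<p. cos ((real l + b) * \<theta>)) = 0"
proof -
  have "2 * sin (\<theta> / 2) * (\<Sum>l<p. cos ((real l + b) * \<theta>)) = (\<Sum>l<p. sin ((real (Suc l) + b - 1/2) * \<theta>) - sin ((real l + b - 1/2) * \<theta>))"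
    unfolding sum_distrib_left
  proof (rule sum.cong[OF refl])
    fix l
    have "(real (Suc l) + b - 1/2) * \<theta> = (real l + b) * \<theta> + \<theta> / 2" "(real l + b - 1/2) * \<theta> = (real l + b) * \<theta> - \<theta> / 2"
      by (simp_all add: algebra_simps)
    then show "2 * sin (\<theta> / 2) * cos ((real l + b) * \<theta>) = sin ((real (Suc l) + b - 1/2) * \<theta>) - sin ((real l + b - 1/2) * \<theta>)"
      by (simp only: sin_add sin_diff) simp
  qed
  also have "\<dots> = sin ((real p + b - 1/2) * \<theta>) - sin ((real 0 + b - 1/2) * \<theta>)"
    by (rule sum_lessThan_telescope)
  also have "(real p + b - 1/2) * \<theta> = (b - 1/2) * \<theta> + of_int n * (2 * pi)"
    using per by (simp add: algebra_simps)
  also have "sin \<dots> - sin ((real 0 + b - 1/2) * \<theta>) = 0"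
    by (simp add: sin_plus_2pi_int)
  finally show ?thesis using s by simp
qed

text \<open>Abel summation, with the sine written as a difference of consecutive cosines.\<close>

lemma sum_sin_sawtooth:
  fixes p :: nat
  assumes p: "p > 0" and s: "sin (\<theta> / 2) \<noteq> 0" and per: "real p * \<theta> = 2 * pi * of_int n"
  shows "(\<Sum>l<p. sin ((real l + h) * \<theta>) * (1 / 2 - (real l + h) / real p)) = cos ((h - 1 / 2) * \<theta>) / (2 * sin (\<theta> / 2))"
proof -
  define c where "c = (\<lambda>l. cos ((real l + h - 1/2) * \<theta>))"
  define a where "a = (\<lambda>l. 1 / 2 - (real l + h) / real p)"
  have S: "(\<Sum>l<N. (c l - c (Suc l)) * a l) = c 0 * a 0 - c N * a N - (1 / real p) * (\<Sum>l<N. c (Suc l))" for N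
  proof (induction N)
    case (Suc N)
    have "a N = a (Suc N) + 1 / real p" by (simp add: a_def add_divide_distrib)
    then have "(c N - c (Suc N)) * a N = c N * a N - c (Suc N) * a (Suc N) - (1 / real p) * c (Suc N)"
      by (simp add: algebra_simps)
    then show ?case unfolding sum.lessThan_Suc Suc distrib_left by linarith
  qed simp
  have z: "(\<Sum>l<p. c (Suc l)) = 0"
    using sum_cos_progression[OF s per, of "h + 1/2"] by (simp add: c_def algebra_simps)
  have cp: "c p = c 0"
  proof -
    have "(real p + h - 1/2) * \<theta> = (h - 1/2) * \<theta> + of_int n * (2 * pi)"
      using per by (simp add: algebra_simps)
    then show ?thesis unfolding c_def by (simp only: cos_plus_2pi_int) simp
  qed
  have "2 * sin (\<theta> / 2) * (\<Sum>l<p. sin ((real l + h) * \<theta>) * (1 / 2 - (real l + h) / real p)) = (\<Sum>l<p. (c l - c (Suc l)) * a l)"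
    unfolding sum_distrib_left
  proof (rule sum.cong[OF refl])
    fix l
    have "(real (Suc l) + h - 1/2) * \<theta> = (real l + h) * \<theta> + \<theta> / 2" "(real l + h - 1/2) * \<theta> = (real l + h) * \<theta> - \<theta> / 2"
      by (simp_all add: algebra_simps)
    then have "c l - c (Suc l) = 2 * sin (\<theta> / 2) * sin ((real l + h) * \<theta>)"
      unfolding c_def by (simp only: cos_add cos_diff) simp
    then show "2 * sin (\<theta> / 2) * (sin ((real l + h) * \<theta>) * (1 / 2 - (real l + h) / real p)) = (c l - c (Suc l)) * a l"
      by (simp add: a_def)
  qed
  also have "\<dots> = c 0 * (a 0 - a p)" unfolding S z cp by (simp add: right_diff_distrib)
  also have "a 0 - a p = 1" using p by (simp add: a_def field_simps)
  finally show ?thesis using s by (simp add: c_def field_simps)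
qed

text \<open>Euler's criterion has the odd exponent 2 r + 1, so replacing k by -k flips the sign. The
  sum of the two symbols is divisible by p and at most 2 in absolute value, hence 0.\<close>

lemma Legendre_complement:
  assumes pr: "prime p" and p: "p = 4 * r + 3" and k: "k \<in> {1..p-1}"
  shows "Legendre (int (p - k)) (int p) = - Legendre (int k) (int p)"
proof -
  have m: "(p - 1) div 2 = 2 * r + 1" and p2: "2 < p" using p by auto
  have 1: "[Legendre (int (p - k)) (int p) = int (p - k) ^ (2 * r + 1)] (mod int p)"
    and 2: "[Legendre (int k) (int p) = int k ^ (2 * r + 1)] (mod int p)"
    using euler_criterion[OF pr p2] unfolding m by auto
  have "int (p - k) + int k = int p" using k by auto
  then have "[int (p - k) = - int k] (mod int p)" by (simp add: cong_iff_dvd_diff)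
  then have "[int (p - k) ^ (2 * r + 1) = (- int k) ^ (2 * r + 1)] (mod int p)" by (rule cong_pow)
  also have "(- int k) ^ (2 * r + 1) = - (int k ^ (2 * r + 1))" by simp
  finally have "[Legendre (int (p - k)) (int p) = - (int k ^ (2 * r + 1))] (mod int p)" using 1 cong_trans by blast
  then have "[Legendre (int (p - k)) (int p) + Legendre (int k) (int p) = - (int k ^ (2 * r + 1)) + int k ^ (2 * r + 1)] (mod int p)"
    using 2 by (rule cong_add)
  then have d: "int p dvd Legendre (int (p - k)) (int p) + Legendre (int k) (int p)"
    by (simp add: cong_iff_dvd_diff)
  have "\<bar>Legendre (int (p - k)) (int p)\<bar> \<le> 1" "\<bar>Legendre (int k) (int p)\<bar> \<le> 1" by (simp_all add: Legendre_def)
  then have "\<bar>Legendre (int (p - k)) (int p) + Legendre (int k) (int p)\<bar> < int p" using p2 by linarith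
  then have "Legendre (int (p - k)) (int p) + Legendre (int k) (int p) = 0"
    using d zdvd_imp_le[of "int p" "\<bar>Legendre (int (p - k)) (int p) + Legendre (int k) (int p)\<bar>"] by fastforce
  then show ?thesis by linarith
qed

context twisted_dirac
begin

text \<open>Each integer coordinate of a nonzero u satisfies 1 + |n| \<le> K |u|. Taking the power
  -\<sigma>/p of all p inequalities and multiplying bounds |u|^(-\<sigma>) by the product
  majorant.\<close>

lemma summable_Lam:
  assumes \<sigma>: "\<sigma> > real p"
  shows "(\<lambda>u. norm u powr (- \<sigma>)) summable_on (Lam - {0})"
proof -
  define a where "a = \<sigma> / real p"
  have a: "a > 1" "a * real p = \<sigma>" using \<sigma> p_pos by (simp_all add: a_def field_simps)
  let ?B = "{u \<in> Lam. norm u \<le> 1} - {0}"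
  obtain c where c: "c > 0" "\<And>u. u \<in> Lam - {0} \<Longrightarrow> c \<le> norm u"
  proof -
    have fin: "finite (insert 1 (norm ` ?B))" using finite_Lam_ball[of 1] by simp
    show ?thesis
    proof (rule that[of "Min (insert 1 (norm ` ?B))"])
      show "Min (insert 1 (norm ` ?B)) > 0" using fin by (subst Min_gr_iff) auto
      fix u assume u: "u \<in> Lam - {0}"
      show "Min (insert 1 (norm ` ?B)) \<le> norm u"
      proof (cases "norm u \<le> 1")
        case True
        then have "norm u \<in> insert 1 (norm ` ?B)" using u by auto
        then show ?thesis using fin by (rule Min_le[rotated])
      next
        case False
        have "Min (insert 1 (norm ` ?B)) \<le> 1" using fin by (intro Min_le) auto
        then show ?thesis using False by linarith
      qed
    qed
  qed
  \<comment> \<open>Nonzero frequencies have length at least \<open>c\<close>, so the part 2 / c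
    absorbs both the summand 1 and the rounding error 1 of \<open>nu\<close>.\<close>
  define K where "K = (\<Sum>k\<in>UNIV. norm (D *v axis k 1)) + 2 / c"
  have "(\<Sum>k\<in>UNIV. norm (D *v axis k 1)) \<ge> 0" by (intro sum_nonneg) auto
  then have K: "K > 0" using c(1) by (simp add: K_def add_nonneg_pos)
  let ?g = "\<lambda>f::'n \<Rightarrow> int. \<Prod>k\<in>UNIV. (1 + \<bar>real_of_int (f k)\<bar>) powr (- a)"
  have "?g summable_on (nu ` (Lam - {0}))"
    by (rule summable_on_subset_banach[OF summable_prod_int_powr[OF a(1)]]) auto
  then have "(?g \<circ> nu) summable_on (Lam - {0})"
    by (subst (asm) summable_on_reindex) (auto intro: inj_on_subset[OF inj_nu])
  then have "(\<lambda>u. K powr \<sigma> * (?g \<circ> nu) u) summable_on (Lam - {0})" by (rule summable_on_cmult_right)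
  then show ?thesis
  proof (rule summable_on_comparison_test)
    fix u assume u: "u \<in> Lam - {0}"
    have nz: "norm u > 0" using u by simp
    have le: "1 + \<bar>real_of_int (nu u k)\<bar> \<le> K * norm u" for k
    proof -
      have "2 \<le> (2 / c) * norm u" using c(1) c(2)[OF u] by (simp add: field_simps)
      then show ?thesis using nu_bound[of u k] by (simp add: K_def algebra_simps)
    qed
    have "(K * norm u) powr (- \<sigma>) = (\<Prod>k\<in>(UNIV :: 'n set). (K * norm u) powr (- a))"
    proof -
      have "((K * norm u) powr (- a)) ^ CARD('n) = (K * norm u) powr (- a * real CARD('n))"
        using K nz by (subst powr_powr[symmetric]) (simp add: powr_realpow)
      then show ?thesis using a(2) p(1) by simp
    qed
    also have "\<dots> \<le> ?g (nu u)"
      by (intro prod_mono conjI powr_mono2' le) (use a in auto)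
    finally have "K powr \<sigma> * (K * norm u) powr (- \<sigma>) \<le> K powr \<sigma> * ?g (nu u)" by (intro mult_left_mono) auto
    moreover have "K powr \<sigma> * (K * norm u) powr (- \<sigma>) = norm u powr (- \<sigma>)"
      using K nz by (simp add: powr_mult powr_minus field_simps)
    ultimately show "norm u powr (- \<sigma>) \<le> K powr \<sigma> * (?g \<circ> nu) u" by simp
  qed simp
qed

text \<open>Different positive \<mu> select disjoint spheres of the shifted lattice, so the sum over
  \<mu> regroups a partial sum of \<open>summable_Lam\<close>.\<close>

lemma sum_card_U_bound:
  assumes \<sigma>: "\<sigma> > real p" and F: "finite F" "\<And>\<mu>. \<mu> \<in> F \<Longrightarrow> \<mu> > 0"
  shows "(\<Sum>\<mu>\<in>F. real (card (U \<mu>)) * \<mu> powr (- \<sigma>)) \<le> (2 * pi) powr (- \<sigma>) * infsum (\<lambda>u. norm u powr (- \<sigma>)) (Lam - {0})"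
proof -
  have "real (card (U \<mu>)) * \<mu> powr (- \<sigma>) = (\<Sum>u\<in>U \<mu>. (2 * pi) powr (- \<sigma>) * norm u powr (- \<sigma>))" if "\<mu> \<in> F" for \<mu>
  proof -
    have "(2 * pi) powr (- \<sigma>) * norm u powr (- \<sigma>) = \<mu> powr (- \<sigma>)" if "u \<in> U \<mu>" for u
      using that F(2)[OF \<open>\<mu> \<in> F\<close>] by (simp add: U_def flip: powr_mult)
    then show ?thesis by simp
  qed
  then have "(\<Sum>\<mu>\<in>F. real (card (U \<mu>)) * \<mu> powr (- \<sigma>)) = (\<Sum>\<mu>\<in>F. \<Sum>u\<in>U \<mu>. (2 * pi) powr (- \<sigma>) * norm u powr (- \<sigma>))"
    by (rule sum.cong[OF refl])
  also have "\<dots> = (\<Sum>u\<in>(\<Union>\<mu>\<in>F. U \<mu>). (2 * pi) powr (- \<sigma>) * norm u powr (- \<sigma>))"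
  proof (rule sum.UNION_disjoint[symmetric])
    show "\<forall>\<mu>\<in>F. finite (U \<mu>)" using finite_U by blast
    have "\<mu> = \<nu>" if "\<mu> \<in> F" "\<nu> \<in> F" "u \<in> U \<mu>" "u \<in> U \<nu>" for \<mu> \<nu> u
      using that F(2)[of \<mu>] F(2)[of \<nu>] by (simp add: U_def)
    then show "\<forall>\<mu>\<in>F. \<forall>\<nu>\<in>F. \<mu> \<noteq> \<nu> \<longrightarrow> U \<mu> \<inter> U \<nu> = {}" by blast
  qed (rule F(1))
  also have "\<dots> = (2 * pi) powr (- \<sigma>) * (\<Sum>u\<in>(\<Union>\<mu>\<in>F. U \<mu>). norm u powr (- \<sigma>))" by (simp add: sum_distrib_left)
  also have "\<dots> \<le> (2 * pi) powr (- \<sigma>) * infsum (\<lambda>u. norm u powr (- \<sigma>)) (Lam - {0})"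
  proof (intro mult_left_mono finite_sum_le_infsum summable_Lam \<sigma>)
    show "(\<Union>\<mu>\<in>F. U \<mu>) \<subseteq> Lam - {0}" using F(2) by (force simp: U_def)
  qed (use F finite_U in auto)
  finally show ?thesis .
qed

abbreviation eterm :: "complex \<Rightarrow> real \<Rightarrow> complex" where "eterm s \<mu> \<equiv> eta_term \<Gamma> L \<epsilon> \<rho> s \<mu>"

lemma summable_eterm:
  assumes s: "Re s > real p"
  shows "(\<lambda>\<mu>. norm (eterm s \<mu>)) summable_on {0<..}" "(\<lambda>\<mu>. norm (eterm s (- \<mu>))) summable_on {0<..}"
proof -
  define B where "B = real CARD('s \<times> 'd) * ((2 * pi) powr (- Re s) * infsum (\<lambda>u. norm u powr (- Re s)) (Lam - {0}))"
  have *: "(\<lambda>\<mu>. norm (eterm s (t * \<mu>))) summable_on {0<..}" if t: "t = 1 \<or> t = - 1" for t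
  proof (rule nonneg_bdd_above_summable_on)
    show "bdd_above (sum (\<lambda>\<mu>. norm (eterm s (t * \<mu>))) ` {F. F \<subseteq> {0<..} \<and> finite F})"
    proof (rule bdd_aboveI2[where M = B])
      fix F assume "F \<in> {F. F \<subseteq> {0<..} \<and> finite (F :: real set)}"
      then have F: "finite F" "\<And>\<mu>. \<mu> \<in> F \<Longrightarrow> \<mu> > 0" by auto
      have "(\<Sum>\<mu>\<in>F. norm (eterm s (t * \<mu>))) \<le> (\<Sum>\<mu>\<in>F. real CARD('s \<times> 'd) * (real (card (U \<mu>)) * \<mu> powr (- Re s)))"
      proof (rule sum_mono)
        fix \<mu> assume "\<mu> \<in> F"
        then have \<mu>: "\<mu> > 0" by (rule F(2))
        have Ut: "U (t * \<mu>) = U \<mu>" using t U_minus by auto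
        have "norm (eterm s (t * \<mu>)) = real (fun_cdim (Eig (t * \<mu>))) * \<mu> powr (- Re s)"
          using t \<mu> by (auto simp: eta_term_def norm_mult norm_of_real_powr)
        also have "\<dots> \<le> real (card (U (t * \<mu>)) * CARD('s \<times> 'd)) * \<mu> powr (- Re s)"
          by (intro mult_right_mono of_nat_mono dim_Eig_le) auto
        finally show "norm (eterm s (t * \<mu>)) \<le> real CARD('s \<times> 'd) * (real (card (U \<mu>)) * \<mu> powr (- Re s))"
          unfolding Ut by (simp add: mult_ac)
      qed
      also have "\<dots> \<le> B"
        unfolding B_def sum_distrib_left[symmetric] by (intro mult_left_mono sum_card_U_bound s F) auto
      finally show "(\<Sum>\<mu>\<in>F. norm (eterm s (t * \<mu>))) \<le> B" .
    qed
  qed auto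
  from *[of 1] *[of "- 1"] show "(\<lambda>\<mu>. norm (eterm s \<mu>)) summable_on {0<..}" "(\<lambda>\<mu>. norm (eterm s (- \<mu>))) summable_on {0<..}"
    by simp_all
qed

text \<open>This lets the eta series run over all nonzero reals, a set independent of the spectrum
  and symmetric about 0.\<close>

lemma eterm_not_eigenvalue:
  assumes "\<mu> \<notin> eigenvalues \<Gamma> L \<epsilon> \<rho>" shows "eterm s \<mu> = 0"
proof -
  have "Eig \<mu> \<subseteq> fun_cvs.span {}"
  proof
    fix \<psi> assume "\<psi> \<in> Eig \<mu>"
    then have "\<psi> = 0" using assms by (auto simp: eigenvalues_def fun_eq_iff)
    then show "\<psi> \<in> fun_cvs.span {}" by simp
  qed
  then have "fun_cdim (Eig \<mu>) \<le> card ({} :: ('n rvec \<Rightarrow> complex ^ ('s \<times> 'd)) set)" by (rule fun_cvs.dim_le_card) simp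
  then show ?thesis by (simp add: eta_term_def)
qed

text \<open>The difference of the multiplicities of 2 \<pi> \<nu> and -2 \<pi> \<nu>, provided that
  \<nu> is positive and \<nu> - h is an integer.\<close>

definition asym :: "real \<Rightarrow> complex" where
  "asym \<nu> = (2 / of_nat p) * (\<Sum>k=1..p-1. of_real (sin (2 * pi * real k * \<nu> / p)) * trace (N (gamma_p ^^ k) ** LT ep))"

lemma asym_period: "asym (\<nu> + real n * real p) = asym \<nu>"
  unfolding asym_def
proof (intro arg_cong[where f = "\<lambda>x. _ * x"] sum.cong refl)
  fix k
  have "2 * pi * real k * (\<nu> + real n * real p) / p = 2 * pi * real k * \<nu> / p + of_int (int (k * n)) * (2 * pi)"
    using p_pos by (simp add: field_simps)
  then have "sin (2 * pi * real k * (\<nu> + real n * real p) / p) = sin (2 * pi * real k * \<nu> / p)"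
    by (simp only: sin_plus_2pi_int)
  then show "of_real (sin (2 * pi * real k * (\<nu> + real n * real p) / p)) * trace (N (gamma_p ^^ k) ** LT ep)
    = of_real (sin (2 * pi * real k * \<nu> / p)) * trace (N (gamma_p ^^ k) ** LT ep)" by simp
qed

lemma h_pos: "h > 0" using h by auto

lemma positive_shift: "\<nu> > 0 \<and> \<nu> - h \<in> \<int> \<longleftrightarrow> (\<exists>j::nat. \<nu> = real j + h)"
proof
  assume \<nu>: "\<nu> > 0 \<and> \<nu> - h \<in> \<int>"
  then obtain n where n: "\<nu> - h = of_int n" by (auto elim: Ints_cases)
  have "of_int n > (- 1 :: real)" using \<nu> n h by auto
  then have "n \<ge> 0" by linarith
  then show "\<exists>j::nat. \<nu> = real j + h" using n by (intro exI[of _ "nat n"]) simp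
qed (use h_pos in auto)

text \<open>Absolute convergence permits folding the negative half-line onto the positive one. A
  folded term is a difference of multiplicities, so it vanishes except at 2 \<pi> (j + h), and the
  sum becomes an ordinary series over j.\<close>

lemma eta_series_nat:
  assumes s: "Re s > real p"
  obtains X where "(eterm s has_sum X) (eigenvalues \<Gamma> L \<epsilon> \<rho> - {0})"
    "(\<lambda>j. asym (real j + h) * of_real (2 * pi * (real j + h)) powr (- s)) sums X"
proof -
  let ?pos = "{0<..} :: real set"
  define d where "d = (\<lambda>\<mu>. eterm s \<mu> + eterm s (- \<mu>))"
  obtain A where A: "(eterm s has_sum A) ?pos"
    using abs_summable_summable[OF summable_eterm(1)[OF s]] by (auto simp: summable_on_def)
  obtain B where B: "((\<lambda>\<mu>. eterm s (- \<mu>)) has_sum B) ?pos"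
    using abs_summable_summable[OF summable_eterm(2)[OF s]] by (auto simp: summable_on_def)
  have B': "(eterm s has_sum B) (uminus ` ?pos)"
    using B by (subst has_sum_reindex) (auto simp: o_def)
  have "(eterm s has_sum (A + B)) (?pos \<union> uminus ` ?pos)"
    by (rule has_sum_Un_disjoint[OF A B']) auto
  moreover have "?pos \<union> uminus ` ?pos = UNIV - {0}"
  proof -
    have "x \<in> uminus ` ?pos" if "x < 0" for x :: real using that by (intro image_eqI[of _ _ "- x"]) auto
    then show ?thesis by (auto simp: not_less less_le)
  qed
  ultimately have tot: "(eterm s has_sum (A + B)) (UNIV - {0})" by simp
  have "(eterm s has_sum (A + B)) (eigenvalues \<Gamma> L \<epsilon> \<rho> - {0})"
    using tot by (subst has_sum_cong_neutral[where g = "eterm s" and T = "UNIV - {0}"]) (auto simp: eterm_not_eigenvalue)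
  moreover have "(d has_sum (A + B)) ?pos" unfolding d_def by (rule has_sum_add[OF A B])
  then have "(\<lambda>j. d (2 * pi * (real j + h))) sums (A + B)"
  proof -
    assume D: "(d has_sum (A + B)) ?pos"
    let ?r = "\<lambda>j::nat. 2 * pi * (real j + h)"
    have inj: "inj ?r" by (auto simp: inj_on_def)
    have zero: "d \<mu> = 0" if "\<mu> \<in> ?pos - range ?r" for \<mu>
    proof -
      define \<nu> where "\<nu> = \<mu> / (2 * pi)"
      have \<mu>: "\<mu> = 2 * pi * \<nu>" by (simp add: \<nu>_def)
      have \<nu>: "\<nu> > 0" using that by (simp add: \<nu>_def)
      have "\<nu> \<noteq> real j + h" for j using that \<mu> by auto
      then have "\<nu> - h \<notin> \<int>" using positive_shift \<nu> by blast
      then have "complex_of_nat (fun_cdim (Eig \<mu>)) - of_nat (fun_cdim (Eig (- \<mu>))) = 0"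
        using dim_asymmetry[OF \<nu>] by (simp add: \<mu>)
      then show ?thesis using that by (simp add: d_def eta_term_def)
    qed
    have "(d has_sum (A + B)) (range ?r)"
      using D by (subst has_sum_cong_neutral[where g = d and T = ?pos])
        (use zero h_pos in \<open>auto intro!: mult_pos_pos add_nonneg_pos\<close>)
    then have "((\<lambda>j. d (?r j)) has_sum (A + B)) UNIV" by (subst (asm) has_sum_reindex[OF inj]) (simp add: o_def)
    then show ?thesis by (rule has_sum_imp_sums)
  qed
  moreover have "d (2 * pi * (real j + h)) = asym (real j + h) * of_real (2 * pi * (real j + h)) powr (- s)" for j
  proof -
    have pos: "real j + h > 0" using h_pos by simp
    have "d (2 * pi * (real j + h)) = (of_nat (fun_cdim (Eig (2 * pi * (real j + h)))) - of_nat (fun_cdim (Eig (- (2 * pi * (real j + h))))))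
      * of_real (2 * pi * (real j + h)) powr (- s)"
    proof -
      have "sgn (2 * pi * (real j + h)) = 1" "\<bar>2 * pi * (real j + h)\<bar> = 2 * pi * (real j + h)"
        using pos by (auto intro!: sgn_pos abs_of_pos mult_pos_pos)
      then show ?thesis unfolding d_def eta_term_def sgn_minus abs_minus_cancel by (simp add: left_diff_distrib)
    qed
    then show ?thesis unfolding dim_asymmetry[OF pos] asym_def by simp
  qed
  ultimately show thesis using that by simp
qed

definition eta_hurwitz :: "complex \<Rightarrow> complex" where
  "eta_hurwitz s = (\<Sum>l<p. asym (real l + h) * (of_real (2 * pi * p) powr (- s) * hurwitz_zeta s ((real l + h) / p)))"

lemma arg_pos: "(real l + h) / p > 0" using h_pos p_pos by simp

text \<open>Group the series in blocks of p terms. The coefficients have period p, and for j = n p +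
  l the frequency is 2 \<pi> p (n + (l + h)/p), the general term of a Hurwitz series.\<close>

lemma eta_has_sum:
  assumes s: "Re s > real p"
  shows "(eterm s has_sum eta_hurwitz s) (eigenvalues \<Gamma> L \<epsilon> \<rho> - {0})"
proof -
  obtain X where X: "(eterm s has_sum X) (eigenvalues \<Gamma> L \<epsilon> \<rho> - {0})"
    and S: "(\<lambda>j. asym (real j + h) * of_real (2 * pi * (real j + h)) powr (- s)) sums X"
    using eta_series_nat[OF s] by blast
  let ?f = "\<lambda>j. asym (real j + h) * of_real (2 * pi * (real j + h)) powr (- s)"
  have s1: "Re s > 1" using s p_ge by simp
  have f: "?f (n * p + l) = asym (real l + h) * (of_real (2 * pi * p) powr (- s) * of_real (real n + (real l + h) / p) powr (- s))" for n l
  proof -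
    have "asym (real (n * p + l) + h) = asym (real l + h)" using asym_period[of "real l + h" n] by (simp add: algebra_simps)
    moreover have "2 * pi * (real (n * p + l) + h) = (2 * pi * p) * (real n + (real l + h) / p)"
      using p_pos by (simp add: field_simps)
    moreover have "complex_of_real ((2 * pi * p) * (real n + (real l + h) / p)) powr (- s)
       = of_real (2 * pi * p) powr (- s) * of_real (real n + (real l + h) / p) powr (- s)"
      unfolding of_real_mult[of "2 * pi * p"] using arg_pos[of l] by (intro powr_times_real) auto
    ultimately show ?thesis by (simp only:)
  qed
  have "(\<lambda>n. sum ?f {n * p..<n * p + p}) sums X" by (rule sums_group[OF S p_pos])
  moreover have "sum ?f {n * p..<n * p + p} = (\<Sum>l<p. asym (real l + h) * (of_real (2 * pi * p) powr (- s) * of_real (real n + (real l + h) / p) powr (- s)))" for n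
  proof -
    have "sum ?f {n * p..<n * p + p} = (\<Sum>l<p. ?f (n * p + l))"
      using sum.shift_bounds_nat_ivl[of ?f 0 "n * p" p] by (simp add: lessThan_atLeast0 add.commute)
    then show ?thesis unfolding f .
  qed
  moreover have "(\<lambda>n. \<Sum>l<p. asym (real l + h) * (of_real (2 * pi * p) powr (- s) * of_real (real n + (real l + h) / p) powr (- s))) sums eta_hurwitz s"
    unfolding eta_hurwitz_def hurwitz_zeta_eq_series[OF arg_pos s1]
    by (intro sums_sum sums_mult summable_sums summable_norm_cancel[OF summable_hurwitz[OF arg_pos s1]])
  ultimately have "X = eta_hurwitz s" using sums_unique2 by (simp only:)
  then show ?thesis using X by simp
qed

lemma eta_hurwitz_analytic: "s \<noteq> 1 \<Longrightarrow> eta_hurwitz analytic_on {s}"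
proof -
  assume s: "s \<noteq> 1"
  have "(\<lambda>s. complex_of_real (2 * pi * p) powr (- s)) analytic_on {s}"
    using p_pos by (intro analytic_on_real_powr) simp
  then show ?thesis unfolding eta_hurwitz_def[abs_def]
    by (intro analytic_on_sum analytic_on_mult analytic_on_const hurwitz_zeta_analytic[OF arg_pos s])
qed

lemma eta_hurwitz_meromorphic: "eta_hurwitz meromorphic_on UNIV"
proof -
  have "(\<lambda>s. complex_of_real (2 * pi * p) powr (- s)) analytic_on UNIV"
    using p_pos by (intro analytic_on_real_powr) simp
  then show ?thesis unfolding eta_hurwitz_def[abs_def]
    by (intro meromorphic_intros analytic_on_imp_meromorphic_on hurwitz_zeta_meromorphic[OF arg_pos]) auto
qed

text \<open>At s = 1 the Hurwitz functions take the value 0 of a pole, while the poles may cancel in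
  the sum. There the continuation is \<open>remove_sings eta_hurwitz\<close>, which agrees with
  \<open>eta_hurwitz\<close> at all other points.\<close>

lemma eta_fun_eq:
  assumes "s \<noteq> 1" shows "eta_fun \<Gamma> L \<epsilon> \<rho> s = eta_hurwitz s"
proof -
  have r: "remove_sings eta_hurwitz s = eta_hurwitz s" if "s \<noteq> 1" for s
    by (rule remove_sings_at_analytic[OF eta_hurwitz_analytic[OF that]])
  have "eta_fun \<Gamma> L \<epsilon> \<rho> = remove_sings eta_hurwitz"
    unfolding eta_fun_def
  proof (rule mero_cont_eqI)
    show "remove_sings eta_hurwitz nicely_meromorphic_on UNIV"
      by (rule remove_sings_nicely_meromorphic[OF eta_hurwitz_meromorphic])
    fix s assume s: "Re s > real CARD('n)"
    then have s': "Re s > real p" unfolding p(1) .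
    then have "s \<noteq> 1" using p_ge by auto
    then show "remove_sings eta_hurwitz s = (\<Sum>\<^sub>\<infinity>\<mu>\<in>eigenvalues \<Gamma> L \<epsilon> \<rho> - {0}. eterm s \<mu>)"
      using infsumI[OF eta_has_sum[OF s']] r[OF \<open>s \<noteq> 1\<close>] by simp
  qed
  then show ?thesis using r[OF assms] by simp
qed

end

section \<open>Evaluation\<close>

lemma sum_pair_reflect:
  fixes f :: "nat \<Rightarrow> 'a::comm_monoid_add"
  assumes p: "odd p"
  shows "(\<Sum>k=1..p-1. f k) = (\<Sum>k=1..(p-1) div 2. f k + f (p - k))"
proof -
  let ?q = "(p - 1) div 2"
  have pq: "p = 2 * ?q + 1" using p by auto
  have "(\<Sum>k=1..p-1. f k) = sum f {1..?q} + sum f {?q+1..p-1}"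
    using pq by (subst sum.union_disjoint[symmetric]) (auto intro!: sum.cong)
  also have "sum f {?q+1..p-1} = (\<Sum>k=1..?q. f (p - k))"
    by (rule sum.reindex_bij_witness[of _ "\<lambda>k. p - k" "\<lambda>k. p - k"]) (use pq in auto)
  finally show ?thesis by (simp add: sum.distrib)
qed

lemma minus_one_power_scale: "(- 1) ^ n * (a :: 'n::{finite,linorder} clifford) = (- 1 :: real) ^ n *\<^sub>R a"
  by (cases "even n") simp_all

context twisted_dirac
begin

text \<open>\<rho> is trivial on translation by \<open>e_p\<close>, the p-th power of \<gamma>. So
  the power p - k is represented by the inverse, hence by the adjoint, of the k-th one.\<close>

lemma chi_conj:
  assumes k: "k \<le> p" shows "chi (p - k) = cnj (chi k)"
proof -
  let ?A = "\<rho> (gamma_p ^^ k)" and ?B = "\<rho> (gamma_p ^^ (p - k))"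
  have "\<rho> (gamma_p ^^ p) = mat 1"
    using rho_lattice[OF int_lattice_ebasis, of p] by (simp add: gamma_pow_p D_last)
  then have AB: "?A ** ?B = mat 1"
    using rho_mult[OF Gamma_gamma_pow Gamma_gamma_pow, of k "p - k"] k by (simp flip: funpow_add)
  have "?A \<in> carrier unitary_group" using rho Gamma_gamma_pow[of k] by (auto simp: hom_def)
  then have "(\<chi> i j. cnj (?A $ j $ i)) ** ?A = mat 1" by (simp add: unitary_group_def)
  then have "?B = (\<chi> i j. cnj (?A $ j $ i)) ** (?A ** ?B)" by (simp add: matrix_mul_assoc)
  then have "?B = (\<chi> i j. cnj (?A $ j $ i))" unfolding AB by simp
  then show ?thesis by (simp add: chi_def trace_def)
qed

end

text \<open>Both spin structures share the sign (-1)^(r+1), which compensates the sign in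
  \<open>prod_sin_Legendre\<close>. What remains is \<open>\<kappa>'\<close>, equal to 1 for
  \<epsilon>_1 and -1 for \<epsilon>_2; it produces the alternating factor of the second pair of
  formulas.\<close>

locale twisted_dirac_sign = twisted_dirac +
  fixes \<kappa>' :: real
  assumes kappa: "\<kappa> = (- 1) ^ (r + 1) * \<kappa>'" and h_kappa: "h = 1 \<and> \<kappa>' = 1 \<or> h = 1 / 2 \<and> \<kappa>' = - 1"
begin

abbreviation leg :: "nat \<Rightarrow> int" where "leg k \<equiv> Legendre (int k) (int p)"

text \<open>All sign exponents together add up to 2 (r + 1) k + 2 r + 1, which is odd whatever k and
  r are.\<close>

lemma trace_N_LT_Legendre:
  assumes k: "k \<in> {1..p-1}"
  shows "trace (N (gamma_p ^^ k) ** LT ep) = - of_real (\<kappa>' ^ k * of_int (leg k) * sqrt p) * chi k"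
proof -
  have "\<kappa> ^ k * (- 1) ^ r * (- 1) ^ ((r + 1) * (k + 1)) = (- 1) ^ ((r + 1) * k + r + (r + 1) * (k + 1)) * \<kappa>' ^ k"
  proof -
    have "\<kappa> ^ k = (- 1) ^ ((r + 1) * k) * \<kappa>' ^ k" by (simp only: kappa power_mult_distrib power_mult)
    then show ?thesis by (simp only: power_add mult_ac)
  qed
  moreover have "odd ((r + 1) * k + r + (r + 1) * (k + 1))" by (cases "even r"; cases "even k"; simp)
  then have "(- 1 :: real) ^ ((r + 1) * k + r + (r + 1) * (k + 1)) = - 1" by (rule neg_one_odd_power)
  ultimately have "\<kappa> ^ k * (- 1) ^ r * (- 1) ^ ((r + 1) * (k + 1)) = - (\<kappa>' ^ k)" by simp
  then have "\<kappa> ^ k * (- 1) ^ r * ((- 1) ^ ((r + 1) * (k + 1)) * of_int (leg k) * sqrt p) = - (\<kappa>' ^ k * of_int (leg k) * sqrt p)"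
    by (simp only: mult.assoc[symmetric])
  then show ?thesis unfolding trace_N_LT[OF k] by (simp only: of_real_minus)
qed

lemma eta_hurwitz_Legendre:
  "eta_hurwitz s = - 2 / (of_real (sqrt p) * of_real (2 * pi * p) powr s) *
     (\<Sum>k=1..p-1. chi k * of_real (\<kappa>' ^ k) * of_int (leg k) *
        (\<Sum>l<p. of_real (sin (2 * pi * real k * (real l + h) / p)) * hurwitz_zeta s ((real l + h) / p)))"
proof -
  let ?P = "complex_of_real (2 * pi * p) powr s"
  have sq: "complex_of_real (sqrt p) * of_real (sqrt p) = of_nat p" "complex_of_real (sqrt p) \<noteq> 0"
    using p_pos by (simp_all flip: of_real_mult)
  then have two: "2 / of_nat p * complex_of_real (sqrt p) = 2 / of_real (sqrt p)"
    by (simp add: field_simps flip: sq(1))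
  have a: "asym \<nu> = - 2 / of_real (sqrt p) * (\<Sum>k=1..p-1. of_real (sin (2 * pi * real k * \<nu> / p)) * (chi k * of_real (\<kappa>' ^ k) * of_int (leg k)))" for \<nu>
  proof -
    have "asym \<nu> = 2 / of_nat p * (\<Sum>k=1..p-1. of_real (sin (2 * pi * real k * \<nu> / p)) * (- of_real (\<kappa>' ^ k * of_int (leg k) * sqrt p) * chi k))"
      unfolding asym_def by (intro arg_cong2[where f = "(*)"] sum.cong refl) (simp only: trace_N_LT_Legendre)
    also have "\<dots> = 2 / of_nat p * of_real (sqrt p) * - (\<Sum>k=1..p-1. of_real (sin (2 * pi * real k * \<nu> / p)) * (chi k * of_real (\<kappa>' ^ k) * of_int (leg k)))"
      unfolding sum_distrib_left sum_negf[symmetric] by (intro sum.cong refl) simp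
    finally show ?thesis unfolding two by simp
  qed
  have "eta_hurwitz s = (\<Sum>l<p. - 2 / of_real (sqrt p) * (\<Sum>k=1..p-1. of_real (sin (2 * pi * real k * (real l + h) / p)) * (chi k * of_real (\<kappa>' ^ k) * of_int (leg k)))
      * (1 / ?P * hurwitz_zeta s ((real l + h) / p)))"
    unfolding eta_hurwitz_def a by (simp only: powr_minus inverse_eq_divide)
  also have "\<dots> = - 2 / (of_real (sqrt p) * ?P) * (\<Sum>l<p. \<Sum>k=1..p-1. chi k * of_real (\<kappa>' ^ k) * of_int (leg k) *
        (of_real (sin (2 * pi * real k * (real l + h) / p)) * hurwitz_zeta s ((real l + h) / p)))"
    unfolding sum_distrib_left sum_distrib_right by (intro sum.cong refl) (simp add: mult_ac)
  also have "(\<Sum>l<p. \<Sum>k=1..p-1. chi k * of_real (\<kappa>' ^ k) * of_int (leg k) *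
        (of_real (sin (2 * pi * real k * (real l + h) / p)) * hurwitz_zeta s ((real l + h) / p)))
     = (\<Sum>k=1..p-1. chi k * of_real (\<kappa>' ^ k) * of_int (leg k) *
        (\<Sum>l<p. of_real (sin (2 * pi * real k * (real l + h) / p)) * hurwitz_zeta s ((real l + h) / p)))"
    by (subst sum.swap) (simp only: sum_distrib_left)
  finally show ?thesis .
qed

text \<open>The right-hand side of \<open>sum_sin_sawtooth\<close> at \<theta> = 2 \<pi> k / p: half
  a cotangent for h = 1 and half a cosecant for h = 1/2.\<close>

definition half_cot :: "nat \<Rightarrow> real" where
  "half_cot k = cos ((h - 1 / 2) * (2 * pi * real k / p)) / (2 * sin (pi * real k / p))"

text \<open>For h = 1 the cotangent is odd under reflection at \<pi>/2. For h = 1/2 the cosecant is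
  even, but the alternating sign changes because p is odd.\<close>

lemma half_cot_reflect:
  assumes k: "k \<in> {1..p-1}"
  shows "\<kappa>' ^ (p - k) * half_cot (p - k) = - (\<kappa>' ^ k * half_cot k)"
proof -
  have "real k + real (p - k) = real p" using k by auto
  then have e: "pi * real (p - k) / p = pi - pi * real k / p" using p_pos by (simp add: field_simps flip: distrib_left)
  have odd: "odd p" unfolding p(2) by simp
  show ?thesis using h_kappa
  proof
    assume H: "h = 1 \<and> \<kappa>' = 1"
    then have half: "(h - 1 / 2) * (2 * pi * real k' / p) = pi * real k' / p" for k' by simp
    show ?thesis unfolding half_cot_def half e using H by simp
  next
    assume H: "h = 1 / 2 \<and> \<kappa>' = - 1"
    have "(- 1 :: real) ^ (p - k) = - ((- 1) ^ k)" using odd k by (cases "even k") auto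
    moreover have "h - 1 / 2 = 0" using H by simp
    ultimately show ?thesis unfolding half_cot_def e using H by (simp only: mult_zero_left) simp
  qed
qed

text \<open>The Legendre symbol and the weight of \<open>half_cot_reflect\<close> both change sign
  under k -> p - k, so their product does not. Adding the two terms turns the character value into
  twice its real part and halves the range of k.\<close>

lemma eta_hurwitz_0:
  "eta_hurwitz 0 = - 2 / of_real (sqrt p) *
     (\<Sum>k=1..(p-1) div 2. of_real (Re (chi k)) * of_real (\<kappa>' ^ k) * of_int (leg k) * of_real (2 * half_cot k))"
proof -
  have inner: "(\<Sum>l<p. of_real (sin (2 * pi * real k * (real l + h) / p)) * hurwitz_zeta 0 ((real l + h) / p)) = of_real (half_cot k)"
    if k: "k \<in> {1..p-1}" for k
  proof -
    have "(\<Sum>l<p. of_real (sin (2 * pi * real k * (real l + h) / p)) * hurwitz_zeta 0 ((real l + h) / p))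
      = of_real (\<Sum>l<p. sin ((real l + h) * (2 * pi * real k / p)) * (1 / 2 - (real l + h) / p))"
      unfolding hurwitz_zeta_0[OF arg_pos] by (simp add: mult_ac)
    also have "(\<Sum>l<p. sin ((real l + h) * (2 * pi * real k / p)) * (1 / 2 - (real l + h) / p)) = half_cot k"
    proof -
      have "0 < pi * real k / p" "pi * real k / p < pi" using k p_pos by (auto simp: field_simps)
      then have "sin (2 * pi * real k / p / 2) \<noteq> 0" using sin_gt_zero[of "pi * real k / p"] by simp
      then show ?thesis using sum_sin_sawtooth[OF p_pos, of "2 * pi * real k / p" "int k" h] p_pos by (simp add: half_cot_def)
    qed
    finally show ?thesis .
  qed
  define g where "g = (\<lambda>k. complex_of_real (\<kappa>' ^ k) * of_int (leg k) * of_real (half_cot k))"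
  have g: "g (p - k) = g k" if k: "k \<in> {1..p-1}" for k
  proof -
    have "of_int (leg (p - k)) * (\<kappa>' ^ (p - k) * half_cot (p - k)) = of_int (leg k) * (\<kappa>' ^ k * half_cot k)"
      unfolding half_cot_reflect[OF k] Legendre_complement[OF p(3,2) k] by simp
    then have "complex_of_real (of_int (leg (p - k)) * (\<kappa>' ^ (p - k) * half_cot (p - k))) = complex_of_real (of_int (leg k) * (\<kappa>' ^ k * half_cot k))"
      by (simp only:)
    then show ?thesis by (simp add: g_def mult_ac)
  qed
  have odd: "odd p" unfolding p(2) by simp
  have "eta_hurwitz 0 = - 2 / of_real (sqrt p) * (\<Sum>k=1..p-1. chi k * g k)"
  proof -
    have "(\<Sum>k=1..p-1. chi k * of_real (\<kappa>' ^ k) * of_int (leg k) *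
        (\<Sum>l<p. of_real (sin (2 * pi * real k * (real l + h) / p)) * hurwitz_zeta 0 ((real l + h) / p))) = (\<Sum>k=1..p-1. chi k * g k)"
      by (intro sum.cong refl) (simp only: inner, simp only: g_def mult.assoc)
    moreover have "complex_of_real (2 * pi * p) powr 0 = 1" using p_pos by simp
    ultimately show ?thesis unfolding eta_hurwitz_Legendre by (simp only: mult_1_right)
  qed
  also have "(\<Sum>k=1..p-1. chi k * g k) = (\<Sum>k=1..(p-1) div 2. chi k * g k + chi (p - k) * g (p - k))"
    by (rule sum_pair_reflect[OF odd])
  also have "\<dots> = (\<Sum>k=1..(p-1) div 2. of_real (Re (chi k)) * of_real (\<kappa>' ^ k) * of_int (leg k) * of_real (2 * half_cot k))"
  proof (rule sum.cong[OF refl])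
    fix k assume k: "k \<in> {1..(p-1) div 2}"
    then have k': "k \<in> {1..p-1}" by auto
    have "chi k * g k + chi (p - k) * g (p - k) = (chi k + cnj (chi k)) * g k"
      unfolding g[OF k'] using k' by (subst chi_conj) (auto simp: distrib_right)
    also have "chi k + cnj (chi k) = 2 * of_real (Re (chi k))" by (simp add: complex_add_cnj)
    finally show "chi k * g k + chi (p - k) * g (p - k) = of_real (Re (chi k)) * of_real (\<kappa>' ^ k) * of_int (leg k) * of_real (2 * half_cot k)"
      by (simp add: g_def mult_ac)
  qed
  finally show ?thesis .
qed

lemmas eta_Legendre = eta_fun_eq[unfolded eta_hurwitz_Legendre]
lemmas eta_0_cot = trans[OF eta_fun_eq[of 0, simplified] eta_hurwitz_0]

lemma eta_has_sum_eta_fun: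
  assumes s: "Re s > real p"
  shows "(eterm s has_sum eta_fun \<Gamma> L \<epsilon> \<rho> s) (eigenvalues \<Gamma> L \<epsilon> \<rho> - {0})"
proof -
  have "s \<noteq> 1" using s p_ge by auto
  then show ?thesis using eta_has_sum[OF s] by (simp add: eta_fun_eq)
qed

text \<open>A constant character is its own conjugate by \<open>chi_conj\<close>, so in that case no
  information is lost by the real parts in the eta invariants.\<close>

lemma chi_const:
  assumes "\<And>k. k \<in> {1..p-1} \<Longrightarrow> chi k = c"
  shows "of_real (Re c) = c"
proof -
  have "chi (p - 1) = cnj (chi 1)" using p_ge by (intro chi_conj) simp
  then have "cnj c = c" using assms[of 1] assms[of "p - 1"] p_ge by simp
  then show ?thesis by (metis Reals_cnj_iff of_real_Re)
qed

text \<open>With h = 1 the index runs from 1 to p, and the last term is sin(2 \<pi> k) = 0.\<close>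

lemma inner_sum_1:
  assumes h: "h = 1"
  shows "(\<Sum>l<p. of_real (sin (2 * pi * real k * (real l + h) / p)) * hurwitz_zeta s ((real l + h) / p))
    = (\<Sum>l=1..p-1. of_real (sin (2 * real l * pi * real k / real p)) * hurwitz_zeta s (real l / real p))"
proof -
  let ?F = "\<lambda>l. complex_of_real (sin (2 * real l * pi * real k / real p)) * hurwitz_zeta s (real l / real p)"
  have "(\<Sum>l<p. of_real (sin (2 * pi * real k * (real l + h) / p)) * hurwitz_zeta s ((real l + h) / p)) = (\<Sum>l<p. ?F (Suc l))"
    using h by (intro sum.cong refl) (simp add: mult_ac add.commute)
  also have "\<dots> = (\<Sum>l=1..p. ?F l)" by (simp add: sum.atLeast1_atMost_eq)
  also have "\<dots> = (\<Sum>l=1..p-1. ?F l) + ?F p"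
    using p_pos by (cases p) simp_all
  also have "?F p = 0"
  proof -
    have "2 * real p * pi * real k / real p = 2 * pi * of_int (int k)" using p_pos by simp
    then show ?thesis by (simp only: sin_int_2pin) simp
  qed
  finally show ?thesis by simp
qed

lemma inner_sum_half:
  assumes h: "h = 1 / 2"
  shows "(\<Sum>l<p. of_real (sin (2 * pi * real k * (real l + h) / p)) * hurwitz_zeta s ((real l + h) / p))
    = (\<Sum>l=0..p-1. of_real (sin ((2 * real l + 1) * pi * real k / real p)) * hurwitz_zeta s ((2 * real l + 1) / (2 * real p)))"
proof (rule sum.cong)
  show "{..<p} = {0..p-1}" using p_pos by auto
  fix l
  have "2 * pi * real k * (real l + h) / p = (2 * real l + 1) * pi * real k / real p"
    "(real l + h) / p = (2 * real l + 1) / (2 * real p)" using p_pos by (simp_all add: h field_simps)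
  then show "of_real (sin (2 * pi * real k * (real l + h) / p)) * hurwitz_zeta s ((real l + h) / p)
    = of_real (sin ((2 * real l + 1) * pi * real k / real p)) * hurwitz_zeta s ((2 * real l + 1) / (2 * real p))" by (simp only:)
qed

lemma half_cot_1: "h = 1 \<Longrightarrow> 2 * half_cot k = cot (real k * pi / real p)"
  unfolding half_cot_def by (simp add: cot_def mult.commute)

lemma half_cot_half: "h = 1 / 2 \<Longrightarrow> 2 * half_cot k = 1 / sin (real k * pi / real p)"
  unfolding half_cot_def by (simp add: mult.commute field_simps)

end

text \<open>The character is kept inside the sums because the trace of \<rho>(\<gamma>^k) is not
  constant in general: the one-dimensional \<rho> with \<rho>(\<gamma>) = exp(2 \<pi> i / p) gives
  exp(2 \<pi> i k / p). The final implication pulls it out when it is constant for 1 \<le> k \<le> p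
  - 1. The point s = 1 is excluded because \<open>hurwitz_zeta\<close> has the conventional value 0
  at its pole, while \<open>eta_fun\<close> is continued through removable singularities.\<close>

theorem theorem5p1:
  fixes p r :: nat
    and D :: "('n rvec, 'n::{finite,linorder}) vec"
    and L :: "'n clifford \<Rightarrow> complex ^ 's ^ 's::finite"
    and \<rho> :: "('n rvec \<Rightarrow> 'n rvec) \<Rightarrow> complex ^ 'd ^ 'd::finite"
    and \<epsilon>\<^sub>1 \<epsilon>\<^sub>2 :: "('n rvec \<Rightarrow> 'n rvec) \<Rightarrow> 'n clifford"
  assumes "p = CARD('n)" and "p = 4 * r + 3" and "prime p"
    and "invertible D" and "D *v ebasis p = ebasis p"
    and "\<forall>v. Cmap v = D *v Bmap (matrix_inv D *v v)"
    and "spinor_rep L"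
    and "\<rho> \<in> hom (subgrp (Gamma_p D)) unitary_group"
    and "\<forall>b\<in>int_lattice. \<rho> (transl (D *v b)) = mat 1"
    and "spin_structure (Gamma_p D) \<epsilon>\<^sub>1" and "spin_structure (Gamma_p D) \<epsilon>\<^sub>2"
    and "\<forall>j\<in>{1..p-1}. \<epsilon>\<^sub>1 (transl (D *v ebasis j)) = 1 \<and> \<epsilon>\<^sub>2 (transl (D *v ebasis j)) = 1"
    and "\<epsilon>\<^sub>1 (transl (ebasis p)) = 1" and "\<epsilon>\<^sub>2 (transl (ebasis p)) = - 1"
    and "\<epsilon>\<^sub>1 gamma_p = (- 1) ^ (r + 1) * spin_x (\<lambda>j. real j * pi / real p)"
    and "\<epsilon>\<^sub>2 gamma_p = (- 1) ^ r * spin_x (\<lambda>j. real j * pi / real p)"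
  shows
    \<comment> \<open>the continuations extend the eta series, which converge for \<open>Re s > p\<close>\<close>
    "(\<forall>\<epsilon>\<in>{\<epsilon>\<^sub>1, \<epsilon>\<^sub>2}. \<forall>s. Re s > p \<longrightarrow>
       (eta_term (Gamma_p D) L \<epsilon> \<rho> s has_sum eta_fun (Gamma_p D) L \<epsilon> \<rho> s)
         (eigenvalues (Gamma_p D) L \<epsilon> \<rho> - {0})) \<and>
     (\<forall>s. s \<noteq> 1 \<longrightarrow> eta_fun (Gamma_p D) L \<epsilon>\<^sub>1 \<rho> s =
       - 2 / (of_real (sqrt p) * of_real (2 * pi * p) powr s) *
       (\<Sum>k=1..p-1. trace (\<rho> (gamma_p ^^ k)) * of_int (Legendre k p) *
          (\<Sum>l=1..p-1. of_real (sin (2 * l * pi * k / p)) * hurwitz_zeta s (l / p)))) \<and>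
     (\<forall>s. s \<noteq> 1 \<longrightarrow> eta_fun (Gamma_p D) L \<epsilon>\<^sub>2 \<rho> s =
       - 2 / (of_real (sqrt p) * of_real (2 * pi * p) powr s) *
       (\<Sum>k=1..p-1. trace (\<rho> (gamma_p ^^ k)) * (- 1) ^ k * of_int (Legendre k p) *
          (\<Sum>l=0..p-1. of_real (sin ((2 * l + 1) * pi * k / p)) * hurwitz_zeta s ((2 * l + 1) / (2 * p))))) \<and>
     eta_invariant (Gamma_p D) L \<epsilon>\<^sub>1 \<rho> =
       - 2 / of_real (sqrt p) *
       (\<Sum>k=1..(p-1) div 2. of_real (Re (trace (\<rho> (gamma_p ^^ k)))) * of_int (Legendre k p) * of_real (cot (k * pi / p))) \<and>
     eta_invariant (Gamma_p D) L \<epsilon>\<^sub>2 \<rho> =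
       - 2 / of_real (sqrt p) *
       (\<Sum>k=1..(p-1) div 2. of_real (Re (trace (\<rho> (gamma_p ^^ k)))) * (- 1) ^ k * of_int (Legendre k p) * of_real (1 / sin (k * pi / p))) \<and>
     ((\<forall>k\<in>{1..p-1}. trace (\<rho> (gamma_p ^^ k)) = trace (\<rho> gamma_p)) \<longrightarrow>
       (\<forall>s. s \<noteq> 1 \<longrightarrow> eta_fun (Gamma_p D) L \<epsilon>\<^sub>1 \<rho> s =
         - 2 * trace (\<rho> gamma_p) / (of_real (sqrt p) * of_real (2 * pi * p) powr s) *
         (\<Sum>k=1..p-1. of_int (Legendre k p) *
            (\<Sum>l=1..p-1. of_real (sin (2 * l * pi * k / p)) * hurwitz_zeta s (l / p)))) \<and>
       (\<forall>s. s \<noteq> 1 \<longrightarrow> eta_fun (Gamma_p D) L \<epsilon>\<^sub>2 \<rho> s =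
         - 2 * trace (\<rho> gamma_p) / (of_real (sqrt p) * of_real (2 * pi * p) powr s) *
         (\<Sum>k=1..p-1. (- 1) ^ k * of_int (Legendre k p) *
            (\<Sum>l=0..p-1. of_real (sin ((2 * l + 1) * pi * k / p)) * hurwitz_zeta s ((2 * l + 1) / (2 * p))))) \<and>
       eta_invariant (Gamma_p D) L \<epsilon>\<^sub>1 \<rho> =
         - 2 * trace (\<rho> gamma_p) / of_real (sqrt p) *
         (\<Sum>k=1..(p-1) div 2. of_int (Legendre k p) * of_real (cot (k * pi / p))) \<and>
       eta_invariant (Gamma_p D) L \<epsilon>\<^sub>2 \<rho> =
         - 2 * trace (\<rho> gamma_p) / of_real (sqrt p) *
         (\<Sum>k=1..(p-1) div 2. (- 1) ^ k * of_int (Legendre k p) * of_real (1 / sin (k * pi / p))))"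
proof -
  interpret spinor_representation L using \<open>spinor_rep L\<close> by unfold_locales
  interpret A: twisted_dirac_sign L D \<rho> \<epsilon>\<^sub>1 p r "rot_dim TYPE('n)" 1 "(- 1) ^ (r + 1)" 1
    using assms by unfold_locales (auto simp: minus_one_power_scale)
  interpret B: twisted_dirac_sign L D \<rho> \<epsilon>\<^sub>2 p r "rot_dim TYPE('n)" "1 / 2" "(- 1) ^ r" "- 1"
    using assms by unfold_locales (auto simp: minus_one_power_scale)
  have chi: "trace (\<rho> (gamma_p ^^ k)) = A.chi k" for k by (simp add: A.chi_def)
  have e1: "eta_fun (Gamma_p D) L \<epsilon>\<^sub>1 \<rho> s =
       - 2 / (of_real (sqrt p) * of_real (2 * pi * p) powr s) *
       (\<Sum>k=1..p-1. A.chi k * of_int (Legendre k p) *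
          (\<Sum>l=1..p-1. of_real (sin (2 * l * pi * k / p)) * hurwitz_zeta s (l / p)))" if "s \<noteq> 1" for s
    unfolding A.eta_Legendre[OF that] A.inner_sum_1[OF refl] by simp
  have e2: "eta_fun (Gamma_p D) L \<epsilon>\<^sub>2 \<rho> s =
       - 2 / (of_real (sqrt p) * of_real (2 * pi * p) powr s) *
       (\<Sum>k=1..p-1. A.chi k * (- 1) ^ k * of_int (Legendre k p) *
          (\<Sum>l=0..p-1. of_real (sin ((2 * l + 1) * pi * k / p)) * hurwitz_zeta s ((2 * l + 1) / (2 * p))))" if "s \<noteq> 1" for s
    unfolding B.eta_Legendre[OF that] B.inner_sum_half[OF refl] by (simp add: A.chi_def B.chi_def add.commute)
  have i1: "eta_invariant (Gamma_p D) L \<epsilon>\<^sub>1 \<rho> =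
       - 2 / of_real (sqrt p) *
       (\<Sum>k=1..(p-1) div 2. of_real (Re (A.chi k)) * of_int (Legendre k p) * of_real (cot (k * pi / p)))"
    unfolding eta_invariant_def A.eta_0_cot A.half_cot_1[OF refl] by simp
  have i2: "eta_invariant (Gamma_p D) L \<epsilon>\<^sub>2 \<rho> =
       - 2 / of_real (sqrt p) *
       (\<Sum>k=1..(p-1) div 2. of_real (Re (A.chi k)) * (- 1) ^ k * of_int (Legendre k p) * of_real (1 / sin (k * pi / p)))"
    unfolding eta_invariant_def B.eta_0_cot B.half_cot_half[OF refl] by (simp add: A.chi_def B.chi_def)
  have conv: "\<forall>\<epsilon>\<in>{\<epsilon>\<^sub>1, \<epsilon>\<^sub>2}. \<forall>s. Re s > p \<longrightarrow>
       (eta_term (Gamma_p D) L \<epsilon> \<rho> s has_sum eta_fun (Gamma_p D) L \<epsilon> \<rho> s)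
         (eigenvalues (Gamma_p D) L \<epsilon> \<rho> - {0})"
    using A.eta_has_sum_eta_fun B.eta_has_sum_eta_fun by blast
  let ?c = "A.chi 1"
  have g: "\<rho> gamma_p = \<rho> (gamma_p ^^ 1)" by simp
  have const: "(\<forall>s. s \<noteq> 1 \<longrightarrow> eta_fun (Gamma_p D) L \<epsilon>\<^sub>1 \<rho> s =
         - 2 * ?c / (of_real (sqrt p) * of_real (2 * pi * p) powr s) *
         (\<Sum>k=1..p-1. of_int (Legendre k p) *
            (\<Sum>l=1..p-1. of_real (sin (2 * l * pi * k / p)) * hurwitz_zeta s (l / p)))) \<and>
       (\<forall>s. s \<noteq> 1 \<longrightarrow> eta_fun (Gamma_p D) L \<epsilon>\<^sub>2 \<rho> s =
         - 2 * ?c / (of_real (sqrt p) * of_real (2 * pi * p) powr s) *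
         (\<Sum>k=1..p-1. (- 1) ^ k * of_int (Legendre k p) *
            (\<Sum>l=0..p-1. of_real (sin ((2 * l + 1) * pi * k / p)) * hurwitz_zeta s ((2 * l + 1) / (2 * p))))) \<and>
       eta_invariant (Gamma_p D) L \<epsilon>\<^sub>1 \<rho> =
         - 2 * ?c / of_real (sqrt p) *
         (\<Sum>k=1..(p-1) div 2. of_int (Legendre k p) * of_real (cot (k * pi / p))) \<and>
       eta_invariant (Gamma_p D) L \<epsilon>\<^sub>2 \<rho> =
         - 2 * ?c / of_real (sqrt p) *
         (\<Sum>k=1..(p-1) div 2. (- 1) ^ k * of_int (Legendre k p) * of_real (1 / sin (k * pi / p)))"
    if H: "\<And>k. k \<in> {1..p-1} \<Longrightarrow> A.chi k = ?c"
  proof -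
    have c: "complex_of_real (Re ?c) = ?c" by (rule A.chi_const[OF H])
    have factor: "- 2 / z * (\<Sum>k=1..p-1. A.chi k * f k) = - 2 * ?c / z * (\<Sum>k=1..p-1. f k)" for z and f :: "nat \<Rightarrow> complex"
    proof -
      have "(\<Sum>k=1..p-1. A.chi k * f k) = ?c * (\<Sum>k=1..p-1. f k)"
        unfolding sum_distrib_left by (intro sum.cong refl) (simp only: H)
      then show ?thesis by simp
    qed
    have factor': "- 2 / z * (\<Sum>k=1..(p-1) div 2. of_real (Re (A.chi k)) * f k) = - 2 * ?c / z * (\<Sum>k=1..(p-1) div 2. f k)" for z and f :: "nat \<Rightarrow> complex"
    proof -
      have "(\<Sum>k=1..(p-1) div 2. of_real (Re (A.chi k)) * f k) = ?c * (\<Sum>k=1..(p-1) div 2. f k)"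
        unfolding sum_distrib_left
      proof (intro sum.cong refl)
        fix k assume "k \<in> {1..(p-1) div 2}"
        then have "k \<in> {1..p-1}" by auto
        then show "of_real (Re (A.chi k)) * f k = ?c * f k" by (simp only: H c)
      qed
      then show ?thesis by simp
    qed
    show ?thesis
      by (intro conjI allI impI)
        (simp_all only: e1 e2 i1 i2 mult.assoc factor factor' not_False_eq_True)
  qed
  show ?thesis
    unfolding g chi
    by (intro conjI conv allI impI e1 e2 i1 i2) (use const in blast)+
qed

end
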